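(* Let $m \geq 1$ be any positive integer and let $$u \in C([0,T]; V^{2}(S)),\qquad \omega \in C([0,T]; V^{1}(S))$$ be a solution of the 1D model $$u_t + v u_z = 0,\qquad \omega_t + v\omega_z = u_z,\qquad v_z = H\omega,$$ with $v(\cdot,t)$ of zero mean, and with initial data $u(\cdot,0)=u_0 \in V^{m+1}(S)$, $\omega(\cdot,0)=\omega_0 \in V^{m}(S)$. Then $$u \in C([0,T]; V^{m+1}(S)),\qquad \omega \in C([0,T]; V^{m}(S)).$$ In particular, $u(\cdot,t),\,\omega(\cdot,t) \in C^{\infty}(S)$ for each $t \in [0,T]$ if $u_0,\,\omega_0 \in C^{\infty}(S)$.
   Context: Fix $L>0$. $S$ is the circle of circumference $L$ (functions on $S$ are $L$-periodic functions of $z$), and $H^k(S)$ is the real $L^2$-based Sobolev space on $S$. For an integer $k\ge 0$, $V^k(S)=\{f\in H^k(S): \bar f=0\}$, where $\bar f=\frac1L\int_0^L f(z)\,dz$, with norm $\|f\|_{V^k}=\big[\int_0^L|\partial_z^k f(z)|^2\,dz\big]^{1/2}$. The symbol $H$ applied to a function denotes the periodic Hilbert transform $H\omega(z)=\frac1L\,\mathrm{P.V.}\int_0^L\omega(y)\cot[\mu(z-y)]\,dy$, $\mu=\pi/L$. At each time the velocity $v$ is the unique zero-mean $L$-periodic function with $v_z=H\omega$. *)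

theory Defs
  imports "HOL-Analysis.Analysis"
begin

text \<open>
  The circle \<open>S\<close> of circumference \<open>L\<close>: functions on \<open>S\<close> are \<open>L\<close>-periodic functions on the reals.
  Elements of \<open>L\<^sup>2(S)\<close> and of the Sobolev spaces are represented by (everywhere defined, Borel)
  functions; the spaces, norms and equations below do not depend on the choice of the representative,
  whereas \<open>smooth_fun\<close> consists of pointwise smooth functions (and serves as the test functions).
\<close>

definition periodic :: "real \<Rightarrow> (real \<Rightarrow> real) \<Rightarrow> bool" where
  "periodic L f \<longleftrightarrow> (\<forall>z. f (z + L) = f z)"

definition smooth_fun :: "real \<Rightarrow> (real \<Rightarrow> real) set" where
  "smooth_fun L = {f. periodic L f \<and> (\<forall>n z. (deriv ^^ n) f differentiable (at z))}"

definition L2 :: "real \<Rightarrow> (real \<Rightarrow> real) set" where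
  "L2 L = {f. periodic L f \<and> f \<in> borel_measurable borel \<and>
              set_integrable lborel {0..L} (\<lambda>z. (f z)\<^sup>2)}"

definition L2_norm :: "real \<Rightarrow> (real \<Rightarrow> real) \<Rightarrow> real" where
  "L2_norm L f = sqrt (LINT z:{0..L}|lborel. (f z)\<^sup>2)"

definition mean :: "real \<Rightarrow> (real \<Rightarrow> real) \<Rightarrow> real" where
  "mean L f = (1 / L) * (LINT z:{0..L}|lborel. f z)"

definition has_weak_deriv :: "real \<Rightarrow> nat \<Rightarrow> (real \<Rightarrow> real) \<Rightarrow> (real \<Rightarrow> real) \<Rightarrow> bool" where
  "has_weak_deriv L k f g \<longleftrightarrow> f \<in> L2 L \<and> g \<in> L2 L \<and>
     (\<forall>\<phi>\<in>smooth_fun L.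
        (LINT z:{0..L}|lborel. f z * (deriv ^^ k) \<phi> z) =
        (- 1) ^ k * (LINT z:{0..L}|lborel. g z * \<phi> z))"

text \<open>A representative of the weak derivative, which is unique up to null sets.\<close>

definition weak_deriv :: "real \<Rightarrow> nat \<Rightarrow> (real \<Rightarrow> real) \<Rightarrow> real \<Rightarrow> real" where
  "weak_deriv L k f = (SOME g. has_weak_deriv L k f g)"

definition sobolev :: "real \<Rightarrow> nat \<Rightarrow> (real \<Rightarrow> real) set" where
  "sobolev L k = {f \<in> L2 L. \<forall>j\<le>k. \<exists>g. has_weak_deriv L j f g}"

definition V_space :: "real \<Rightarrow> nat \<Rightarrow> (real \<Rightarrow> real) set" where
  "V_space L k = {f \<in> sobolev L k. mean L f = 0}"

definition V_norm :: "real \<Rightarrow> nat \<Rightarrow> (real \<Rightarrow> real) \<Rightarrow> real" where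
  "V_norm L k f = sqrt (LINT z:{0..L}|lborel. \<bar>weak_deriv L k f z\<bar>\<^sup>2)"

definition C_V :: "real \<Rightarrow> real \<Rightarrow> nat \<Rightarrow> (real \<Rightarrow> real \<Rightarrow> real) set" where
  "C_V L T k = {f. (\<forall>t\<in>{0..T}. f t \<in> V_space L k) \<and>
     (\<forall>t\<in>{0..T}. ((\<lambda>s. V_norm L k (\<lambda>z. f s z - f t z)) \<longlongrightarrow> 0) (at t within {0..T}))}"

text \<open>
  Elements of Sobolev spaces are classes modulo null sets, so such an element belongs to
  \<open>C\<^sup>\<infinity>(S)\<close> if it has a smooth representative.
\<close>

definition C_infinity :: "real \<Rightarrow> (real \<Rightarrow> real) set" where
  "C_infinity L = {f. periodic L f \<and> (\<exists>g\<in>smooth_fun L. AE z in lborel. f z = g z)}"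

text \<open>
  The principal value is taken on the circle: an \<open>\<epsilon>\<close>-neighbourhood of \<open>z\<close> modulo \<open>L\<close> is removed from
  the period, i.e. of all the singularities of \<open>y \<mapsto> cot (\<pi> (z - y) / L)\<close>.
\<close>

definition hilbert :: "real \<Rightarrow> (real \<Rightarrow> real) \<Rightarrow> real \<Rightarrow> real" where
  "hilbert L w z = (1 / L) * Lim (at_right 0)
     (\<lambda>\<epsilon>. LINT y:{y \<in> {0..L}. \<forall>n::int. \<epsilon> \<le> \<bar>z - y - of_int n * L\<bar>}|lborel.
        w y * cot (pi / L * (z - y)))"

definition is_velocity :: "real \<Rightarrow> (real \<Rightarrow> real) \<Rightarrow> (real \<Rightarrow> real) \<Rightarrow> bool" where
  "is_velocity L w v \<longleftrightarrow> has_weak_deriv L 1 v (hilbert L w) \<and> mean L v = 0"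

text \<open>The time derivative is that of \<open>L\<^sup>2(S)\<close>-valued functions, one-sided at \<open>0\<close> and \<open>T\<close>.\<close>

definition has_time_deriv ::
  "real \<Rightarrow> real \<Rightarrow> (real \<Rightarrow> real \<Rightarrow> real) \<Rightarrow> (real \<Rightarrow> real) \<Rightarrow> real \<Rightarrow> bool" where
  "has_time_deriv L T f d t \<longleftrightarrow> (\<forall>s\<in>{0..T}. f s \<in> L2 L) \<and> d \<in> L2 L \<and>
     ((\<lambda>s. L2_norm L (\<lambda>z. (f s z - f t z) / (s - t) - d z)) \<longlongrightarrow> 0) (at t within {0..T})"

definition solves_model ::
  "real \<Rightarrow> real \<Rightarrow> (real \<Rightarrow> real \<Rightarrow> real) \<Rightarrow> (real \<Rightarrow> real \<Rightarrow> real) \<Rightarrow> (real \<Rightarrow> real \<Rightarrow> real) \<Rightarrow> bool" where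
  "solves_model L T u \<omega> v \<longleftrightarrow> (\<forall>t\<in>{0..T}.
     is_velocity L (\<omega> t) (v t) \<and>
     has_time_deriv L T u (\<lambda>z. - (v t z * weak_deriv L 1 (u t) z)) t \<and>
     has_time_deriv L T \<omega> (\<lambda>z. weak_deriv L 1 (u t) z - v t z * weak_deriv L 1 (\<omega> t) z) t)"

end

(* The Fourier coefficients of u_z and omega satisfy an infinite system of ordinary differential
   equations, and multiplication by v becomes a convolution. The energy is the sum over k of
   w(k)^2 (|u_z(k)|^2 + |omega(k)|^2) with the saturated weight w(k) = min(|k|, N)^m. The transport
   term is antisymmetric up to the commutator of w with v d/dz, and |l| |w(k) - w(l)| is at most
   C |k - l| (w(l) + w(k - l)) uniformly in N. As v_z is the Hilbert transform of omega, and u_z and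
   omega lie in H^1, hence have absolutely summable Fourier coefficients, Young's inequality bounds
   the time derivative of the energy by a multiple of the energy that does not depend on N.
   Gronwall's inequality and N tending to infinity give the bound in the Sobolev space; the same
   estimate makes the full energy Lipschitz in time, and together with the continuity of the
   individual coefficients this gives strong continuity. *)

theory Submission
  imports Defs "HOL-Real_Asymp.Real_Asymp"
begin

section \<open>Square-integrable functions and Fourier coefficients\<close>

text \<open>The solution is only known to lie in the base spaces, so the energy of order
  \<open>m\<close> may a priori be infinite. Saturating the weight at \<open>N\<close> makes it
  finite, but only single coefficients are known to be differentiable in time; hence the sum is also
  cut off at \<open>\<bar>k\<bar> \<le> K\<close>. The cutoff breaks the antisymmetry for
  frequencies \<open>l\<close> beyond \<open>K\<close>; these are paid for by a uniform H^1 bound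
  \<open>M\<close> and contribute O(1/K) for fixed \<open>N\<close>. So \<open>K\<close> goes to
  infinity first, and the constants in the surviving terms must be free of \<open>N\<close>. The
  energy pairs u_z with omega because the differentiated first equation has the extra term v_z u_z,
  of the same order as u_z, while the coupling u_z in the second equation is then of order zero. The
  Hilbert transform is given pointwise as a principal value, so its multiplier has to be derived:
  the coefficients of the truncated cotangent kernel are computed explicitly, and their errors grow
  only logarithmically in the frequency, which H^1 data can absorb.\<close>

definition circ :: "real \<Rightarrow> real measure" where
  "circ L = restrict_space lborel {0..L}"

definition ee :: "real \<Rightarrow> int \<Rightarrow> real \<Rightarrow> complex" where
  "ee L k z = cis (2 * pi / L * of_int k * z)"

text \<open>The factor \<open>1 / L\<close> makes products correspond to convolutions without a
  constant; in exchange Parseval carries a factor \<open>L\<close>.\<close>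

definition fc :: "real \<Rightarrow> (real \<Rightarrow> real) \<Rightarrow> int \<Rightarrow> complex" where
  "fc L f k = (1 / L) * (\<integral>z. of_real (f z) * ee L (- k) z \<partial>circ L)"

lemma space_circ [simp]: "space (circ L) = {0..L}" by (simp add: circ_def space_restrict_space)

lemma borel_measurable_circ:
  "f \<in> borel_measurable borel \<Longrightarrow> f \<in> borel_measurable (circ L)"
  unfolding circ_def by (rule measurable_restrict_space1) simp

lemma ident_measurable_circ [measurable]: "(\<lambda>x. x) \<in> borel_measurable (circ L)" by (rule borel_measurable_circ) simp

lemma integral_circ:
  fixes f :: "real \<Rightarrow> 'a::{banach, second_countable_topology}"
  shows "(LINT z:{0..L}|lborel. f z) = integral\<^sup>L (circ L) f"
  unfolding set_lebesgue_integral_def circ_def by (subst integral_restrict_space) auto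

lemma integrable_circ:
  fixes f :: "real \<Rightarrow> 'a::{banach, second_countable_topology}"
  shows "set_integrable lborel {0..L} f \<longleftrightarrow> integrable (circ L) f"
  unfolding set_integrable_def circ_def by (subst integrable_restrict_space) auto

lemma finite_measure_circ: "finite_measure (circ L)"
  by (rule finite_measureI) (simp add: circ_def emeasure_restrict_space space_restrict_space emeasure_lborel_Icc_eq)

lemma AE_circ:
  assumes "AE z in lborel. P z" shows "AE z in circ L. P z"
  unfolding circ_def using assms by (subst AE_restrict_space_iff) auto

text \<open>Both endpoints represent the same point of the circle. Off them \<open>ee L 1\<close> is
  injective on the period, and small neighbourhoods stay inside it.\<close>

lemma AE_interior: "AE z in circ L. z \<noteq> 0 \<and> z \<noteq> L"
  by (rule AE_circ) (use AE_lborel_singleton[of 0] AE_lborel_singleton[of L] in auto)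

lemma ee_add: "ee L (j + k) z = ee L j z * ee L k z" by (simp add: ee_def cis_mult ring_distribs)

lemma ee_0 [simp]: "ee L 0 z = 1" by (simp add: ee_def)

lemma norm_ee [simp]: "cmod (ee L k z) = 1" by (simp add: ee_def)

lemma cnj_ee: "cnj (ee L k z) = ee L (- k) z" by (simp add: ee_def cis_cnj)

lemma ee_measurable [measurable]: "ee L k \<in> borel_measurable borel" unfolding ee_def[abs_def] cis_conv_exp
  by (intro borel_measurable_continuous_onI continuous_intros)

lemma continuous_on_ee: "continuous_on S (ee L k)" unfolding ee_def[abs_def] cis_conv_exp by (intro continuous_intros)

definition trig_sum :: "real \<Rightarrow> (int \<Rightarrow> complex) \<Rightarrow> nat \<Rightarrow> real \<Rightarrow> complex" where
  "trig_sum L c J z = (\<Sum>k\<in>{- int J..int J}. c k * ee L k z)"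

lemma trig_sum_measurable [measurable]: "trig_sum L c J \<in> borel_measurable borel" unfolding trig_sum_def[abs_def]
  by (intro borel_measurable_sum borel_measurable_times borel_measurable_const ee_measurable)

text \<open>Conjugation only permutes the terms, because the index range is symmetric.\<close>

lemma trig_sum_real:
  assumes "\<And>k. c (- k) = cnj (c k)"
  shows "trig_sum L c J z = of_real (Re (trig_sum L c J z))"
proof -
  have "cnj (trig_sum L c J z) = (\<Sum>k\<in>{- int J..int J}. c (- k) * ee L (- k) z)" by (simp add: trig_sum_def assms cnj_ee)
  also have "\<dots> = trig_sum L c J z" unfolding trig_sum_def by (rule sum.reindex_bij_witness[of _ uminus uminus]) auto
  finally show ?thesis by (metis Reals_cnj_iff of_real_Re)
qed

locale circle =
  fixes L :: real
  assumes L_pos: "L > 0"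
begin

sublocale circ: finite_measure "circ L" by (rule finite_measure_circ)

lemma measure_circ: "measure (circ L) (space (circ L)) = L" using L_pos by (simp add: circ_def measure_restrict_space)

lemma integrable_bounded:
  fixes f :: "real \<Rightarrow> 'a::{banach, second_countable_topology}"
  assumes "f \<in> borel_measurable (circ L)" "\<And>z. norm (f z) \<le> B"
  shows "integrable (circ L) f"
  by (rule circ.integrable_const_bound[where B=B]) (use assms in simp_all)

lemma ee_periodic: "ee L k (z + L) = ee L k z"
proof -
  have "2 * pi / L * of_int k * (z + L) = 2 * pi / L * of_int k * z + 2 * pi * of_int k" using L_pos by (simp add: field_simps)
  then show ?thesis unfolding ee_def by (simp add: cis_mult[symmetric] cis_multiple_2pi)
qed

lemma ee_has_vector_derivative:
  "(ee L k has_vector_derivative (\<i> * of_real (2 * pi / L * of_int k) * ee L k z)) (at z within S)"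
proof -
  define c where "c = \<i> * of_real (2 * pi / L * of_int k)"
  have "ee L k = (\<lambda>z. exp (c * of_real z))" by (rule ext) (simp add: ee_def cis_conv_exp c_def mult_ac)
  moreover have "((\<lambda>z. exp (c * of_real z)) has_vector_derivative (c * exp (c * of_real z))) (at z within S)"
    by (rule has_vector_derivative_real_field) (auto intro!: derivative_eq_intros)
  ultimately show ?thesis unfolding c_def by simp
qed

lemma ee_0_eq_L: "ee L k L = ee L k 0" using ee_periodic[of k 0] by simp

lemma integral_ee: "integral\<^sup>L (circ L) (ee L k) = (if k = 0 then of_real L else 0)"
proof (cases "k = 0")
  case True
  have "ee L 0 = (\<lambda>z. 1)" by auto
  then show ?thesis using True measure_circ by (simp add: scaleR_conv_of_real)
next
  case False
  define c where "c = \<i> * of_real (2 * pi / L * of_int k)"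
  have c: "c \<noteq> 0" using False L_pos by (simp add: c_def)
  have "(LINT z:{0..L}|lborel. c * ee L k z) = ee L k L - ee L k 0" unfolding set_lebesgue_integral_def
  proof (rule integral_FTC_Icc)
    show "continuous_on {0..L} (\<lambda>z. c * ee L k z)" by (intro continuous_on_mult continuous_on_const continuous_on_ee)
    show "(ee L k has_vector_derivative c * ee L k z) (at z within {0..L})" for z unfolding c_def by (rule ee_has_vector_derivative)
  qed (use L_pos in simp)
  then have "c * integral\<^sup>L (circ L) (ee L k) = 0" by (simp add: integral_circ ee_0_eq_L)
  then show ?thesis using c False by simp
qed

section \<open>Trigonometric polynomials and uniqueness of Fourier coefficients\<close>

inductive trig_poly :: "(real \<Rightarrow> complex) \<Rightarrow> bool" where
  trig_ee: "trig_poly (\<lambda>z. c * ee L k z)"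
| trig_add: "trig_poly f \<Longrightarrow> trig_poly g \<Longrightarrow> trig_poly (\<lambda>z. f z + g z)"

lemma trig_poly_mult_ee: "trig_poly f \<Longrightarrow> trig_poly (\<lambda>z. c * ee L k z * f z)"
proof (induction rule: trig_poly.induct)
  case (trig_ee d l)
  have "(\<lambda>z. c * ee L k z * (d * ee L l z)) = (\<lambda>z. (c * d) * ee L (k + l) z)" by (auto simp: ee_add mult_ac)
  then show ?case using trig_poly.trig_ee by simp
next
  case (trig_add f g)
  then show ?case using trig_poly.trig_add[OF trig_add.IH] by (simp add: ring_distribs)
qed

lemma trig_poly_mult: "trig_poly f \<Longrightarrow> trig_poly g \<Longrightarrow> trig_poly (\<lambda>z. f z * g z)"
proof (induction rule: trig_poly.induct)
  case (trig_ee d l)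
  then show ?case by (rule trig_poly_mult_ee)
next
  case (trig_add f h)
  then show ?case using trig_poly.trig_add[OF trig_add.IH] by (simp add: ring_distribs)
qed

text \<open>The polynomials in Stone-Weierstrass are built from real-linear functionals of the point
  \<open>w = ee L 1 z\<close>. Such a functional is a combination of \<open>w\<close> and its
  conjugate, and on the unit circle the conjugate is the character of frequency
  \<open>- 1\<close>.\<close>

lemma trig_poly_real_polynomial:
  assumes "real_polynomial_function p"
  shows "trig_poly (\<lambda>z. of_real (p (ee L 1 z)))"
  using assms
proof (induction rule: real_polynomial_function.induct)
  case (linear h)
  \<comment> \<open>From \<open>h w = Re w * h 1 + Im w * h \<i>\<close>, with the real and
    imaginary parts expressed by \<open>w + cnj w\<close> and \<open>w - cnj w\<close>.\<close>
  define a where "a = complex_of_real (h 1) / 2"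
  define b where "b = complex_of_real (h \<i>) / (2 * \<i>)"
  interpret bounded_linear h by fact
  have "of_real (h (ee L 1 z)) = (a + b) * ee L 1 z + (a - b) * ee L (- 1) z" for z
  proof -
    define w where "w = ee L 1 z"
    have "h w = h (Re w *\<^sub>R 1 + Im w *\<^sub>R \<i>)" by (rule arg_cong[of _ _ h]) (simp add: complex_eq_iff)
    also have "\<dots> = Re w * h 1 + Im w * h \<i>" by (simp only: add scale real_scaleR_def)
    finally have "h w = Re w * h 1 + Im w * h \<i>" .
    moreover have "ee L (- 1) z = cnj w" by (simp add: w_def cnj_ee)
    moreover have "(a + b) * w + (a - b) * cnj w = a * (w + cnj w) + b * (w - cnj w)" by (simp only: ring_distribs) simp
    moreover have "a * (w + cnj w) = of_real (Re w * h 1)" by (simp add: a_def complex_add_cnj)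
    moreover have "b * (w - cnj w) = of_real (Im w * h \<i>)" by (simp add: b_def complex_diff_cnj complex_eq_iff)
    ultimately show ?thesis unfolding w_def[symmetric] by simp
  qed
  then have "(\<lambda>z. of_real (h (ee L 1 z))) = (\<lambda>z. (a + b) * ee L 1 z + (a - b) * ee L (- 1) z)" by (rule ext)
  then show ?case using trig_add[OF trig_ee[of "a + b" 1] trig_ee[of "a - b" "- 1"]] by (simp only:)
next
  case (const c)
  then show ?case using trig_ee[of "of_real c" 0] by simp
next
  case (add f g)
  show ?case unfolding of_real_add by (rule trig_poly.trig_add[OF add.IH])
next
  case (mult f g)
  show ?case unfolding of_real_mult by (rule trig_poly_mult[OF mult.IH])
qed

text \<open>Integrability is carried through the induction, since the sum rule for integrals needs
  it.\<close>

lemma integral_trig_poly_eq_0: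
  assumes "trig_poly p" and g: "integrable (circ L) g" and "\<And>k. fc L g k = 0"
  shows "integrable (circ L) (\<lambda>z. of_real (g z) * p z) \<and> (\<integral>z. of_real (g z) * p z \<partial>circ L) = 0"
  using assms(1)
proof (induction rule: trig_poly.induct)
  case (trig_ee c k)
  have i: "integrable (circ L) (\<lambda>z. of_real (g z) * ee L k z)"
    by (rule Bochner_Integration.integrable_bound[OF g]) (use g in \<open>auto simp: norm_mult\<close>)
  have "(\<integral>z. of_real (g z) * ee L k z \<partial>circ L) = 0" using assms(3)[of "- k"] L_pos by (simp add: fc_def)
  then have "(\<integral>z. c * (of_real (g z) * ee L k z) \<partial>circ L) = 0" by simp
  moreover have "integrable (circ L) (\<lambda>z. c * (of_real (g z) * ee L k z))" using i by simp
  moreover have "(\<lambda>z. c * (of_real (g z) * ee L k z)) = (\<lambda>z. of_real (g z) * (c * ee L k z))" by (auto simp: mult_ac)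
  ultimately show ?case by simp
next
  case (trig_add f h)
  then show ?case by (simp add: ring_distribs)
qed

text \<open>Stone-Weierstrass approximates \<open>F\<close> uniformly on the unit circle by
  polynomials, which are orthogonal to \<open>g\<close>; the error is at most \<open>e\<close> times
  the L1 norm of \<open>g\<close>.\<close>

lemma integral_continuous_eq_0:
  assumes g: "integrable (circ L) g" and "\<And>k. fc L g k = 0" and F: "continuous_on UNIV F"
  shows "(\<integral>z. g z * F (ee L 1 z) \<partial>circ L) = 0"
proof -
  have [measurable]: "g \<in> borel_measurable (circ L)" using g by auto
  have Fm[measurable]: "F \<in> borel_measurable borel" using F by (rule borel_measurable_continuous_onI)
  have cS: "compact (sphere (0::complex) 1)" by (rule compact_sphere)
  have cF: "continuous_on (sphere 0 1) F" using F continuous_on_subset by blast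
  have "bounded (F ` sphere 0 1)" using compact_continuous_image[OF cF cS] compact_imp_bounded by blast
  then obtain B where B: "\<And>w. w \<in> sphere 0 1 \<Longrightarrow> \<bar>F w\<bar> \<le> B" by (force simp: bounded_iff)
  have iF: "integrable (circ L) (\<lambda>z. g z * F (ee L 1 z))"
  proof (rule Bochner_Integration.integrable_bound[OF integrable_mult_right[OF integrable_norm[OF g], of B]])
    show "AE z in circ L. norm (g z * F (ee L 1 z)) \<le> norm (B * norm (g z))"
    proof (rule AE_I2)
      fix z
      have "\<bar>g z\<bar> * \<bar>F (ee L 1 z)\<bar> \<le> \<bar>g z\<bar> * \<bar>B\<bar>"
        using B[of "ee L 1 z"] by (intro mult_left_mono) auto
      then show "norm (g z * F (ee L 1 z)) \<le> norm (B * norm (g z))" by (simp add: abs_mult mult.commute)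
    qed
  qed simp
  have "\<bar>\<integral>z. g z * F (ee L 1 z) \<partial>circ L\<bar> \<le> e * (\<integral>z. \<bar>g z\<bar> \<partial>circ L)" if e: "e > 0" for e
  proof -
    obtain p where p: "real_polynomial_function p" "\<And>x. x \<in> sphere 0 1 \<Longrightarrow> \<bar>F x - p x\<bar> < e"
      using Stone_Weierstrass_real_polynomial_function[OF cS cF e] by blast
    have "trig_poly (\<lambda>z. of_real (p (ee L 1 z)))" using trig_poly_real_polynomial[OF p(1)] .
    from integral_trig_poly_eq_0[OF this g assms(2)]
    have ip: "integrable (circ L) (\<lambda>z. g z * p (ee L 1 z))" and p0: "(\<integral>z. g z * p (ee L 1 z) \<partial>circ L) = 0"
      by (auto simp: complex_of_real_integrable_eq simp flip: of_real_mult)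
    have "(\<integral>z. g z * F (ee L 1 z) \<partial>circ L) = (\<integral>z. g z * F (ee L 1 z) - g z * p (ee L 1 z) \<partial>circ L)"
      using iF ip p0 by simp
    also have "\<bar>\<dots>\<bar> \<le> (\<integral>z. e * \<bar>g z\<bar> \<partial>circ L)"
    proof (rule order.trans[OF integral_abs_bound], rule integral_mono)
      show "\<bar>g z * F (ee L 1 z) - g z * p (ee L 1 z)\<bar> \<le> e * \<bar>g z\<bar>" for z
        using mult_left_mono[OF less_imp_le[OF p(2)[of "ee L 1 z"]] abs_ge_zero[of "g z"]]
        by (simp flip: right_diff_distrib add: abs_mult mult.commute)
    qed (use iF ip g in auto)
    finally show ?thesis by simp
  qed
  then have "\<bar>\<integral>z. g z * F (ee L 1 z) \<partial>circ L\<bar> \<le> 0"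
    by (intro tendsto_le[OF _ _ tendsto_const, of "at_right 0" "\<lambda>e. e * (\<integral>z. \<bar>g z\<bar> \<partial>circ L)" 0])
       (auto intro!: tendsto_eq_intros eventually_at_right_less simp: eventually_at_filter)
  then show ?thesis by simp
qed

lemma ee_1_eq_iff:
  assumes "x \<in> {0..L}" "y \<in> {0..L}" "ee L 1 x = ee L 1 y" "x \<noteq> L" "y \<noteq> L"
  shows "x = y"
proof -
  have "sin (2 * pi / L * x) = sin (2 * pi / L * y) \<and> cos (2 * pi / L * x) = cos (2 * pi / L * y)"
    using assms(3) by (simp add: ee_def cis.ctr complex_eq_iff)
  then obtain n where n: "2 * pi / L * x = 2 * pi / L * y + 2 * pi * of_int n" using sin_cos_eq_iff by metis
  then have "(2 * pi / L) * (x - y - of_int n * L) = 0" using L_pos by (simp add: field_simps)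
  then have xy: "x = y + of_int n * L" using L_pos by simp
  have "\<bar>x - y\<bar> < L" using assms by auto
  then have "\<bar>of_int n\<bar> * L < 1 * L" using xy L_pos by (simp add: abs_mult)
  then have "\<bar>of_int n :: real\<bar> < 1" using L_pos mult_less_cancel_right_pos by blast
  then have "n = 0" by linarith
  then show ?thesis using xy by simp
qed

text \<open>Vanishing integrals pass from continuous functions of \<open>ee L 1 z\<close> to
  indicators of closed sets by dominated convergence, and then to all Borel sets, because the closed
  sets are a generator stable under intersection. A function whose integrals over all measurable
  sets vanish is zero almost everywhere.\<close>

lemma fc_eq_0_imp_AE:
  assumes g: "integrable (circ L) g" and "\<And>k. fc L g k = 0"
  shows "AE z in circ L. g z = 0"
proof -
  let ?I = "\<lambda>A. \<integral>z. indicator A z * g z \<partial>circ L"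
  have [measurable]: "g \<in> borel_measurable (circ L)" using g by auto
  have closed: "?I C = 0" if "closed C" for C
  proof -
    \<comment> \<open>The set is transported to the unit circle, so that the approximating functions
      respect the identification of \<open>0\<close> with \<open>L\<close>.\<close>
    define K where "K = ee L 1 ` (C \<inter> {0..L})"
    have "compact (C \<inter> {0..L})" using \<open>closed C\<close> compact_Int_closed by (simp add: closed_Int_compact)
    then have K: "compact K" unfolding K_def using continuous_on_ee compact_continuous_image by blast
    show ?thesis
    proof (cases "K = {}")
      case True
      then have "C \<inter> {0..L} = {}" by (simp add: K_def)
      then have "?I C = (\<integral>z. 0 \<partial>circ L)" by (intro Bochner_Integration.integral_cong) (auto simp: indicator_def)
      then show ?thesis by simp
    next
      case False
      \<comment> \<open>Continuous tents, equal to \<open>1\<close> on \<open>K\<close> and to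
        \<open>0\<close> from distance \<open>1 / n\<close> on; they tend to the indicator because
        \<open>K\<close> is closed.\<close>
      define F where "F n w = max 0 (1 - real n * infdist w K)" for n w
      have cF: "continuous_on UNIV (F n)" for n unfolding F_def by (intro continuous_intros)
      have [measurable]: "F n \<in> borel_measurable borel" for n using cF by (rule borel_measurable_continuous_onI)
      have F1: "F n w \<ge> 0" "F n w \<le> 1" for n w unfolding F_def by (auto simp: infdist_nonneg)
      have lim: "(\<lambda>n. F n w) \<longlonglongrightarrow> indicator K w" for w
      proof (cases "w \<in> K")
        case True then show ?thesis by (simp add: F_def)
      next
        case w: False
        have "infdist w K > 0" using K w False by (metis compact_imp_closed in_closed_iff_infdist_zero infdist_nonneg less_eq_real_def)
        then have "eventually (\<lambda>n. real n * infdist w K > 1) sequentially" by real_asymp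
        then have "eventually (\<lambda>n. F n w = 0) sequentially" by eventually_elim (simp add: F_def)
        then show ?thesis using w by (simp add: tendsto_eventually)
      qed
      have "(\<lambda>n. \<integral>z. g z * F n (ee L 1 z) \<partial>circ L) \<longlonglongrightarrow> (\<integral>z. g z * indicator K (ee L 1 z) \<partial>circ L)"
      proof (rule integral_dominated_convergence[where w="\<lambda>z. \<bar>g z\<bar>"])
        have [measurable]: "K \<in> sets borel" using K borel_compact by blast
        show "(\<lambda>z. g z * indicator K (ee L 1 z)) \<in> borel_measurable (circ L)" by measurable
        show "AE z in circ L. (\<lambda>n. g z * F n (ee L 1 z)) \<longlonglongrightarrow> g z * indicator K (ee L 1 z)"
          by (intro AE_I2 tendsto_intros lim)
        show "AE z in circ L. norm (g z * F n (ee L 1 z)) \<le> \<bar>g z\<bar>" for n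
          by (intro AE_I2) (use F1 in \<open>auto simp: abs_mult intro: mult_left_le\<close>)
      qed (use g in auto)
      then have "(\<integral>z. g z * indicator K (ee L 1 z) \<partial>circ L) = 0"
        using integral_continuous_eq_0[OF g assms(2) cF] by (simp add: LIMSEQ_const_iff)
      moreover have "(\<integral>z. g z * indicator K (ee L 1 z) \<partial>circ L) = ?I C"
      proof (rule integral_cong_AE)
        have [measurable]: "K \<in> sets borel" using K borel_compact by blast
        have [measurable]: "C \<in> sets borel" using that by auto
        show "(\<lambda>z. g z * indicator K (ee L 1 z)) \<in> borel_measurable (circ L)" by measurable
        show "(\<lambda>z. indicator C z * g z) \<in> borel_measurable (circ L)" by measurable
        show "AE z in circ L. g z * indicator K (ee L 1 z) = indicator C z * g z" using AE_space[of "circ L"] AE_interior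
        proof eventually_elim
          case (elim z)
          have "ee L 1 z \<in> K \<longleftrightarrow> z \<in> C"
          proof
            assume "ee L 1 z \<in> K"
            then obtain y where y: "y \<in> C" "y \<in> {0..L}" "ee L 1 z = ee L 1 y" by (auto simp: K_def)
            have "y = z"
            proof (cases "y = L")
              \<comment> \<open>\<open>L\<close> and \<open>0\<close> have the same image on the
                unit circle, so \<open>z\<close> would be an endpoint.\<close>
              case True
              have "ee L 1 z = ee L 1 0" using y True ee_0_eq_L by simp
              then have "z = 0" using ee_1_eq_iff[of z 0] elim L_pos by auto
              then show ?thesis using elim by simp
            qed (use ee_1_eq_iff[of z y] y elim in auto)
            then show "z \<in> C" using y by simp
          qed (use elim in \<open>auto simp: K_def\<close>)
          then show ?case by (simp add: indicator_def)
        qed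
      qed
      ultimately show ?thesis by simp
    qed
  qed
  have int: "integrable (circ L) (\<lambda>z. indicator A z * g z)" if "A \<in> sets borel" for A
    by (rule Bochner_Integration.integrable_bound[OF g]) (use that in \<open>auto simp: indicator_def\<close>)
  have all: "?I A = 0" if "A \<in> sets borel" for A
  proof -
    have st: "Int_stable (Collect closed :: real set set)" by (auto simp: Int_stable_def)
    have sg: "A \<in> sigma_sets UNIV (Collect closed)" using that by (simp add: borel_eq_closed sets_measure_of)
    have pw: "Collect closed \<subseteq> Pow (UNIV :: real set)" by simp
    from st pw sg show ?thesis
    proof (induction rule: sigma_sets_induct_disjoint)
      case (basic A) then show ?case using closed by auto
    next
      case empty then show ?case by simp
    next
      case (compl A)
      then have A: "A \<in> sets borel" by (simp add: borel_eq_closed sets_measure_of)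
      have "?I (UNIV - A) = (\<integral>z. indicator UNIV z * g z - indicator A z * g z \<partial>circ L)"
        by (rule Bochner_Integration.integral_cong) (auto simp: indicator_def)
      also have "\<dots> = 0" using compl int[OF A] int[of UNIV] closed[of UNIV] g by simp
      finally show ?case .
    next
      case (union A)
      then have A: "A i \<in> sets borel" for i by (auto simp: borel_eq_closed sets_measure_of)
      have lim: "(\<lambda>n. \<integral>z. (\<Sum>i<n. indicator (A i) z) * g z \<partial>circ L) \<longlonglongrightarrow> ?I (\<Union>i. A i)"
      proof (rule integral_dominated_convergence[where w="\<lambda>z. \<bar>g z\<bar>"])
        have [measurable]: "\<And>i. A i \<in> sets borel" using A .
        show "(\<lambda>z. indicator (\<Union>i. A i) z * g z) \<in> borel_measurable (circ L)" by measurable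
        show "\<And>n. (\<lambda>z. (\<Sum>i<n. indicator (A i) z) * g z) \<in> borel_measurable (circ L)" by measurable
        have ind: "(\<Sum>i<n. indicator (A i) z) = (indicator (\<Union>i<n. A i) z :: real)" for n z
          by (subst indicator_UN_disjoint) (use union in \<open>auto simp: disjoint_family_on_def\<close>)
        have "(\<lambda>n. indicator (\<Union>i<n. A i) z * g z) \<longlonglongrightarrow> indicator (\<Union>i. A i) z * g z" for z
          by (intro tendsto_intros LIMSEQ_indicator_UN)
        then show "AE z in circ L. (\<lambda>n. (\<Sum>i<n. indicator (A i) z) * g z) \<longlonglongrightarrow> indicator (\<Union>i. A i) z * g z"
          by (simp add: ind)
        show "AE z in circ L. norm ((\<Sum>i<n. indicator (A i) z) * g z) \<le> \<bar>g z\<bar>" for n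
          by (intro AE_I2, simp only: ind, simp add: indicator_def)
      qed (use g in auto)
      have "(\<integral>z. (\<Sum>i<n. indicator (A i) z) * g z \<partial>circ L) = 0" for n
        unfolding sum_distrib_right using union int[OF A] by (subst Bochner_Integration.integral_sum) auto
      then show ?case using lim by (simp add: LIMSEQ_const_iff)
    qed
  qed
  show ?thesis
  proof (rule circ.density_zero[OF g])
    fix A assume "A \<in> sets (circ L)"
    then have "A \<in> sets borel" by (auto simp: circ_def sets_restrict_space)
    then show "set_lebesgue_integral (circ L) A g = 0" using all by (simp add: set_lebesgue_integral_def)
  qed
qed

end

section \<open>Inequalities and completeness in L2\<close>

lemma L2_iff:
  "f \<in> L2 L \<longleftrightarrow> periodic L f \<and> f \<in> borel_measurable borel \<and> integrable (circ L) (\<lambda>z. (f z)\<^sup>2)"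
  by (simp add: L2_def integrable_circ)

lemma L2_measurable: "f \<in> L2 L \<Longrightarrow> f \<in> borel_measurable borel" by (simp add: L2_iff)

lemma L2_norm_eq: "L2_norm L f = sqrt (\<integral>z. (f z)\<^sup>2 \<partial>circ L)" by (simp add: L2_norm_def integral_circ)

lemma abs_mult_le_sum_squares: "\<bar>x * y\<bar> \<le> x\<^sup>2 + (y :: real)\<^sup>2"
  using sum_squares_bound[of x y] sum_squares_bound[of x "- y"] zero_le_power2[of x] zero_le_power2[of y]
  unfolding abs_le_iff power2_minus mult_minus_right by linarith

lemma cmod_add_square_le: "(cmod (a + b))\<^sup>2 \<le> 2 * (cmod a)\<^sup>2 + 2 * (cmod b)\<^sup>2"
proof -
  have "(cmod (a + b))\<^sup>2 \<le> (cmod a + cmod b)\<^sup>2" by (intro power_mono norm_triangle_ineq) auto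
  also have "\<dots> \<le> 2 * (cmod a)\<^sup>2 + 2 * (cmod b)\<^sup>2" using sum_squares_bound[of "cmod a" "cmod b"] by (simp add: power2_sum)
  finally show ?thesis .
qed

lemma L2_mult_integrable:
  assumes "f \<in> L2 L" "g \<in> L2 L" shows "integrable (circ L) (\<lambda>z. f z * g z)"
proof (rule Bochner_Integration.integrable_bound)
  have [measurable]: "f \<in> borel_measurable borel" "g \<in> borel_measurable borel" using assms by (auto simp: L2_iff)
  show "integrable (circ L) (\<lambda>z. (f z)\<^sup>2 + (g z)\<^sup>2)" using assms by (auto simp: L2_iff)
  show "(\<lambda>z. f z * g z) \<in> borel_measurable (circ L)" by measurable
  show "AE z in circ L. norm (f z * g z) \<le> norm ((f z)\<^sup>2 + (g z)\<^sup>2)" using abs_mult_le_sum_squares by (simp add: AE_I2)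
qed

lemma L2_add:
  assumes "f \<in> L2 L" "g \<in> L2 L" shows "(\<lambda>z. a * f z + b * g z) \<in> L2 L"
proof -
  have [measurable]: "f \<in> borel_measurable borel" "g \<in> borel_measurable borel" using assms by (auto simp: L2_iff)
  have "(a * f z + b * g z)\<^sup>2 = a\<^sup>2 * (f z)\<^sup>2 + (2 * a * b) * (f z * g z) + b\<^sup>2 * (g z)\<^sup>2" for z
    by (simp add: power2_eq_square algebra_simps)
  then show ?thesis using assms L2_mult_integrable[OF assms] by (auto simp: L2_iff periodic_def)
qed

lemma L2_diff: "f \<in> L2 L \<Longrightarrow> g \<in> L2 L \<Longrightarrow> (\<lambda>z. f z - g z) \<in> L2 L"
  using L2_add[of f L g 1 "-1"] by simp

text \<open>The integral of \<open>(f z + t * g z)\<^sup>2\<close> is a quadratic in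
  \<open>t\<close> that is never negative.\<close>

lemma L2_Cauchy_Schwarz:
  assumes "f \<in> L2 L" "g \<in> L2 L"
  shows "(\<integral>z. f z * g z \<partial>circ L)\<^sup>2 \<le> (\<integral>z. (f z)\<^sup>2 \<partial>circ L) * (\<integral>z. (g z)\<^sup>2 \<partial>circ L)"
proof -
  define F G I where "F = (\<integral>z. (f z)\<^sup>2 \<partial>circ L)" "G = (\<integral>z. (g z)\<^sup>2 \<partial>circ L)"
    "I = (\<integral>z. f z * g z \<partial>circ L)"
  have *: "0 \<le> F + 2 * t * I + t\<^sup>2 * G" for t
  proof -
    have "0 \<le> (\<integral>z. (f z + t * g z)\<^sup>2 \<partial>circ L)" by (intro integral_nonneg_AE) simp
    also have "\<dots> = (\<integral>z. (f z)\<^sup>2 + (2 * t) * (f z * g z) + t\<^sup>2 * (g z)\<^sup>2 \<partial>circ L)"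
      by (intro Bochner_Integration.integral_cong) (auto simp: power2_eq_square algebra_simps)
    also have "\<dots> = F + 2 * t * I + t\<^sup>2 * G" using assms L2_mult_integrable[OF assms] by (simp add: L2_iff F_G_I_def)
    finally show ?thesis .
  qed
  have "G \<ge> 0" unfolding F_G_I_def by (intro integral_nonneg_AE) simp
  have "I\<^sup>2 \<le> F * G"
  proof (cases "G = 0")
    case True
    have "I = 0"
    proof (rule ccontr)
      assume "I \<noteq> 0"
      \<comment> \<open>With \<open>G = 0\<close> the quadratic is affine, and this \<open>t\<close>
        gives it the value \<open>- 1\<close>.\<close>
      then show False using *[of "- (F + 1) / (2 * I)"] True by (simp add: field_simps)
    qed
    then show ?thesis using True by simp
  next
    case False
    then have "G > 0" using \<open>G \<ge> 0\<close> by simp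
    \<comment> \<open>The choice \<open>t = - I / G\<close> minimises the quadratic.\<close>
    have "0 \<le> G * (F + 2 * (- I / G) * I + (- I / G)\<^sup>2 * G)" by (rule mult_nonneg_nonneg[OF \<open>G \<ge> 0\<close> *])
    also have "\<dots> = F * G - I\<^sup>2" using \<open>G > 0\<close> by (simp add: power2_eq_square field_simps)
    finally show ?thesis by simp
  qed
  then show ?thesis by (simp add: F_G_I_def)
qed

context circle
begin

lemma bounded_imp_L2:
  assumes "periodic L f" "f \<in> borel_measurable borel" "\<And>z. \<bar>f z\<bar> \<le> B"
  shows "f \<in> L2 L"
proof -
  have "B \<ge> 0" using assms(3)[of 0] by simp
  have "(f z)\<^sup>2 \<le> B\<^sup>2" for z using assms(3)[of z] by (metis abs_ge_zero power2_abs power_mono)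
  then have "integrable (circ L) (\<lambda>z. (f z)\<^sup>2)"
    by (intro integrable_bounded[of _ "B\<^sup>2"]) (use borel_measurable_circ[OF assms(2)] in auto)
  then show ?thesis using assms by (simp add: L2_iff)
qed

lemma L2_one: "(\<lambda>z. 1) \<in> L2 L" by (rule bounded_imp_L2[of _ 1]) (auto simp: periodic_def)

lemma L2_abs: "f \<in> L2 L \<Longrightarrow> (\<lambda>z. \<bar>f z\<bar>) \<in> L2 L" by (auto simp: L2_iff periodic_def)

lemma L2_integrable: "f \<in> L2 L \<Longrightarrow> integrable (circ L) f" using L2_mult_integrable[OF _ L2_one] by simp

lemma L1_le_L2:
  assumes "f \<in> L2 L" shows "(\<integral>z. \<bar>f z\<bar> \<partial>circ L) \<le> sqrt L * L2_norm L f"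
proof -
  have "(\<integral>z. \<bar>f z\<bar> \<partial>circ L)\<^sup>2 \<le> (\<integral>z. (f z)\<^sup>2 \<partial>circ L) * L"
    using L2_Cauchy_Schwarz[OF L2_abs[OF assms] L2_one] measure_circ by simp
  then have "\<bar>\<integral>z. \<bar>f z\<bar> \<partial>circ L\<bar> \<le> sqrt ((\<integral>z. (f z)\<^sup>2 \<partial>circ L) * L)"
    by (metis real_sqrt_abs real_sqrt_le_mono)
  then show ?thesis by (simp add: L2_norm_eq real_sqrt_mult mult.commute)
qed

lemma integrable_mult_ee:
  assumes "integrable (circ L) f" shows "integrable (circ L) (\<lambda>z. of_real (f z) * ee L k z)"
  by (rule Bochner_Integration.integrable_bound[OF assms]) (use assms in \<open>auto simp: norm_mult\<close>)

text \<open>Coefficients depend continuously on the function in L2. This transfers both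
  Riesz-Fischer limits and L2-valued time derivatives to single frequencies.\<close>

lemma norm_fc_le:
  assumes "f \<in> L2 L" shows "cmod (fc L f k) \<le> L2_norm L f / sqrt L"
proof -
  have "cmod (\<integral>z. of_real (f z) * ee L (- k) z \<partial>circ L) \<le> (\<integral>z. \<bar>f z\<bar> \<partial>circ L)"
    by (rule order.trans[OF integral_norm_bound]) (simp add: norm_mult)
  also have "\<dots> \<le> sqrt L * L2_norm L f" by (rule L1_le_L2[OF assms])
  finally have "cmod (fc L f k) \<le> (sqrt L * L2_norm L f) / L" using L_pos by (simp add: fc_def norm_mult norm_divide divide_right_mono)
  also have "\<dots> = L2_norm L f / sqrt L" using L_pos real_sqrt_mult_self[of L] by (simp add: field_simps)
  finally show ?thesis .
qed

lemma fc_add: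
  assumes "integrable (circ L) f" "integrable (circ L) g"
  shows "fc L (\<lambda>z. a * f z + b * g z) k = of_real a * fc L f k + of_real b * fc L g k"
  using integrable_mult_ee[OF assms(1), of "- k"] integrable_mult_ee[OF assms(2), of "- k"] by (simp add: fc_def ring_distribs mult.assoc)

lemma fc_cnj: "fc L f (- k) = cnj (fc L f k)"
proof -
  have "cnj (\<integral>z. of_real (f z) * ee L (- k) z \<partial>circ L) = (\<integral>z. cnj (of_real (f z) * ee L (- k) z) \<partial>circ L)"
    by (rule Bochner_Integration.integral_cnj[symmetric])
  then show ?thesis by (simp add: fc_def cnj_ee)
qed

lemma fc_cong_AE:
  assumes "AE z in circ L. f z = g z" "f \<in> borel_measurable borel" "g \<in> borel_measurable borel"
  shows "fc L f k = fc L g k"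
proof -
  have [measurable]: "f \<in> borel_measurable borel" "g \<in> borel_measurable borel" by fact+
  have "(\<integral>z. of_real (f z) * ee L (- k) z \<partial>circ L) = (\<integral>z. of_real (g z) * ee L (- k) z \<partial>circ L)"
    by (rule integral_cong_AE) (use assms(1) in auto)
  then show ?thesis by (simp add: fc_def)
qed

lemma fc_inj:
  assumes "integrable (circ L) f" "integrable (circ L) g" "\<And>k. fc L f k = fc L g k"
  shows "AE z in circ L. f z = g z"
proof -
  have "AE z in circ L. 1 * f z + (- 1) * g z = 0" by (rule fc_eq_0_imp_AE) (use assms in \<open>simp_all only: fc_add, auto\<close>)
  then show ?thesis by simp
qed

text \<open>On a finite measure space an L2 Cauchy sequence is Cauchy in L1, so a subsequence
  converges almost everywhere. Fatou's lemma along it bounds the L2 distance to the limit by the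
  distances within the sequence.\<close>

lemma L2_complete:
  assumes s: "\<And>n. s n \<in> L2 L"
    and Cauchy: "\<And>e. e > 0 \<Longrightarrow> \<exists>N. \<forall>i\<ge>N. \<forall>j\<ge>N. (\<integral>z. (s i z - s j z)\<^sup>2 \<partial>circ L) < e"
  shows "\<exists>g\<in>L2 L. (\<lambda>n. \<integral>z. (s n z - g z)\<^sup>2 \<partial>circ L) \<longlonglongrightarrow> 0"
proof -
  let ?D = "\<lambda>i j. \<integral>z. (s i z - s j z)\<^sup>2 \<partial>circ L"
  have [measurable]: "s n \<in> borel_measurable borel" for n using s by (auto simp: L2_iff)
  have d: "(\<lambda>z. s i z - s j z) \<in> L2 L" for i j using s by (intro L2_diff)
  have "\<exists>N. \<forall>i\<ge>N. \<forall>j\<ge>N. (\<integral>z. norm (s i z - s j z) \<partial>circ L) < e" if "e > 0" for e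
  proof -
    have "e\<^sup>2 / L > 0" using that L_pos by simp
    from Cauchy[OF this] obtain N where N: "\<And>i j. i \<ge> N \<Longrightarrow> j \<ge> N \<Longrightarrow> ?D i j < e\<^sup>2 / L" by blast
    have "(\<integral>z. norm (s i z - s j z) \<partial>circ L) < e" if "i \<ge> N" "j \<ge> N" for i j
    proof -
      have "(\<integral>z. norm (s i z - s j z) \<partial>circ L) \<le> sqrt (L * ?D i j)"
        using L1_le_L2[OF d[of i j]] by (simp add: L2_norm_eq real_sqrt_mult)
      also have "\<dots> < sqrt (L * (e\<^sup>2 / L))" using mult_strict_left_mono[OF N[OF that] L_pos] by (rule real_sqrt_less_mono)
      also have "\<dots> = e" using L_pos \<open>e > 0\<close> by simp
      finally show ?thesis .
    qed
    then show ?thesis by blast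
  qed
  then obtain r where r: "strict_mono r" "AE z in circ L. Cauchy (\<lambda>i. s (r i) z)"
    using cauchy_L1_AE_cauchy_subseq[of "circ L" s] L2_integrable[OF s] by blast
  \<comment> \<open>Defined at every point, even where the subsequence diverges: there
    \<open>lim\<close> is some arbitrary value, but the same one at \<open>z\<close> and
    \<open>z + L\<close>, so \<open>g\<close> is exactly periodic.\<close>
  define g where "g z = lim (\<lambda>i. s (r i) z)" for z
  let ?G = "\<lambda>n. \<integral>z. (s n z - g z)\<^sup>2 \<partial>circ L"
  have [measurable]: "g \<in> borel_measurable borel" unfolding g_def[abs_def] by measurable
  have pg: "periodic L g" using s by (simp add: g_def periodic_def L2_iff)
  have lim: "AE z in circ L. (\<lambda>i. s (r i) z) \<longlonglongrightarrow> g z"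
    using r(2) by eventually_elim (simp add: g_def convergent_LIMSEQ_iff[symmetric] real_Cauchy_convergent)
  have bound: "(\<integral>\<^sup>+z. ennreal ((s n z - g z)\<^sup>2) \<partial>circ L) \<le> ennreal e"
    if e: "\<And>j. j \<ge> N \<Longrightarrow> ?D n j \<le> e" for n N e
  proof -
    have "(\<integral>\<^sup>+z. ennreal ((s n z - g z)\<^sup>2) \<partial>circ L) = (\<integral>\<^sup>+z. liminf (\<lambda>i. ennreal ((s n z - s (r i) z)\<^sup>2)) \<partial>circ L)"
    proof (rule nn_integral_cong_AE)
      show "AE z in circ L. ennreal ((s n z - g z)\<^sup>2) = liminf (\<lambda>i. ennreal ((s n z - s (r i) z)\<^sup>2))" using lim
      proof eventually_elim
        case (elim z)
        then have "(\<lambda>i. ennreal ((s n z - s (r i) z)\<^sup>2)) \<longlonglongrightarrow> ennreal ((s n z - g z)\<^sup>2)"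
          by (intro tendsto_intros)
        from lim_imp_Liminf[OF _ this] show ?case by simp
      qed
    qed
    also have "\<dots> \<le> liminf (\<lambda>i. \<integral>\<^sup>+z. ennreal ((s n z - s (r i) z)\<^sup>2) \<partial>circ L)"
      by (rule nn_integral_liminf) measurable
    also have "\<dots> = liminf (\<lambda>i. ennreal (?D n (r i)))" using d by (subst nn_integral_eq_integral) (auto simp: L2_iff)
    also have "\<dots> \<le> limsup (\<lambda>i. ennreal (?D n (r i)))" by (rule Liminf_le_Limsup) simp
    also have "\<dots> \<le> ennreal e"
    proof (rule Limsup_bounded)
      show "\<forall>\<^sub>F i in sequentially. ennreal (?D n (r i)) \<le> ennreal e" using eventually_ge_at_top[of N]
      proof eventually_elim
        case (elim i)
        then have "r i \<ge> N" using seq_suble[OF r(1), of i] by simp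
        then show ?case using e by (intro ennreal_leI)
      qed
    qed
    finally show ?thesis .
  qed
  have int: "integrable (circ L) (\<lambda>z. (s n z - g z)\<^sup>2)" and le: "?G n \<le> e"
    if e: "\<And>j. j \<ge> N \<Longrightarrow> ?D n j \<le> e" for n N e
  proof -
    have b: "(\<integral>\<^sup>+z. ennreal ((s n z - g z)\<^sup>2) \<partial>circ L) \<le> ennreal e" by (rule bound[of N n e]) (rule e)
    then have "(\<integral>\<^sup>+z. ennreal ((s n z - g z)\<^sup>2) \<partial>circ L) < \<infinity>" by (rule order_le_less_trans) simp
    then show i: "integrable (circ L) (\<lambda>z. (s n z - g z)\<^sup>2)" by (intro integrableI_nonneg) auto
    have "ennreal (?G n) \<le> ennreal e" using b by (subst nn_integral_eq_integral[symmetric, OF i]) auto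
    moreover have "0 \<le> ?D n N" by (intro integral_nonneg_AE) simp
    then have "e \<ge> 0" by (rule order_trans) (rule e, simp)
    ultimately show "?G n \<le> e" by (simp add: ennreal_le_iff)
  qed
  have Le: "\<exists>N. \<forall>n\<ge>N. \<forall>j\<ge>N. ?D n j \<le> e" if "e > 0" for e using Cauchy[OF that] less_imp_le by blast
  show ?thesis
  proof (rule bexI[of _ g])
    show "(\<lambda>n. \<integral>z. (s n z - g z)\<^sup>2 \<partial>circ L) \<longlonglongrightarrow> 0"
    proof (rule LIMSEQ_I)
      fix e :: real assume "e > 0"
      then obtain N where N: "\<And>n j. n \<ge> N \<Longrightarrow> j \<ge> N \<Longrightarrow> ?D n j \<le> e / 2" using Le[of "e / 2"] by auto
      have "norm (?G n - 0) < e" if "n \<ge> N" for n using le[of N n "e / 2"] N[OF that] \<open>e > 0\<close> by simp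
      then show "\<exists>no. \<forall>n\<ge>no. norm (?G n - 0) < e" by blast
    qed
    obtain N where "\<And>n j. n \<ge> N \<Longrightarrow> j \<ge> N \<Longrightarrow> ?D n j \<le> 1" using Le[of 1] by auto
    then have "integrable (circ L) (\<lambda>z. (s N z - g z)\<^sup>2)" using int[of N N 1] by simp
    then have "(\<lambda>z. s N z - g z) \<in> L2 L" using s pg by (simp add: L2_iff periodic_def)
    from L2_diff[OF s this, of N] show "g \<in> L2 L" by simp
  qed
qed

end

section \<open>Fourier series\<close>

abbreviation symint :: "nat \<Rightarrow> int set" where
  "symint K \<equiv> {- int K..int K}"

lemma deriv_periodic:
  assumes "periodic L f" shows "periodic L (deriv f)"
proof -
  have "(\<lambda>x. f (x + L)) = f" using assms by (auto simp: periodic_def)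
  then have "DERIV f (z + L) :> D \<longleftrightarrow> DERIV f z :> D" for z D by (simp add: DERIV_shift)
  then show ?thesis by (simp add: periodic_def deriv_def)
qed

lemma smooth_fun_deriv: "f \<in> smooth_fun L \<Longrightarrow> deriv f \<in> smooth_fun L"
  by (auto simp: smooth_fun_def deriv_periodic) (metis funpow_Suc_right o_apply)

lemma smooth_fun_funpow_deriv: "f \<in> smooth_fun L \<Longrightarrow> (deriv ^^ n) f \<in> smooth_fun L"
  by (induction n) (auto simp: smooth_fun_deriv)

lemma smooth_fun_DERIV: "f \<in> smooth_fun L \<Longrightarrow> DERIV f z :> deriv f z" unfolding smooth_fun_def mem_Collect_eq
  by (metis DERIV_deriv_iff_real_differentiable funpow_0)

lemma smooth_fun_continuous: "f \<in> smooth_fun L \<Longrightarrow> continuous_on S f"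
  by (meson DERIV_isCont smooth_fun_DERIV continuous_at_imp_continuous_on)

context circle
begin

lemma continuous_imp_L2:
  assumes "periodic L f" "continuous_on UNIV f" shows "f \<in> L2 L"
proof -
  have m: "f \<in> borel_measurable borel" using assms(2) by (rule borel_measurable_continuous_onI)
  have "set_integrable lborel {0..L} (\<lambda>z. (f z)\<^sup>2)"
    by (intro borel_integrable_atLeastAtMost' continuous_intros continuous_on_subset[OF assms(2)]) auto
  then show ?thesis using assms m by (simp add: L2_def)
qed

lemma smooth_fun_L2: "f \<in> smooth_fun L \<Longrightarrow> f \<in> L2 L"
  by (intro continuous_imp_L2 smooth_fun_continuous) (auto simp: smooth_fun_def)

lemma integrable_ee [simp]: "integrable (circ L) (ee L k)" by (rule integrable_bounded[of _ 1]) auto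

lemma integral_cmod_square_sum:
  assumes "finite A"
  shows "(\<integral>z. (cmod (\<Sum>k\<in>A. d k * ee L k z))\<^sup>2 \<partial>circ L) = L * (\<Sum>k\<in>A. (cmod (d k))\<^sup>2)"
proof -
  have eq: "complex_of_real ((cmod (\<Sum>k\<in>A. d k * ee L k z))\<^sup>2) = (\<Sum>k\<in>A. \<Sum>l\<in>A. d k * cnj (d l) * ee L (k - l) z)" for z
    unfolding complex_norm_square cnj_sum sum_product by (intro sum.cong refl) (simp add: cnj_ee ee_add[of L _ "- _", simplified] mult_ac)
  have "complex_of_real (\<integral>z. (cmod (\<Sum>k\<in>A. d k * ee L k z))\<^sup>2 \<partial>circ L) =
    (\<integral>z. complex_of_real ((cmod (\<Sum>k\<in>A. d k * ee L k z))\<^sup>2) \<partial>circ L)" by (rule integral_complex_of_real[symmetric])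
  also have "\<dots> = (\<Sum>k\<in>A. \<Sum>l\<in>A. d k * cnj (d l) * (if k = l then of_real L else 0))"
    unfolding eq by (subst Bochner_Integration.integral_sum, simp, intro sum.cong refl)
      (subst Bochner_Integration.integral_sum, auto simp: integral_ee)
  also have "\<dots> = (\<Sum>k\<in>A. d k * cnj (d k) * of_real L)" using assms by (simp add: if_distrib[of "\<lambda>x. _ * x"] cong: if_cong)
  also have "\<dots> = of_real (L * (\<Sum>k\<in>A. (cmod (d k))\<^sup>2))"
    by (simp only: complex_norm_square[symmetric] of_real_mult of_real_sum sum_distrib_left sum_distrib_right mult.commute)
  finally show ?thesis by (simp only: of_real_eq_iff)
qed

text \<open>One identity with several uses: \<open>m = - k\<close> gives the coefficients of a
  trigonometric sum and the finite convolutions, \<open>m = 0\<close> the inner product in Bessel's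
  inequality.\<close>

lemma integral_mult_trig_sum:
  assumes "integrable (circ L) f"
  shows "(\<integral>z. of_real (f z) * ee L m z * trig_sum L c J z \<partial>circ L) = L * (\<Sum>l\<in>symint J. fc L f (- m - l) * c l)"
proof -
  have "(\<integral>z. of_real (f z) * ee L m z * trig_sum L c J z \<partial>circ L) =
    (\<integral>z. (\<Sum>l\<in>symint J. c l * (of_real (f z) * ee L (m + l) z)) \<partial>circ L)"
    by (simp add: trig_sum_def sum_distrib_left ee_add mult_ac)
  also have "\<dots> = (\<Sum>l\<in>symint J. c l * (\<integral>z. of_real (f z) * ee L (m + l) z \<partial>circ L))"
    by (subst Bochner_Integration.integral_sum) (auto intro!: integrable_mult_right integrable_mult_ee assms)
  also have "\<dots> = L * (\<Sum>l\<in>symint J. fc L f (- m - l) * c l)"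
    using L_pos by (simp add: fc_def sum_distrib_left add.commute mult.commute)
  finally show ?thesis .
qed

lemma Re_trig_sum_L2: "(\<lambda>z. Re (trig_sum L c J z)) \<in> L2 L"
proof (rule bounded_imp_L2)
  show "periodic L (\<lambda>z. Re (trig_sum L c J z))" by (simp add: periodic_def trig_sum_def ee_periodic)
  show "\<bar>Re (trig_sum L c J z)\<bar> \<le> (\<Sum>l\<in>symint J. cmod (c l))" for z
    by (rule order.trans[OF abs_Re_le_cmod]) (auto simp: trig_sum_def norm_mult intro!: sum_norm_le)
qed measurable

lemma fc_trig_sum:
  assumes "\<And>k. c (- k) = cnj (c k)"
  shows "fc L (\<lambda>z. Re (trig_sum L c J z)) k = (if k \<in> symint J then c k else 0)"
proof -
  have one: "fc L (\<lambda>z. 1) j = (if j = 0 then 1 else 0)" for j using integral_ee[of "- j"] L_pos by (simp add: fc_def)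
  have "fc L (\<lambda>z. Re (trig_sum L c J z)) k = (1 / L) * (\<integral>z. of_real 1 * ee L (- k) z * trig_sum L c J z \<partial>circ L)"
    by (simp add: fc_def trig_sum_real[of c, OF assms, symmetric] mult_ac)
  also have "\<dots> = (\<Sum>l\<in>symint J. (if k = l then 1 else 0) * c l)" using L_pos by (subst integral_mult_trig_sum) (auto simp: one)
  finally show ?thesis by (simp add: if_distrib[of "\<lambda>x. x * _"] cong: if_cong)
qed

lemma symint_mono: "i \<le> j \<Longrightarrow> symint i \<subseteq> symint j" by auto

text \<open>Two partial sums differ by the frequencies in between, so their squared distance is
  \<open>L * (a i - a j)\<close> for a bounded increasing sequence \<open>a\<close>, and
  completeness of L2 gives the limit. The symmetry of \<open>c\<close> keeps the partial sums
  real.\<close>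

lemma Riesz_Fischer:
  assumes c: "\<And>k. c (- k) = cnj (c k)" and B: "\<And>J. (\<Sum>k\<in>symint J. (cmod (c k))\<^sup>2) \<le> B"
  shows "\<exists>g\<in>L2 L. (\<forall>k. fc L g k = c k) \<and> (\<lambda>J. \<integral>z. (Re (trig_sum L c J z) - g z)\<^sup>2 \<partial>circ L) \<longlonglongrightarrow> 0"
proof -
  define s where "s J z = Re (trig_sum L c J z)" for J z
  define a where "a J = (\<Sum>k\<in>symint J. (cmod (c k))\<^sup>2)" for J
  have s: "s J \<in> L2 L" for J unfolding s_def[abs_def] by (rule Re_trig_sum_L2)
  have diff: "(\<integral>z. (s i z - s j z)\<^sup>2 \<partial>circ L) = L * (a i - a j)" if "j \<le> i" for i j
  proof -
    have "complex_of_real (s i z - s j z) = (\<Sum>k\<in>symint i - symint j. c k * ee L k z)" for z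
    proof -
      have "complex_of_real (s i z - s j z) = trig_sum L c i z - trig_sum L c j z"
        unfolding s_def of_real_diff by (simp only: trig_sum_real[of c, OF c, symmetric])
      also have "\<dots> = (\<Sum>k\<in>symint i - symint j. c k * ee L k z)"
        unfolding trig_sum_def by (rule sum_diff[symmetric]) (use that in auto)
      finally show ?thesis .
    qed
    then have "(s i z - s j z)\<^sup>2 = (cmod (\<Sum>k\<in>symint i - symint j. c k * ee L k z))\<^sup>2" for z
      by (metis norm_of_real power2_abs)
    then have "(\<integral>z. (s i z - s j z)\<^sup>2 \<partial>circ L) = L * (\<Sum>k\<in>symint i - symint j. (cmod (c k))\<^sup>2)"
      by (simp only:) (rule integral_cmod_square_sum, simp)
    also have "(\<Sum>k\<in>symint i - symint j. (cmod (c k))\<^sup>2) = a i - a j" unfolding a_def by (rule sum_diff) (use that in auto)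
    finally show ?thesis .
  qed
  have "incseq a" unfolding a_def by (intro monoI sum_mono2 symint_mono) auto
  then have "convergent a" using B Bseq_mono_convergent[of a] by (metis a_def incseq_convergent convergentI)
  then have Ca: "Cauchy a" by (rule convergent_Cauchy)
  have "\<exists>N. \<forall>i\<ge>N. \<forall>j\<ge>N. (\<integral>z. (s i z - s j z)\<^sup>2 \<partial>circ L) < e" if "e > 0" for e
  proof -
    obtain N where N: "\<And>i j. i \<ge> N \<Longrightarrow> j \<ge> N \<Longrightarrow> norm (a i - a j) < e / L"
      using CauchyD[OF Ca, of "e / L"] \<open>e > 0\<close> L_pos by auto
    have "(\<integral>z. (s i z - s j z)\<^sup>2 \<partial>circ L) < e" if "i \<ge> N" "j \<ge> N" for i j
    proof -
      have "(\<integral>z. (s i z - s j z)\<^sup>2 \<partial>circ L) \<le> L * norm (a i - a j)"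
      proof (cases "j \<le> i")
        case True then show ?thesis using diff[OF True] L_pos by simp
      next
        case False
        have "(\<integral>z. (s i z - s j z)\<^sup>2 \<partial>circ L) = (\<integral>z. (s j z - s i z)\<^sup>2 \<partial>circ L)"
          by (simp add: power2_commute)
        then show ?thesis using diff[of i j] False L_pos by simp
      qed
      also have "\<dots> < e" using N[OF that] L_pos by (simp add: field_simps)
      finally show ?thesis .
    qed
    then show ?thesis by blast
  qed
  from L2_complete[OF s this] obtain g where g: "g \<in> L2 L"
    and lim: "(\<lambda>n. \<integral>z. (s n z - g z)\<^sup>2 \<partial>circ L) \<longlonglongrightarrow> 0" by auto
  have "fc L g k = c k" for k
  proof -
    have "(\<lambda>n. L2_norm L (\<lambda>z. s n z - g z) / sqrt L) \<longlonglongrightarrow> sqrt 0 / sqrt L"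
      unfolding L2_norm_eq using L_pos by (intro tendsto_intros lim) auto
    then have lim0: "(\<lambda>n. L2_norm L (\<lambda>z. s n z - g z) / sqrt L) \<longlonglongrightarrow> 0" by simp
    have "(\<lambda>n. fc L (\<lambda>z. s n z - g z) k) \<longlonglongrightarrow> 0"
      by (rule Lim_null_comparison[OF always_eventually lim0]) (intro allI norm_fc_le L2_diff s g)
    moreover have "fc L (\<lambda>z. s n z - g z) k = fc L (s n) k - fc L g k" for n
      using fc_add[OF L2_integrable[OF s[of n]] L2_integrable[OF g], of 1 "-1"] by simp
    ultimately have "(\<lambda>n. fc L (s n) k - fc L g k) \<longlonglongrightarrow> 0" by simp
    then have "(\<lambda>n. fc L (s n) k) \<longlonglongrightarrow> fc L g k" by (simp add: LIM_zero_iff)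
    moreover have "(\<lambda>n. fc L (s n) k) \<longlonglongrightarrow> c k"
    proof (rule tendsto_eventually)
      show "\<forall>\<^sub>F n in sequentially. fc L (s n) k = c k" using eventually_ge_at_top[of "nat \<bar>k\<bar>"]
        by eventually_elim (auto simp: s_def[abs_def] fc_trig_sum[of c, OF c])
    qed
    ultimately show ?thesis by (rule LIMSEQ_unique)
  qed
  then show ?thesis using g lim unfolding s_def by blast
qed

text \<open>Expand the integral of \<open>(f z - s z)\<^sup>2\<close> for the partial sum
  \<open>s\<close>: both the square of \<open>s\<close> and the product of \<open>f\<close> and
  \<open>s\<close> integrate to \<open>E\<close>.\<close>

lemma Bessel:
  assumes f: "f \<in> L2 L"
  shows "L * (\<Sum>k\<in>symint J. (cmod (fc L f k))\<^sup>2) \<le> (\<integral>z. (f z)\<^sup>2 \<partial>circ L)"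
proof -
  define s where "s z = Re (trig_sum L (fc L f) J z)" for z
  define E where "E = L * (\<Sum>k\<in>symint J. (cmod (fc L f k))\<^sup>2)"
  have s: "s \<in> L2 L" unfolding s_def[abs_def] by (rule Re_trig_sum_L2)
  have sr: "complex_of_real (s z) = trig_sum L (fc L f) J z" for z unfolding s_def by (rule trig_sum_real[symmetric]) (rule fc_cnj)
  have "(\<integral>z. (s z)\<^sup>2 \<partial>circ L) = (\<integral>z. (cmod (trig_sum L (fc L f) J z))\<^sup>2 \<partial>circ L)"
    by (simp flip: sr)
  also have "\<dots> = E" unfolding trig_sum_def E_def by (rule integral_cmod_square_sum) simp
  finally have ss: "(\<integral>z. (s z)\<^sup>2 \<partial>circ L) = E" .
  have "complex_of_real (\<integral>z. f z * s z \<partial>circ L) = (\<integral>z. of_real (f z) * ee L 0 z * trig_sum L (fc L f) J z \<partial>circ L)"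
    by (simp flip: sr integral_complex_of_real)
  also have "\<dots> = of_real E" by (subst integral_mult_trig_sum[OF L2_integrable[OF f]])
       (simp add: E_def fc_cnj complex_norm_square mult.commute del: of_real_power)
  finally have fs: "(\<integral>z. f z * s z \<partial>circ L) = E" by (simp only: of_real_eq_iff)
  have "0 \<le> (\<integral>z. (f z - s z)\<^sup>2 \<partial>circ L)" by (intro integral_nonneg_AE) simp
  also have "\<dots> = (\<integral>z. (f z)\<^sup>2 - 2 * (f z * s z) + (s z)\<^sup>2 \<partial>circ L)"
    by (intro Bochner_Integration.integral_cong) (auto simp: power2_eq_square algebra_simps)
  also have "\<dots> = (\<integral>z. (f z)\<^sup>2 \<partial>circ L) - E" using f s L2_mult_integrable[OF f s] by (simp add: L2_iff ss fs)
  finally show ?thesis by (simp add: E_def)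
qed

text \<open>Riesz-Fischer provides a limit \<open>g\<close> with the coefficients of
  \<open>f\<close>; uniqueness identifies the two almost everywhere.\<close>

lemma Fourier_series_L2:
  assumes f: "f \<in> L2 L"
  shows "(\<lambda>J. \<integral>z. (Re (trig_sum L (fc L f) J z) - f z)\<^sup>2 \<partial>circ L) \<longlonglongrightarrow> 0"
proof -
  have "(\<Sum>k\<in>symint J. (cmod (fc L f k))\<^sup>2) \<le> (\<integral>z. (f z)\<^sup>2 \<partial>circ L) / L" for J
    using Bessel[OF f, of J] L_pos by (simp add: field_simps)
  from Riesz_Fischer[OF fc_cnj this] obtain g where g: "g \<in> L2 L" "\<And>k. fc L g k = fc L f k"
    "(\<lambda>J. \<integral>z. (Re (trig_sum L (fc L f) J z) - g z)\<^sup>2 \<partial>circ L) \<longlonglongrightarrow> 0" by blast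
  have [measurable]: "f \<in> borel_measurable borel" "g \<in> borel_measurable borel" using f g by (auto simp: L2_iff)
  have ae: "AE z in circ L. g z = f z" using fc_inj[OF L2_integrable[OF g(1)] L2_integrable[OF f] g(2)] .
  have "(\<integral>z. (Re (trig_sum L (fc L f) J z) - g z)\<^sup>2 \<partial>circ L) = (\<integral>z. (Re (trig_sum L (fc L f) J z) - f z)\<^sup>2 \<partial>circ L)" for J
    by (rule integral_cong_AE) (use ae in auto)
  then show ?thesis using g(3) by simp
qed

text \<open>Replacing \<open>g\<close> by a partial Fourier sum gives the finite convolution
  exactly; Cauchy-Schwarz controls the remainder. The limit of symmetric partial sums is the form in
  which the equations enter \<open>spectral_flow\<close>.\<close>

lemma fc_mult:
  assumes f: "f \<in> L2 L" and g: "g \<in> L2 L"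
  shows "(\<lambda>J. \<Sum>l\<in>symint J. fc L f (k - l) * fc L g l) \<longlonglongrightarrow> fc L (\<lambda>z. f z * g z) k"
proof -
  define s where "s J z = Re (trig_sum L (fc L g) J z)" for J z
  have s: "s J \<in> L2 L" for J unfolding s_def[abs_def] by (rule Re_trig_sum_L2)
  have sr: "complex_of_real (s J z) = trig_sum L (fc L g) J z" for J z unfolding s_def by (rule trig_sum_real[symmetric]) (rule fc_cnj)
  have eq: "(\<Sum>l\<in>symint J. fc L f (k - l) * fc L g l) = fc L (\<lambda>z. f z * s J z) k" for J
    using integral_mult_trig_sum[OF L2_integrable[OF f], of "- k" "fc L g" J] L_pos by (simp add: fc_def sr mult_ac)
  have bnd: "norm (fc L (\<lambda>z. f z * s J z) k - fc L (\<lambda>z. f z * g z) k) \<le>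
    (1 / L) * sqrt ((\<integral>z. (f z)\<^sup>2 \<partial>circ L) * (\<integral>z. (s J z - g z)\<^sup>2 \<partial>circ L))" for J
  proof -
    have i: "integrable (circ L) (\<lambda>z. f z * s J z)" "integrable (circ L) (\<lambda>z. f z * g z)" by (intro L2_mult_integrable f g s)+
    have "fc L (\<lambda>z. f z * s J z) k - fc L (\<lambda>z. f z * g z) k = fc L (\<lambda>z. f z * (s J z - g z)) k"
      using fc_add[OF i, of 1 "-1"] by (simp add: algebra_simps)
    also have "norm \<dots> \<le> (1 / L) * (\<integral>z. \<bar>f z\<bar> * \<bar>s J z - g z\<bar> \<partial>circ L)"
      unfolding fc_def norm_mult using L_pos
      by (intro mult_mono order.trans[OF integral_norm_bound]) (auto simp: norm_mult norm_divide abs_mult simp flip: of_real_diff)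
    also have "(\<integral>z. \<bar>f z\<bar> * \<bar>s J z - g z\<bar> \<partial>circ L) \<le> sqrt ((\<integral>z. (f z)\<^sup>2 \<partial>circ L) * (\<integral>z. (s J z - g z)\<^sup>2 \<partial>circ L))"
      using L2_Cauchy_Schwarz[OF L2_abs[OF f] L2_abs[OF L2_diff[OF s g]], of J] by (intro real_le_rsqrt) simp
    finally show ?thesis using L_pos by (simp add: mult_left_mono divide_right_mono)
  qed
  have "(\<lambda>J. (1 / L) * sqrt ((\<integral>z. (f z)\<^sup>2 \<partial>circ L) * (\<integral>z. (s J z - g z)\<^sup>2 \<partial>circ L))) \<longlonglongrightarrow> (1 / L) * sqrt ((\<integral>z. (f z)\<^sup>2 \<partial>circ L) * 0)"
    unfolding s_def by (intro tendsto_intros Fourier_series_L2 g)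
  then have lim0: "(\<lambda>J. (1 / L) * sqrt ((\<integral>z. (f z)\<^sup>2 \<partial>circ L) * (\<integral>z. (s J z - g z)\<^sup>2 \<partial>circ L))) \<longlonglongrightarrow> 0"
    by simp
  have "(\<lambda>J. fc L (\<lambda>z. f z * s J z) k - fc L (\<lambda>z. f z * g z) k) \<longlonglongrightarrow> 0"
    by (rule Lim_null_comparison[OF always_eventually lim0]) (intro allI bnd)
  then show ?thesis unfolding eq by (simp add: LIM_zero_iff)
qed

text \<open>Frequency \<open>0\<close> of the convolution formula.\<close>

lemma Parseval:
  assumes f: "f \<in> L2 L" and g: "g \<in> L2 L"
  shows "(\<lambda>J. L * (\<Sum>l\<in>symint J. fc L f (- l) * fc L g l)) \<longlonglongrightarrow> of_real (\<integral>z. f z * g z \<partial>circ L)"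
proof -
  have "(\<lambda>J. L * (\<Sum>l\<in>symint J. fc L f (0 - l) * fc L g l)) \<longlonglongrightarrow> L * fc L (\<lambda>z. f z * g z) 0"
    by (intro tendsto_intros fc_mult f g)
  moreover have "L * fc L (\<lambda>z. f z * g z) 0 = of_real (\<integral>z. f z * g z \<partial>circ L)"
    using L_pos by (simp add: fc_def del: of_real_mult)
  ultimately show ?thesis by simp
qed

lemma Parseval_norm:
  assumes f: "f \<in> L2 L"
  shows "(\<lambda>J. L * (\<Sum>l\<in>symint J. (cmod (fc L f l))\<^sup>2)) \<longlonglongrightarrow> (\<integral>z. (f z)\<^sup>2 \<partial>circ L)"
proof -
  have "(\<Sum>l\<in>symint J. fc L f (- l) * fc L f l) = of_real (\<Sum>l\<in>symint J. (cmod (fc L f l))\<^sup>2)" for J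
    by (simp add: fc_cnj complex_norm_square mult.commute del: of_real_power)
  then have "(\<lambda>J. complex_of_real (L * (\<Sum>l\<in>symint J. (cmod (fc L f l))\<^sup>2))) \<longlonglongrightarrow> of_real (\<integral>z. (f z)\<^sup>2 \<partial>circ L)"
    using Parseval[OF f f] by (simp add: power2_eq_square)
  then show ?thesis by (simp only: tendsto_of_real_iff)
qed

end

section \<open>Weak derivatives and Sobolev norms\<close>

text \<open>The Fourier symbol of \<open>deriv\<close>. It is purely imaginary, which is behind the
  antisymmetry of the transport term.\<close>

definition frq :: "real \<Rightarrow> int \<Rightarrow> complex" where
  "frq L k = \<i> * of_real (2 * pi / L * of_int k)"

lemma frq_minus [simp]: "frq L (- k) = - frq L k" by (simp add: frq_def)

lemma cnj_frq [simp]: "cnj (frq L k) = - frq L k" by (simp add: frq_def)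

context circle
begin

text \<open>The squared seminorm of order \<open>n\<close> without its factor
  \<open>L * (2 * pi / L) ^ (2 * n)\<close>. Keeping partial sums turns membership in a Sobolev
  space into a bound uniform in \<open>J\<close>.\<close>

definition sobolev_sum :: "nat \<Rightarrow> (real \<Rightarrow> real) \<Rightarrow> nat \<Rightarrow> real" where
  "sobolev_sum n f J = (\<Sum>k\<in>symint J. (real_of_int k) ^ (2 * n) * (cmod (fc L f k))\<^sup>2)"

lemma Re_ee_has_real_derivative:
  "((\<lambda>z. Re (c * ee L k z)) has_real_derivative Re (c * frq L k * ee L k z)) (at z)"
proof -
  have "((\<lambda>z. c * ee L k z) has_vector_derivative (c * (frq L k * ee L k z))) (at z)"
    by (intro has_vector_derivative_mult_right ee_has_vector_derivative[folded frq_def])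
  from bounded_linear.has_vector_derivative[OF bounded_linear_Re this] show ?thesis
    by (simp only: has_real_derivative_iff_has_vector_derivative mult.assoc)
qed

lemma funpow_deriv_Re_ee:
  "(deriv ^^ n) (\<lambda>z. Re (c * ee L k z)) = (\<lambda>z. Re (c * frq L k ^ n * ee L k z))"
proof (induction n)
  case (Suc n)
  have "deriv (\<lambda>z. Re (c * frq L k ^ n * ee L k z)) = (\<lambda>z. Re (c * frq L k ^ Suc n * ee L k z))"
    by (rule ext, rule DERIV_imp_deriv)
      (use Re_ee_has_real_derivative[of "c * frq L k ^ n" k] in \<open>simp only: power_Suc2 mult.assoc\<close>)
  then show ?case using Suc by simp
qed simp

lemma Re_ee_smooth: "(\<lambda>z. Re (c * ee L k z)) \<in> smooth_fun L" unfolding smooth_fun_def mem_Collect_eq funpow_deriv_Re_ee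
proof (intro conjI allI)
  show "periodic L (\<lambda>z. Re (c * ee L k z))" by (simp only: periodic_def ee_periodic simp_thms)
  show "(\<lambda>z. Re (c * frq L k ^ n * ee L k z)) differentiable at z" for n z
    using Re_ee_has_real_derivative real_differentiable_def by blast
qed

text \<open>Integration by parts over one period; the boundary terms cancel by periodicity.\<close>

lemma fc_deriv:
  assumes f: "f \<in> smooth_fun L"
  shows "fc L (deriv f) k = frq L k * fc L f k"
proof -
  define F where "F z = of_real (f z) * ee L (- k) z" for z
  have f': "deriv f \<in> smooth_fun L" using f by (rule smooth_fun_deriv)
  have i: "integrable (circ L) (\<lambda>z. of_real (deriv f z) * ee L (- k) z)"
    "integrable (circ L) (\<lambda>z. of_real (f z) * ee L (- k) z)" using f f' by (auto intro!: integrable_mult_ee L2_integrable smooth_fun_L2)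
  have "(LINT z:{0..L}|lborel. of_real (f z) * (frq L (- k) * ee L (- k) z) + of_real (deriv f z) * ee L (- k) z) = F L - F 0"
    unfolding set_lebesgue_integral_def
  proof (rule integral_FTC_Icc)
    show "continuous_on {0..L} (\<lambda>z. of_real (f z) * (frq L (- k) * ee L (- k) z) + of_real (deriv f z) * ee L (- k) z)"
      by (intro continuous_on_add continuous_on_mult continuous_on_const continuous_on_ee continuous_on_of_real
          smooth_fun_continuous[OF f] smooth_fun_continuous[OF f'])
    show "(F has_vector_derivative of_real (f z) * (frq L (- k) * ee L (- k) z) + of_real (deriv f z) * ee L (- k) z) (at z within {0..L})" for z
    proof -
      have "(f has_real_derivative deriv f z) (at z within {0..L})" by (rule has_field_derivative_at_within[OF smooth_fun_DERIV[OF f]])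
      then show ?thesis unfolding F_def
        by (intro has_vector_derivative_mult ee_has_vector_derivative[folded frq_def] has_vector_derivative_of_real)
    qed
  qed (use L_pos in simp)
  moreover have "F L = F 0" using f ee_0_eq_L[of "- k"] by (simp add: F_def smooth_fun_def periodic_def) (metis add_0)
  moreover have "(\<integral>z. of_real (f z) * (frq L (- k) * ee L (- k) z) + of_real (deriv f z) * ee L (- k) z \<partial>circ L) =
    frq L (- k) * (\<integral>z. of_real (f z) * ee L (- k) z \<partial>circ L) + (\<integral>z. of_real (deriv f z) * ee L (- k) z \<partial>circ L)"
    using i by (simp only: mult.left_commute[of "of_real (f _)"] Bochner_Integration.integral_add
        integrable_mult_right integral_mult_right_zero)
  ultimately have "(\<integral>z. of_real (deriv f z) * ee L (- k) z \<partial>circ L) = frq L k * (\<integral>z. of_real (f z) * ee L (- k) z \<partial>circ L)"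
    by (simp add: integral_circ add_eq_0_iff)
  then show ?thesis by (simp add: fc_def)
qed

lemma fc_funpow_deriv:
  "f \<in> smooth_fun L \<Longrightarrow> fc L ((deriv ^^ n) f) k = frq L k ^ n * fc L f k"
  by (induction n) (simp_all add: fc_deriv smooth_fun_funpow_deriv mult.assoc)

text \<open>Test functions are real, so the test is with \<open>Re (c * ee L (- k) z)\<close> for
  every complex \<open>c\<close>, which recovers the complex identity.\<close>

lemma has_weak_deriv_imp_fc:
  assumes "has_weak_deriv L n f g"
  shows "fc L g k = frq L k ^ n * fc L f k"
proof -
  have f: "f \<in> L2 L" and g: "g \<in> L2 L" using assms by (auto simp: has_weak_deriv_def)
  have int: "(\<integral>z. h z * Re (c * ee L (- k) z) \<partial>circ L) = Re (c * (L * fc L h k))" if "h \<in> L2 L" for h c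
  proof -
    have "(\<integral>z. h z * Re (c * ee L (- k) z) \<partial>circ L) = (\<integral>z. Re (c * (of_real (h z) * ee L (- k) z)) \<partial>circ L)"
      by (intro Bochner_Integration.integral_cong) (auto simp: algebra_simps)
    also have "\<dots> = Re (\<integral>z. c * (of_real (h z) * ee L (- k) z) \<partial>circ L)"
      by (rule integral_Re) (intro integrable_mult_right integrable_mult_ee L2_integrable that)
    also have "\<dots> = Re (c * (L * fc L h k))" using L_pos by (simp add: fc_def)
    finally show ?thesis .
  qed
  define x where "x = frq L (- k) ^ n * (L * fc L f k) - (- 1) ^ n * (L * fc L g k)"
  have "Re (c * x) = 0" for c
  proof -
    have "(LINT z:{0..L}|lborel. f z * (deriv ^^ n) (\<lambda>z. Re (c * ee L (- k) z)) z) =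
        (- 1) ^ n * (LINT z:{0..L}|lborel. g z * Re (c * ee L (- k) z))" using assms Re_ee_smooth unfolding has_weak_deriv_def by blast
    then have "Re (c * frq L (- k) ^ n * (L * fc L f k)) = (- 1) ^ n * Re (c * (L * fc L g k))"
      unfolding integral_circ funpow_deriv_Re_ee int[OF f] int[OF g] .
    also have "\<dots> = Re (of_real ((- 1) ^ n) * (c * (L * fc L g k)))" by (simp only: Re_complex_of_real times_complex.sel Im_complex_of_real mult_zero_left diff_zero)
    finally show ?thesis by (simp add: x_def algebra_simps)
  qed
  \<comment> \<open>The choice \<open>c = cnj x\<close> turns the vanishing real part into
    \<open>(cmod x)\<^sup>2 = 0\<close>.\<close>
  from this[of "cnj x"] have "x = 0" by (simp add: complex_eq_iff power2_eq_square[symmetric] sum_power2_eq_zero_iff)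
  moreover have "frq L (- k) ^ n = (- 1) ^ n * frq L k ^ n" by (simp add: power_minus[of "frq L k"])
  ultimately have "(- 1) ^ n * (complex_of_real L * (frq L k ^ n * fc L f k - fc L g k)) = 0"
    unfolding x_def by (simp only: ring_distribs mult_ac)
  then show ?thesis using L_pos by simp
qed

text \<open>Parseval turns both sides of the weak formulation into sums over frequencies, where they
  agree term by term because \<open>frq\<close> is odd.\<close>

lemma fc_imp_has_weak_deriv:
  assumes f: "f \<in> L2 L" and g: "g \<in> L2 L" and eq: "\<And>k. fc L g k = frq L k ^ n * fc L f k"
  shows "has_weak_deriv L n f g"
proof -
  have "(\<integral>z. f z * (deriv ^^ n) \<phi> z \<partial>circ L) = (- 1) ^ n * (\<integral>z. g z * \<phi> z \<partial>circ L)" if \<phi>: "\<phi> \<in> smooth_fun L" for \<phi>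
  proof -
    have "fc L f (- l) * fc L ((deriv ^^ n) \<phi>) l = (- 1) ^ n * (fc L g (- l) * fc L \<phi> l)" for l
    proof -
      have "frq L l ^ n = (- 1) ^ n * frq L (- l) ^ n" by (simp flip: power_mult_distrib)
      then show ?thesis using \<phi> by (simp only: eq fc_funpow_deriv mult_ac)
    qed
    then have "L * (\<Sum>l\<in>symint J. fc L f (- l) * fc L ((deriv ^^ n) \<phi>) l) = (- 1) ^ n * (L * (\<Sum>l\<in>symint J. fc L g (- l) * fc L \<phi> l))" for J
      by (simp add: sum_distrib_left mult_ac)
    moreover have "(\<lambda>J. L * (\<Sum>l\<in>symint J. fc L f (- l) * fc L ((deriv ^^ n) \<phi>) l)) \<longlonglongrightarrow> of_real (\<integral>z. f z * (deriv ^^ n) \<phi> z \<partial>circ L)"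
      by (intro Parseval f smooth_fun_L2 smooth_fun_funpow_deriv \<phi>)
    moreover have "(\<lambda>J. (- 1) ^ n * (L * (\<Sum>l\<in>symint J. fc L g (- l) * fc L \<phi> l))) \<longlonglongrightarrow> (- 1) ^ n * of_real (\<integral>z. g z * \<phi> z \<partial>circ L)"
      by (intro tendsto_intros Parseval g smooth_fun_L2 \<phi>)
    ultimately have "complex_of_real (\<integral>z. f z * (deriv ^^ n) \<phi> z \<partial>circ L) = (- 1) ^ n * of_real (\<integral>z. g z * \<phi> z \<partial>circ L)"
      by (simp only:) (rule LIMSEQ_unique)
    also have "\<dots> = of_real ((- 1) ^ n * (\<integral>z. g z * \<phi> z \<partial>circ L))" by simp
    finally show ?thesis by (simp only: of_real_eq_iff)
  qed
  then show ?thesis using f g by (simp add: has_weak_deriv_def integral_circ)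
qed

lemma cmod_frq: "(cmod (frq L k ^ n * x))\<^sup>2 = (2 * pi / L) ^ (2 * n) * ((real_of_int k) ^ (2 * n) * (cmod x)\<^sup>2)"
proof -
  have sq: "(cmod (frq L k))\<^sup>2 = (2 * pi / L)\<^sup>2 * (of_int k)\<^sup>2"
    by (simp add: frq_def norm_mult norm_divide power_mult_distrib power_divide)
  have "(cmod (frq L k ^ n * x))\<^sup>2 = ((cmod (frq L k))\<^sup>2) ^ n * (cmod x)\<^sup>2"
    by (simp only: norm_mult norm_power power_mult_distrib power_mult[symmetric] mult.commute[of n])
  then show ?thesis by (simp only: sq power_mult power_mult_distrib mult.assoc)
qed

lemma sum_has_weak_deriv:
  assumes "has_weak_deriv L n f g"
  shows "(\<Sum>k\<in>symint J. (cmod (fc L g k))\<^sup>2) = (2 * pi / L) ^ (2 * n) * sobolev_sum n f J"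
  unfolding has_weak_deriv_imp_fc[OF assms] cmod_frq sobolev_sum_def by (simp add: sum_distrib_left)

lemma sobolev_sum_mono: "I \<le> J \<Longrightarrow> sobolev_sum n f I \<le> sobolev_sum n f J"
  unfolding sobolev_sum_def by (intro sum_mono2 symint_mono) (auto simp: zero_le_even_power)

text \<open>The weak derivative is produced by Riesz-Fischer from the coefficients it must
  have.\<close>

lemma bounded_sobolev_sum_imp_weak_deriv:
  assumes f: "f \<in> L2 L" and B: "\<And>J. sobolev_sum n f J \<le> B"
  shows "\<exists>g. has_weak_deriv L n f g"
proof -
  define c where "c k = frq L k ^ n * fc L f k" for k
  have "c (- k) = cnj (c k)" for k by (simp add: c_def fc_cnj)
  moreover have "(\<Sum>k\<in>symint J. (cmod (c k))\<^sup>2) \<le> (2 * pi / L) ^ (2 * n) * B" for J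
    unfolding c_def cmod_frq sum_distrib_left[symmetric] using B[of J] L_pos by (intro mult_left_mono) (auto simp: sobolev_sum_def)
  ultimately obtain g where "g \<in> L2 L" "\<And>k. fc L g k = c k" using Riesz_Fischer[of c] by blast
  then show ?thesis using fc_imp_has_weak_deriv[OF f, of g n] by (auto simp: c_def)
qed

text \<open>The space asks for weak derivatives of every order up to \<open>n\<close>, while the
  bound concerns order \<open>n\<close> alone: the lower orders follow from the top one together
  with Bessel's inequality for \<open>f\<close>.\<close>

lemma sobolev_iff:
  "f \<in> sobolev L n \<longleftrightarrow> f \<in> L2 L \<and> (\<exists>B. \<forall>J. sobolev_sum n f J \<le> B)"
proof safe
  assume f: "f \<in> sobolev L n"
  then show "f \<in> L2 L" by (simp add: sobolev_def)
  from f obtain g where g: "has_weak_deriv L n f g" by (auto simp: sobolev_def)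
  then have "g \<in> L2 L" by (simp add: has_weak_deriv_def)
  have "sobolev_sum n f J \<le> (\<integral>z. (g z)\<^sup>2 \<partial>circ L) / (L * (2 * pi / L) ^ (2 * n))" for J
    using Bessel[OF \<open>g \<in> L2 L\<close>, of J] L_pos unfolding sum_has_weak_deriv[OF g] by (subst pos_le_divide_eq) (auto simp: mult_ac)
  then show "\<exists>B. \<forall>J. sobolev_sum n f J \<le> B" by blast
next
  fix B assume f: "f \<in> L2 L" and B: "\<forall>J. sobolev_sum n f J \<le> B"
  have "\<exists>g. has_weak_deriv L j f g" if "j \<le> n" for j
  proof (rule bounded_sobolev_sum_imp_weak_deriv[OF f])
    fix J
    \<comment> \<open>The summand \<open>1\<close> covers frequency \<open>0\<close>, where
      \<open>j = 0\<close> gives \<open>0 ^ 0 = 1\<close>.\<close>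
    have "(real_of_int k) ^ (2 * j) \<le> (real_of_int k) ^ (2 * n) + 1" for k
    proof (cases "k = 0")
      case False
      then have "1 \<le> (real_of_int k)\<^sup>2" using int_one_le_iff_zero_less[of "k\<^sup>2"]
        by (metis of_int_1_le_iff of_int_power zero_less_power2)
      then have "((real_of_int k)\<^sup>2) ^ j \<le> ((real_of_int k)\<^sup>2) ^ n" using that by (rule power_increasing[rotated])
      then show ?thesis by (simp add: power_mult)
    qed (auto simp: power_0_left)
    then have "sobolev_sum j f J \<le> (\<Sum>k\<in>symint J. ((real_of_int k) ^ (2 * n) + 1) * (cmod (fc L f k))\<^sup>2)"
      unfolding sobolev_sum_def by (intro sum_mono mult_right_mono) auto
    also have "\<dots> = sobolev_sum n f J + (\<Sum>k\<in>symint J. (cmod (fc L f k))\<^sup>2)"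
      by (simp add: sobolev_sum_def ring_distribs sum.distrib)
    also have "\<dots> \<le> B + (\<integral>z. (f z)\<^sup>2 \<partial>circ L) / L"
      using B Bessel[OF f, of J] L_pos by (intro add_mono) (auto simp: field_simps)
    finally show "sobolev_sum j f J \<le> B + (\<integral>z. (f z)\<^sup>2 \<partial>circ L) / L" .
  qed
  then show "f \<in> sobolev L n" using f by (simp add: sobolev_def)
qed

lemma mean_eq: "of_real (mean L f) = fc L f 0" by (simp add: mean_def fc_def integral_circ)

lemma V_space_iff:
  "f \<in> V_space L n \<longleftrightarrow> f \<in> L2 L \<and> fc L f 0 = 0 \<and> (\<exists>B. \<forall>J. sobolev_sum n f J \<le> B)"
  unfolding V_space_def mem_Collect_eq sobolev_iff mean_eq[symmetric] by auto

lemma has_weak_deriv_weak_deriv: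
  assumes "f \<in> sobolev L n" "j \<le> n"
  shows "has_weak_deriv L j f (weak_deriv L j f)"
proof -
  have "\<exists>g. has_weak_deriv L j f g" using assms by (auto simp: sobolev_def)
  then show ?thesis unfolding weak_deriv_def by (rule someI_ex)
qed

text \<open>\<open>weak_deriv\<close> picks an arbitrary representative, but its coefficients are
  determined, and Parseval sees nothing else.\<close>

lemma V_norm_limit:
  assumes "f \<in> sobolev L n"
  shows "(\<lambda>J. L * (2 * pi / L) ^ (2 * n) * sobolev_sum n f J) \<longlonglongrightarrow> (V_norm L n f)\<^sup>2"
proof -
  have w: "has_weak_deriv L n f (weak_deriv L n f)" using has_weak_deriv_weak_deriv[OF assms] by simp
  then have g: "weak_deriv L n f \<in> L2 L" by (simp add: has_weak_deriv_def)
  have "(V_norm L n f)\<^sup>2 = (\<integral>z. (weak_deriv L n f z)\<^sup>2 \<partial>circ L)" by (simp add: V_norm_def integral_circ)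
  then show ?thesis using Parseval_norm[OF g] by (simp add: sum_has_weak_deriv[OF w] mult_ac)
qed

lemma sobolev_sum_le_V_norm:
  assumes "f \<in> sobolev L n"
  shows "L * (2 * pi / L) ^ (2 * n) * sobolev_sum n f J \<le> (V_norm L n f)\<^sup>2"
  by (rule incseq_le[OF _ V_norm_limit[OF assms]])
    (use L_pos in \<open>auto intro!: monoI mult_left_mono sobolev_sum_mono\<close>)

lemma V_norm_le:
  assumes "f \<in> sobolev L n" "\<And>J. sobolev_sum n f J \<le> B"
  shows "(V_norm L n f)\<^sup>2 \<le> L * (2 * pi / L) ^ (2 * n) * B"
  by (rule LIMSEQ_le_const2[OF V_norm_limit[OF assms(1)]])
    (use assms(2) L_pos in \<open>auto intro!: mult_left_mono\<close>)

end

section \<open>Convolution estimates\<close>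

text \<open>Later bounds are assumed for all finite frequency sets, since the ranges of
  \<open>k - l\<close> in a convolution are not symmetric; this passes between the two kinds of
  sets.\<close>

lemma finite_subset_symint:
  assumes "finite (F :: int set)" obtains K where "F \<subseteq> symint K" "K \<ge> m"
proof -
  define K where "K = m + (\<Sum>k\<in>F. nat \<bar>k\<bar>)"
  have "nat \<bar>k\<bar> \<le> K" if "k \<in> F" for k
    using member_le_sum[of k F "\<lambda>k. nat \<bar>k\<bar>"] that assms by (simp add: K_def)
  then have "F \<subseteq> symint K" by force
  then show thesis using that[of K] by (simp add: K_def)
qed

lemma sum_symint:
  fixes f :: "int \<Rightarrow> 'a::ab_group_add"
  shows "(\<Sum>k\<in>symint n. f k) = f 0 + (\<Sum>i<n. f (int (Suc i)) + f (- int (Suc i)))"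
proof (induction n)
  case (Suc n)
  have eq: "symint (Suc n) = insert (int (Suc n)) (insert (- int (Suc n)) (symint n))" by auto
  have "(\<Sum>k\<in>symint (Suc n). f k) = f (int (Suc n)) + (f (- int (Suc n)) + (\<Sum>k\<in>symint n. f k))"
    unfolding eq by (subst sum.insert, simp, simp, subst sum.insert) auto
  then show ?case using Suc by (simp add: algebra_simps)
qed simp

text \<open>Comparison with the telescoping sum of \<open>1 / n - 1 / (n + 1)\<close> gives at most
  \<open>2\<close> on each side of zero.\<close>

lemma sum_inverse_squares_le:
  assumes "finite F" "0 \<notin> F"
  shows "(\<Sum>k\<in>F. 1 / (real_of_int k)\<^sup>2) \<le> 4"
proof -
  obtain n where n: "F \<subseteq> symint n" using finite_subset_symint[OF assms(1)] by metis
  have "(\<Sum>i<Suc n. 1 / (real (Suc i))\<^sup>2) \<le> 2 - 1 / real (Suc n)" for n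
  proof (induction n)
    case (Suc n)
    have "1 / (real (Suc (Suc n)))\<^sup>2 \<le> 1 / (real (Suc n) * real (Suc (Suc n)))"
      unfolding power2_eq_square by (intro divide_left_mono mult_right_mono) auto
    also have "\<dots> = 1 / real (Suc n) - 1 / real (Suc (Suc n))" by (simp add: field_simps)
    finally show ?case using Suc by simp
  qed simp
  from this[of n] have le2: "(\<Sum>i<n. 1 / (real (Suc i))\<^sup>2) \<le> 2"
    by (simp del: of_nat_Suc) (smt (verit) divide_nonneg_nonneg of_nat_0_le_iff zero_le_power2)
  have "(\<Sum>k\<in>F. 1 / (real_of_int k)\<^sup>2) \<le> (\<Sum>k\<in>symint n. 1 / (real_of_int k)\<^sup>2)" using n by (intro sum_mono2) auto
  also have "\<dots> = (\<Sum>i<n. 2 * (1 / (real (Suc i))\<^sup>2))" unfolding sum_symint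
    using power2_minus[of "1 + real _"] by (simp add: power2_eq_square algebra_simps)
  also have "\<dots> = 2 * (\<Sum>i<n. 1 / (real (Suc i))\<^sup>2)" by (simp only: sum_distrib_left)
  also have "\<dots> \<le> 4" using le2 by simp
  finally show ?thesis .
qed

text \<open>One derivative in l2 makes the coefficients absolutely summable: split off
  \<open>1 / \<bar>k\<bar>\<close> and use \<open>a * b \<le> a\<^sup>2 + b\<^sup>2\<close>. This is
  the source of the constant \<open>M + 4\<close> in all later rates.\<close>

lemma sum_cmod_le:
  fixes c :: "int \<Rightarrow> complex"
  assumes "c 0 = 0" "finite F" "\<And>F. finite F \<Longrightarrow> (\<Sum>k\<in>F. (\<bar>real_of_int k\<bar> * cmod (c k))\<^sup>2) \<le> M"
  shows "(\<Sum>k\<in>F. cmod (c k)) \<le> M + 4"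
proof -
  have "(\<Sum>k\<in>F. cmod (c k)) = (\<Sum>k\<in>F - {0}. cmod (c k))" using assms(1,2) by (intro sum.mono_neutral_right) auto
  also have "\<dots> \<le> (\<Sum>k\<in>F - {0}. (\<bar>real_of_int k\<bar> * cmod (c k))\<^sup>2 + 1 / (real_of_int k)\<^sup>2)"
  proof (rule sum_mono)
    fix k assume "k \<in> F - {0}"
    define a b where "a = \<bar>real_of_int k\<bar> * cmod (c k)" "b = 1 / \<bar>real_of_int k\<bar>"
    have "cmod (c k) = a * b" using \<open>k \<in> F - {0}\<close> by (simp add: a_b_def)
    also have "\<dots> \<le> a\<^sup>2 + b\<^sup>2" using sum_squares_bound[of a b] zero_le_power2[of a] zero_le_power2[of b] by linarith
    finally show "cmod (c k) \<le> (\<bar>real_of_int k\<bar> * cmod (c k))\<^sup>2 + 1 / (real_of_int k)\<^sup>2"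
      by (simp add: a_b_def power_divide)
  qed
  also have "\<dots> \<le> M + 4" unfolding sum.distrib using assms sum_inverse_squares_le[of "F - {0}"] by (intro add_mono) auto
  finally show ?thesis .
qed

text \<open>Young's inequality for trilinear convolution forms; the digits in the names are the exponents.\<close>

lemma Young_212:
  fixes x y z :: "int \<Rightarrow> real"
  assumes "finite A" "finite B" "\<And>k. x k \<ge> 0" "\<And>k. y k \<ge> 0" "\<And>k. z k \<ge> 0"
    and y: "\<And>F. finite F \<Longrightarrow> (\<Sum>k\<in>F. y k) \<le> Y"
    and x: "\<And>F. finite F \<Longrightarrow> (\<Sum>k\<in>F. (x k)\<^sup>2) \<le> X" and z: "\<And>F. finite F \<Longrightarrow> (\<Sum>k\<in>F. (z k)\<^sup>2) \<le> X"
  shows "(\<Sum>k\<in>A. \<Sum>l\<in>B. x k * y (k - l) * z l) \<le> Y * X"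
proof -
  have Y: "Y \<ge> 0" using y[of "{}"] by simp
  \<comment> \<open>Separating the two square-summable factors leaves \<open>y\<close> alone, to be
    summed over a reflected range in \<open>l\<close> or a translated one in
    \<open>k\<close>.\<close>
  have "(\<Sum>k\<in>A. \<Sum>l\<in>B. x k * y (k - l) * z l) \<le> (\<Sum>k\<in>A. \<Sum>l\<in>B. (x k)\<^sup>2 / 2 * y (k - l) + (z l)\<^sup>2 / 2 * y (k - l))"
  proof (intro sum_mono)
    fix k l
    have "x k * z l * y (k - l) \<le> ((x k)\<^sup>2 / 2 + (z l)\<^sup>2 / 2) * y (k - l)"
      using sum_squares_bound[of "x k" "z l"] assms(4) by (intro mult_right_mono) auto
    then show "x k * y (k - l) * z l \<le> (x k)\<^sup>2 / 2 * y (k - l) + (z l)\<^sup>2 / 2 * y (k - l)" by (simp add: algebra_simps)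
  qed
  also have "\<dots> = (\<Sum>k\<in>A. (x k)\<^sup>2 / 2 * (\<Sum>l\<in>B. y (k - l))) + (\<Sum>l\<in>B. (z l)\<^sup>2 / 2 * (\<Sum>k\<in>A. y (k - l)))"
    unfolding sum.distrib sum_distrib_left by (subst (2) sum.swap) (rule refl)
  also have "\<dots> \<le> (\<Sum>k\<in>A. (x k)\<^sup>2 / 2 * Y) + (\<Sum>l\<in>B. (z l)\<^sup>2 / 2 * Y)"
  proof (intro add_mono sum_mono mult_left_mono)
    show "(\<Sum>l\<in>B. y (k - l)) \<le> Y" for k using y[of "(\<lambda>l. k - l) ` B"] assms(2) by (simp add: sum.reindex inj_on_def)
    show "(\<Sum>k\<in>A. y (k - l)) \<le> Y" for l using y[of "(\<lambda>k. k - l) ` A"] assms(1) by (simp add: sum.reindex inj_on_def)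
  qed auto
  also have "\<dots> = Y / 2 * (\<Sum>k\<in>A. (x k)\<^sup>2) + Y / 2 * (\<Sum>l\<in>B. (z l)\<^sup>2)"
    by (simp add: sum_distrib_left mult.commute)
  also have "\<dots> \<le> Y / 2 * X + Y / 2 * X" using x[OF assms(1)] z[OF assms(2)] Y by (intro add_mono mult_left_mono) auto
  finally show ?thesis by (simp add: mult.commute)
qed

lemma Young_221:
  fixes x y z :: "int \<Rightarrow> real"
  assumes "finite A" "finite B" "\<And>k. x k \<ge> 0" "\<And>k. y k \<ge> 0" "\<And>k. z k \<ge> 0"
    and z: "\<And>F. finite F \<Longrightarrow> (\<Sum>k\<in>F. z k) \<le> Z"
    and x: "\<And>F. finite F \<Longrightarrow> (\<Sum>k\<in>F. (x k)\<^sup>2) \<le> X" and y: "\<And>F. finite F \<Longrightarrow> (\<Sum>k\<in>F. (y k)\<^sup>2) \<le> X"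
  shows "(\<Sum>k\<in>A. \<Sum>l\<in>B. x k * y (k - l) * z l) \<le> Z * X"
proof -
  have X: "X \<ge> 0" using x[of "{}"] by simp
  \<comment> \<open>The summable factor now sits at \<open>l\<close>, so the sum over
    \<open>k\<close> is estimated first, uniformly in the shift \<open>l\<close>.\<close>
  have "(\<Sum>k\<in>A. \<Sum>l\<in>B. x k * y (k - l) * z l) = (\<Sum>l\<in>B. z l * (\<Sum>k\<in>A. x k * y (k - l)))"
    unfolding sum_distrib_left by (subst sum.swap) (simp add: mult_ac)
  also have "\<dots> \<le> (\<Sum>l\<in>B. z l * X)"
  proof (intro sum_mono mult_left_mono)
    fix l
    have "(\<Sum>k\<in>A. x k * y (k - l)) \<le> (\<Sum>k\<in>A. (x k)\<^sup>2 / 2 + (y (k - l))\<^sup>2 / 2)"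
    proof (rule sum_mono)
      show "x k * y (k - l) \<le> (x k)\<^sup>2 / 2 + (y (k - l))\<^sup>2 / 2" for k using sum_squares_bound[of "x k" "y (k - l)"] by simp
    qed
    also have "\<dots> = (\<Sum>k\<in>A. (x k)\<^sup>2) / 2 + (\<Sum>k\<in>A. (y (k - l))\<^sup>2) / 2"
      by (simp add: sum.distrib sum_divide_distrib)
    also have "(\<Sum>k\<in>A. (y (k - l))\<^sup>2) \<le> X" using y[of "(\<lambda>k. k - l) ` A"] assms(1) by (simp add: sum.reindex inj_on_def)
    finally show "(\<Sum>k\<in>A. x k * y (k - l)) \<le> X" using x[OF assms(1)] by simp
  qed (use assms in auto)
  also have "\<dots> = (\<Sum>l\<in>B. z l) * X" by (simp add: sum_distrib_right)
  also have "\<dots> \<le> Z * X" using z[OF assms(2)] X by (rule mult_right_mono)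
  finally show ?thesis .
qed

section \<open>Saturated weights and their commutator\<close>

definition wt :: "nat \<Rightarrow> nat \<Rightarrow> int \<Rightarrow> real" where
  "wt N r k = (min \<bar>real_of_int k\<bar> (real N)) ^ r"

lemma wt_nonneg [simp]: "wt N r k \<ge> 0" by (simp add: wt_def)

lemma wt_le: "wt N r k \<le> real N ^ r" unfolding wt_def by (intro power_mono) auto

lemma wt_le_power: "wt N r k \<le> \<bar>real_of_int k\<bar> ^ r" unfolding wt_def by (intro power_mono) auto

text \<open>A mean value inequality: on \<open>[0, m]\<close> the derivative of the power is at most
  \<open>Suc n * m ^ n\<close>.\<close>

lemma abs_power_diff_le:
  fixes x y m :: real
  assumes "0 \<le> x" "x \<le> m" "0 \<le> y" "y \<le> m"
  shows "\<bar>x ^ Suc n - y ^ Suc n\<bar> \<le> real (Suc n) * \<bar>x - y\<bar> * m ^ n"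
proof (induction n)
  case (Suc n)
  have "\<bar>x ^ Suc (Suc n) - y ^ Suc (Suc n)\<bar> = \<bar>x * (x ^ Suc n - y ^ Suc n) + (x - y) * y ^ Suc n\<bar>"
    by (simp add: algebra_simps)
  also have "\<dots> \<le> x * \<bar>x ^ Suc n - y ^ Suc n\<bar> + \<bar>x - y\<bar> * y ^ Suc n"
    by (rule order.trans[OF abs_triangle_ineq]) (use assms in \<open>simp add: abs_mult\<close>)
  also have "\<dots> \<le> m * (real (Suc n) * \<bar>x - y\<bar> * m ^ n) + \<bar>x - y\<bar> * m ^ Suc n"
    using assms Suc by (intro add_mono mult_mono power_mono mult_left_mono) auto
  also have "\<dots> = real (Suc (Suc n)) * \<bar>x - y\<bar> * m ^ Suc n" by (simp add: algebra_simps)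
  finally show ?case .
qed simp

lemma add_power_le:
  fixes x y :: real
  assumes "0 \<le> x" "0 \<le> y"
  shows "(x + y) ^ r \<le> 2 ^ r * (x ^ r + y ^ r)"
proof -
  have "(x + y) ^ r \<le> (2 * max x y) ^ r" using assms by (intro power_mono) auto
  also have "\<dots> = 2 ^ r * (max x y) ^ r" by (simp add: power_mult_distrib)
  also have "(max x y) ^ r \<le> x ^ r + y ^ r" using assms by (auto simp: max_def)
  finally show ?thesis by simp
qed

text \<open>Write \<open>k = l + (k - l)\<close>; the minimum with \<open>N\<close> is
  subadditive.\<close>

lemma wt_triangle: "wt N r k \<le> 2 ^ r * (wt N r l + wt N r (k - l))"
proof -
  have "wt N r k \<le> (min \<bar>real_of_int l\<bar> (real N) + min \<bar>real_of_int (k - l)\<bar> (real N)) ^ r"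
    unfolding wt_def by (intro power_mono) auto
  also have "\<dots> \<le> 2 ^ r * (wt N r l + wt N r (k - l))" unfolding wt_def by (rule add_power_le) auto
  finally show ?thesis .
qed

text \<open>The commutator estimate: the weight is saturated beyond \<open>N\<close>, so that the loss of one derivative
  in \<open>l\<close> is compensated by \<open>k - l\<close> uniformly in \<open>N\<close>.\<close>

lemma wt_commutator:
  "\<bar>real_of_int l\<bar> * \<bar>wt N r k - wt N r l\<bar> \<le> 2 * real r * 2 ^ r * \<bar>real_of_int (k - l)\<bar> * (wt N r l + wt N r (k - l))"
proof (cases r)
  case 0
  then show ?thesis by (simp add: wt_def)
next
  case (Suc n)
  define a b c where "a = min \<bar>real_of_int k\<bar> (real N)" "b = min \<bar>real_of_int l\<bar> (real N)"
    "c = min \<bar>real_of_int (k - l)\<bar> (real N)"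
  have abc: "0 \<le> a" "0 \<le> b" "0 \<le> c" "a \<le> b + c" by (auto simp: a_b_c_def)
  \<comment> \<open>The heart of the estimate. If \<open>l\<close> is not saturated, then
    \<open>\<bar>l\<bar> = b\<close> and saturation is 1-Lipschitz; if both are saturated, the left
    side vanishes; the mixed case produces the factor \<open>2\<close>.\<close>
  have key: "\<bar>real_of_int l\<bar> * \<bar>a - b\<bar> \<le> 2 * \<bar>real_of_int (k - l)\<bar> * b"
  proof (cases "\<bar>real_of_int l\<bar> \<le> real N")
    case True
    have "\<bar>a - b\<bar> \<le> \<bar>\<bar>real_of_int k\<bar> - \<bar>real_of_int l\<bar>\<bar>"
    proof -
      have "\<bar>min x n - min y n\<bar> \<le> \<bar>x - y\<bar>" for x y n :: real by (simp add: min_def abs_if)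
      then show ?thesis by (simp add: a_b_c_def)
    qed
    also have "\<dots> \<le> \<bar>real_of_int k - real_of_int l\<bar>" by (rule abs_triangle_ineq3)
    also have "\<dots> \<le> 2 * \<bar>real_of_int k - real_of_int l\<bar>"
      using mult_right_mono[of 1 2 "\<bar>real_of_int k - real_of_int l\<bar>"] by simp
    finally have "\<bar>a - b\<bar> \<le> 2 * \<bar>real_of_int (k - l)\<bar>" by simp
    then have "b * \<bar>a - b\<bar> \<le> b * (2 * \<bar>real_of_int (k - l)\<bar>)" using abc by (intro mult_left_mono) auto
    moreover have "\<bar>real_of_int l\<bar> = b" using True by (simp add: a_b_c_def)
    ultimately show ?thesis by (simp only: mult_ac)
  next
    case l: False
    then have b: "b = real N" by (simp add: a_b_c_def)
    show ?thesis
    proof (cases "\<bar>real_of_int k\<bar> \<le> real N")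
      case True
      define d where "d = \<bar>real_of_int (k - l)\<bar>"
      have d: "\<bar>real_of_int l\<bar> \<le> d + \<bar>real_of_int k\<bar>" by (simp add: d_def)
      have "\<bar>a - b\<bar> = real N - \<bar>real_of_int k\<bar>" using True b by (simp add: a_b_c_def)
      then have "\<bar>real_of_int l\<bar> * \<bar>a - b\<bar> \<le> (d + \<bar>real_of_int k\<bar>) * (real N - \<bar>real_of_int k\<bar>)"
        using d True by (simp add: mult_right_mono)
      also have "\<dots> = d * (real N - \<bar>real_of_int k\<bar>) + \<bar>real_of_int k\<bar> * (real N - \<bar>real_of_int k\<bar>)"
        by (simp add: algebra_simps)
      \<comment> \<open>As \<open>l\<close> lies beyond \<open>N\<close>, the difference
        \<open>N - \<bar>k\<bar>\<close> is at most
        \<open>\<bar>l\<bar> - \<bar>k\<bar> \<le> d\<close>; the other factor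
        \<open>\<bar>k\<bar>\<close> is at most \<open>N\<close>.\<close>
      also have "\<dots> \<le> d * real N + real N * d" using True l d by (intro add_mono mult_left_mono mult_mono) (auto simp: d_def)
      finally show ?thesis by (simp add: b d_def mult_ac)
    next
      case False
      then show ?thesis using l b by (simp add: a_b_c_def)
    qed
  qed
  \<comment> \<open>\<open>b + c\<close> dominates both bases: \<open>a\<close> by the triangle
    inequality, \<open>b\<close> because \<open>c\<close> is nonnegative.\<close>
  have "\<bar>a ^ r - b ^ r\<bar> \<le> real r * \<bar>a - b\<bar> * (b + c) ^ n" unfolding Suc using abc by (intro abs_power_diff_le) auto
  then have "\<bar>real_of_int l\<bar> * \<bar>a ^ r - b ^ r\<bar> \<le> \<bar>real_of_int l\<bar> * (real r * \<bar>a - b\<bar> * (b + c) ^ n)"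
    by (rule mult_left_mono) simp
  also have "\<dots> = real r * (\<bar>real_of_int l\<bar> * \<bar>a - b\<bar>) * (b + c) ^ n" by simp
  also have "\<dots> \<le> real r * (2 * \<bar>real_of_int (k - l)\<bar> * b) * (b + c) ^ n"
    using abc by (intro mult_right_mono mult_left_mono key) auto
  also have "\<dots> \<le> real r * (2 * \<bar>real_of_int (k - l)\<bar> * (b + c)) * (b + c) ^ n"
    using abc by (intro mult_right_mono mult_left_mono) auto
  also have "\<dots> = 2 * real r * \<bar>real_of_int (k - l)\<bar> * (b + c) ^ r" by (simp add: Suc)
  also have "\<dots> \<le> 2 * real r * \<bar>real_of_int (k - l)\<bar> * (2 ^ r * (b ^ r + c ^ r))"
    using abc by (intro mult_left_mono add_power_le) auto
  finally show ?thesis using abc by (simp add: wt_def a_b_c_def mult_right_mono mult_ac)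
qed

lemma one_le_abs_of_int: "k \<noteq> 0 \<Longrightarrow> 1 \<le> \<bar>real_of_int k\<bar>"
  by (metis int_one_le_iff_zero_less of_int_1_le_iff of_int_abs zero_less_abs_iff)

lemma sum_norm_double_le:
  fixes t :: "'a \<Rightarrow> 'b \<Rightarrow> complex"
  assumes "\<And>k l. k \<in> A \<Longrightarrow> l \<in> B \<Longrightarrow> cmod (t k l) \<le> b k l"
  shows "cmod (\<Sum>k\<in>A. \<Sum>l\<in>B. t k l) \<le> (\<Sum>k\<in>A. \<Sum>l\<in>B. b k l)"
  by (intro sum_norm_le assms)

section \<open>Energy estimates at one instant\<close>

abbreviation advect :: "real \<Rightarrow> (int \<Rightarrow> complex) \<Rightarrow> (int \<Rightarrow> complex) \<Rightarrow> nat \<Rightarrow> int \<Rightarrow> complex" where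
  "advect \<kappa> v f J k \<equiv> (\<Sum>l\<in>symint J. v (k - l) * (\<i> * \<kappa> * l) * f l)"

text \<open>With \<open>\<kappa> = 2 * pi / L\<close>, \<open>advect\<close> stands for the
  coefficients of v f_z and \<open>stretch\<close> for those of v_z f, each using only the
  frequencies of \<open>f\<close> up to \<open>J\<close>.\<close>

abbreviation stretch :: "real \<Rightarrow> (int \<Rightarrow> complex) \<Rightarrow> (int \<Rightarrow> complex) \<Rightarrow> nat \<Rightarrow> int \<Rightarrow> complex" where
  "stretch \<kappa> v f J k \<equiv> (\<Sum>l\<in>symint J. (\<i> * \<kappa> * (k - l) * v (k - l)) * f l)"

abbreviation pairing :: "nat \<Rightarrow> nat \<Rightarrow> nat \<Rightarrow> (int \<Rightarrow> complex) \<Rightarrow> (int \<Rightarrow> complex) \<Rightarrow> complex" where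
  "pairing N r K a b \<equiv> (\<Sum>k\<in>symint K. of_real ((wt N r k)\<^sup>2) * cnj (a k) * b k)"

text \<open>\<open>A\<close> bounds the absolute sums, \<open>X\<close> the saturated energy and
  \<open>M\<close> the squared H^1 seminorm; in \<open>transport_le\<close>, \<open>M\<close> occurs
  only in the error of the frequency cutoff. The velocity will enter through \<open>q\<close>, which
  dominates the coefficients of v_z in modulus.\<close>

locale energy_snapshot =
  fixes f q :: "int \<Rightarrow> complex" and A X M :: real and N r :: nat
  assumes A: "\<And>F. finite F \<Longrightarrow> (\<Sum>k\<in>F. cmod (f k)) \<le> A" "\<And>F. finite F \<Longrightarrow> (\<Sum>k\<in>F. cmod (q k)) \<le> A"
    and X: "\<And>F. finite F \<Longrightarrow> (\<Sum>k\<in>F. (wt N r k * cmod (f k))\<^sup>2) \<le> X"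
      "\<And>F. finite F \<Longrightarrow> (\<Sum>k\<in>F. (wt N r k * cmod (q k))\<^sup>2) \<le> X"
    and M: "\<And>F. finite F \<Longrightarrow> (\<Sum>k\<in>F. (\<bar>real_of_int k\<bar> * cmod (f k))\<^sup>2) \<le> M"
    and f_0: "f 0 = 0"
begin

lemma A_nonneg: "A \<ge> 0" and X_nonneg: "X \<ge> 0" using A(1)[of "{}"] X(1)[of "{}"] by simp_all

text \<open>Young's inequality, with the absolutely summable factor chosen by the position of the
  weight: \<open>q\<close> when the weight sits at \<open>l\<close>, \<open>f\<close> when it sits
  at \<open>k - l\<close>.\<close>

lemma weighted_convolution_le:
  assumes "finite B" "finite C"
  shows "(\<Sum>k\<in>B. \<Sum>l\<in>C. (wt N r k * cmod (f k)) * cmod (q (k - l)) * ((wt N r l + wt N r (k - l)) * cmod (f l))) \<le> 2 * A * X"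
proof -
  have "(\<Sum>k\<in>B. \<Sum>l\<in>C. (wt N r k * cmod (f k)) * cmod (q (k - l)) * (wt N r l * cmod (f l))) \<le> A * X"
    by (rule Young_212[where x = "\<lambda>k. wt N r k * cmod (f k)" and y = "\<lambda>k. cmod (q k)" and z = "\<lambda>k. wt N r k * cmod (f k)"])
       (use assms A X in auto)
  moreover have "(\<Sum>k\<in>B. \<Sum>l\<in>C. (wt N r k * cmod (f k)) * (wt N r (k - l) * cmod (q (k - l))) * cmod (f l)) \<le> A * X"
    by (rule Young_221[where x = "\<lambda>k. wt N r k * cmod (f k)" and y = "\<lambda>k. wt N r k * cmod (q k)" and z = "\<lambda>k. cmod (f k)"])
       (use assms A X in auto)
  ultimately show ?thesis by (simp add: algebra_simps sum.distrib)
qed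

text \<open>No derivative falls on \<open>f\<close>, so the triangle inequality for the weight
  suffices: one factor \<open>wt N r k\<close> stays with \<open>f k\<close>, the other is shared
  between \<open>l\<close> and \<open>k - l\<close>.\<close>

lemma stretching_le:
  assumes g: "\<And>j. cmod (g j) \<le> cmod (q j)"
  shows "\<bar>Re (pairing N r K f (\<lambda>k. \<Sum>l\<in>symint J. g (k - l) * f l))\<bar> \<le> 2 * 2 ^ r * A * X"
proof -
  define b where "b k l = (wt N r k * cmod (f k)) * cmod (q (k - l)) * ((wt N r l + wt N r (k - l)) * cmod (f l))" for k l
  have "\<bar>Re (pairing N r K f (\<lambda>k. \<Sum>l\<in>symint J. g (k - l) * f l))\<bar>
    \<le> cmod (\<Sum>k\<in>symint K. \<Sum>l\<in>symint J. (wt N r k)\<^sup>2 * cnj (f k) * (g (k - l) * f l))"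
    by (simp only: sum_distrib_left abs_Re_le_cmod)
  also have "\<dots> \<le> (\<Sum>k\<in>symint K. \<Sum>l\<in>symint J. 2 ^ r * b k l)"
  proof (rule sum_norm_double_le)
    fix k l
    have "cmod ((wt N r k)\<^sup>2 * cnj (f k) * (g (k - l) * f l)) = (wt N r k * cmod (f k)) * cmod (g (k - l)) * (wt N r k * cmod (f l))"
      by (simp add: norm_mult power2_eq_square)
    also have "\<dots> \<le> (wt N r k * cmod (f k)) * cmod (q (k - l)) * (2 ^ r * (wt N r l + wt N r (k - l)) * cmod (f l))"
      using g wt_triangle[of N r k l] by (intro mult_mono) auto
    also have "\<dots> = 2 ^ r * b k l" by (simp add: b_def mult_ac)
    finally show "cmod ((wt N r k)\<^sup>2 * cnj (f k) * (g (k - l) * f l)) \<le> 2 ^ r * b k l" .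
  qed
  also have "\<dots> = 2 ^ r * (\<Sum>k\<in>symint K. \<Sum>l\<in>symint J. b k l)" by (simp only: sum_distrib_left)
  also have "\<dots> \<le> 2 ^ r * (2 * A * X)" unfolding b_def by (intro mult_left_mono weighted_convolution_le) auto
  finally show ?thesis by (simp add: mult_ac)
qed

text \<open>Inside the cutoff one weight is moved from \<open>k\<close> to \<open>l\<close>: the
  part \<open>S\<close> is antisymmetric up to a term with v_z, the remainder \<open>R\<close> is
  the commutator. Frequencies \<open>l\<close> beyond \<open>K\<close> have no mirror term and form
  a tail, small because \<open>f\<close> lies in H^1.\<close>

lemma transport_le:
  assumes \<kappa>: "\<kappa> > 0" and v: "\<And>j. v (- j) = cnj (v j)"
    and vq: "\<And>j. \<kappa> * \<bar>real_of_int j\<bar> * cmod (v j) \<le> cmod (q j)"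
    and K: "K > 0" "K \<le> J"
  shows "\<bar>Re (pairing N r K f (advect \<kappa> v f J))\<bar>
    \<le> (1 + 4 * real r * 2 ^ r) * A * X + 2 * real N ^ (2 * r) * A * M / real K"
proof -
  define w where "w = wt N r"
  let ?a = "\<lambda>k. w k * cmod (f k)" and ?c = "\<lambda>k. \<bar>real_of_int k\<bar> * cmod (f k)" and ?v = "\<lambda>k l. \<kappa> * cmod (v (k - l))"
  define F where "F k = w k * f k" for k
  define S where "S k l = cnj (F k) * v (k - l) * (\<i> * \<kappa> * l) * F l" for k l
  define R where "R k l = cnj (F k) * v (k - l) * (\<i> * \<kappa> * l) * ((w k - w l) * f l)" for k l
  define t where "t k l = (w k)\<^sup>2 * cnj (f k) * (v (k - l) * (\<i> * \<kappa> * l) * f l)" for k l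
  have tSR: "t k l = S k l + R k l" for k l by (simp add: t_def S_def R_def F_def power2_eq_square algebra_simps)
  have w: "w k \<ge> 0" for k by (simp add: w_def)
  have "\<bar>Re (\<Sum>k\<in>symint K. \<Sum>l\<in>symint K. S k l)\<bar> \<le> A * X / 2"
  proof -
    define Z where "Z = (\<Sum>k\<in>symint K. \<Sum>l\<in>symint K. S k l)"
    have "cnj Z = (\<Sum>k\<in>symint K. \<Sum>l\<in>symint K. cnj (S l k))" unfolding Z_def cnj_sum by (rule sum.swap)
    then have "Z + cnj Z = (\<Sum>k\<in>symint K. \<Sum>l\<in>symint K. S k l + cnj (S l k))" unfolding Z_def by (simp add: sum.distrib)
    also have "cmod \<dots> \<le> (\<Sum>k\<in>symint K. \<Sum>l\<in>symint K. ?a k * cmod (q (k - l)) * ?a l)"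
    proof (rule sum_norm_double_le)
      fix k l
      have "cnj (v (l - k)) = v (k - l)" using v[of "l - k"] by simp
      \<comment> \<open>The factors \<open>l\<close> and \<open>- k\<close> add up to
        \<open>- (k - l)\<close>: the derivative has moved from \<open>f\<close> to
        \<open>v\<close>, where \<open>vq\<close> bounds it.\<close>
      then have "S k l + cnj (S l k) = - (cnj (F k) * v (k - l) * (\<i> * \<kappa> * (k - l)) * F l)" by (simp add: S_def algebra_simps)
      then have "cmod (S k l + cnj (S l k)) = ?a k * (\<kappa> * \<bar>real_of_int (k - l)\<bar> * cmod (v (k - l))) * ?a l"
        using \<kappa> w norm_of_int[of "k - l", where 'a=complex] by (simp add: norm_mult F_def mult_ac)
      also have "\<dots> \<le> ?a k * cmod (q (k - l)) * ?a l" using w vq[of "k - l"] by (intro mult_right_mono mult_left_mono) auto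
      finally show "cmod (S k l + cnj (S l k)) \<le> ?a k * cmod (q (k - l)) * ?a l" .
    qed
    also have "\<dots> \<le> A * X" by (rule Young_212[where x = ?a and y = "\<lambda>k. cmod (q k)" and z = ?a])
        (use A X in \<open>auto simp: w_def\<close>)
    finally have "cmod (Z + cnj Z) \<le> A * X" .
    then have "2 * \<bar>Re Z\<bar> \<le> A * X" by (simp add: complex_add_cnj norm_mult abs_mult)
    then show ?thesis by (simp add: Z_def)
  qed
  moreover have "\<bar>Re (\<Sum>k\<in>symint K. \<Sum>l\<in>symint K. R k l)\<bar> \<le> 2 * real r * 2 ^ r * (2 * A * X)"
  proof -
    define b where "b k l = ?a k * cmod (q (k - l)) * ((w l + w (k - l)) * cmod (f l))" for k l
    have "\<bar>Re (\<Sum>k\<in>symint K. \<Sum>l\<in>symint K. R k l)\<bar> \<le> cmod (\<Sum>k\<in>symint K. \<Sum>l\<in>symint K. R k l)"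
      by (rule abs_Re_le_cmod)
    also have "\<dots> \<le> (\<Sum>k\<in>symint K. \<Sum>l\<in>symint K. 2 * real r * 2 ^ r * b k l)"
    proof (rule sum_norm_double_le)
      fix k l
      have "cmod (R k l) = ?a k * ?v k l * (\<bar>real_of_int l\<bar> * \<bar>w k - w l\<bar>) * cmod (f l)"
        using \<kappa> w by (simp add: R_def F_def norm_mult mult_ac flip: of_real_diff)
      also have "\<dots> \<le> ?a k * ?v k l * (2 * real r * 2 ^ r * \<bar>real_of_int (k - l)\<bar> * (w l + w (k - l))) * cmod (f l)"
        using \<kappa> w wt_commutator[of l N r k] by (intro mult_right_mono mult_left_mono) (auto simp: w_def)
      also have "\<dots> = ?a k * (\<kappa> * \<bar>real_of_int (k - l)\<bar> * cmod (v (k - l))) * (2 * real r * 2 ^ r * (w l + w (k - l)) * cmod (f l))"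
        by (simp add: mult_ac)
      also have "\<dots> \<le> ?a k * cmod (q (k - l)) * (2 * real r * 2 ^ r * (w l + w (k - l)) * cmod (f l))"
        using w vq[of "k - l"] by (intro mult_right_mono mult_left_mono) auto
      also have "\<dots> = 2 * real r * 2 ^ r * b k l" by (simp add: b_def mult_ac)
      finally show "cmod (R k l) \<le> 2 * real r * 2 ^ r * b k l" .
    qed
    also have "\<dots> = 2 * real r * 2 ^ r * (\<Sum>k\<in>symint K. \<Sum>l\<in>symint K. b k l)" by (simp only: sum_distrib_left)
    also have "\<dots> \<le> 2 * real r * 2 ^ r * (2 * A * X)" unfolding b_def w_def by (intro mult_left_mono weighted_convolution_le) auto
    finally show ?thesis .
  qed
  moreover have "\<bar>Re (\<Sum>k\<in>symint K. \<Sum>l\<in>symint J - symint K. t k l)\<bar> \<le> 2 * real N ^ (2 * r) * A * M / real K"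
  proof -
    \<comment> \<open>Uniformity in \<open>N\<close> is given up here: the weights cost at most
      \<open>N ^ (2 * r)\<close>, and both copies of \<open>f\<close> carry one derivative, so that
      Young's inequality gives \<open>A * M\<close>. The gain is \<open>1 / K\<close>, from
      \<open>\<bar>l\<bar> \<ge> K\<close>.\<close>
    define b where "b k l = ?c k * cmod (q (k - l)) * ?c l" for k l
    have "\<bar>Re (\<Sum>k\<in>symint K. \<Sum>l\<in>symint J - symint K. t k l)\<bar> \<le> cmod (\<Sum>k\<in>symint K. \<Sum>l\<in>symint J - symint K. t k l)"
      by (rule abs_Re_le_cmod)
    also have "\<dots> \<le> (\<Sum>k\<in>symint K. \<Sum>l\<in>symint J - symint K. 2 * real N ^ (2 * r) / real K * b k l)"
    proof (rule sum_norm_double_le)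
      fix k l assume kl: "k \<in> symint K" "l \<in> symint J - symint K"
      have Kl: "real K \<le> \<bar>real_of_int l\<bar>" using kl by auto
      show "cmod (t k l) \<le> 2 * real N ^ (2 * r) / real K * b k l"
      proof (cases "k = 0")
        case True
        then show ?thesis by (simp add: t_def b_def f_0)
      next
        case False
        then have k1: "1 \<le> \<bar>real_of_int k\<bar>" by (rule one_le_abs_of_int)
        have "k \<noteq> l" using kl by auto
        then have d1: "1 \<le> \<bar>real_of_int (k - l)\<bar>" by (intro one_le_abs_of_int) simp
        have "?v k l * 1 \<le> ?v k l * \<bar>real_of_int (k - l)\<bar>" using \<kappa> d1 by (intro mult_left_mono) auto
        then have v1: "?v k l \<le> cmod (q (k - l))" using vq[of "k - l"] by (simp add: mult_ac)
        \<comment> \<open>Both summands are absorbed by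
          \<open>cmod (q (k - l)) * \<bar>k\<bar>\<close>, since neither \<open>k\<close> nor
          \<open>k - l\<close> is zero; hence the factor \<open>2\<close>.\<close>
        have "\<bar>real_of_int l\<bar> \<le> \<bar>real_of_int (k - l)\<bar> + \<bar>real_of_int k\<bar>" by simp
        then have "?v k l * \<bar>real_of_int l\<bar> \<le> ?v k l * (\<bar>real_of_int (k - l)\<bar> + \<bar>real_of_int k\<bar>)"
          using \<kappa> by (intro mult_left_mono) auto
        also have "\<dots> = \<kappa> * \<bar>real_of_int (k - l)\<bar> * cmod (v (k - l)) + ?v k l * \<bar>real_of_int k\<bar>"
          by (simp add: algebra_simps)
        also have "\<dots> \<le> cmod (q (k - l)) * \<bar>real_of_int k\<bar> + cmod (q (k - l)) * \<bar>real_of_int k\<bar>"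
          using vq[of "k - l"] mult_left_mono[OF k1, of "cmod (q (k - l))"] v1 by (intro add_mono mult_right_mono) auto
        finally have vl: "?v k l * \<bar>real_of_int l\<bar> \<le> 2 * (cmod (q (k - l)) * \<bar>real_of_int k\<bar>)" by (simp add: mult_ac)
        have "real K * cmod (f l) \<le> \<bar>real_of_int l\<bar> * cmod (f l)" using Kl by (rule mult_right_mono) simp
        then have fl: "cmod (f l) \<le> \<bar>real_of_int l\<bar> * cmod (f l) / real K" using K(1) by (simp add: field_simps)
        have w2: "(w k)\<^sup>2 \<le> real N ^ (2 * r)"
          using power_mono[OF wt_le[of N r k], of 2] by (simp add: w_def mult.commute flip: power_mult)
        have "cmod (t k l) = (w k)\<^sup>2 * cmod (f k) * (?v k l * \<bar>real_of_int l\<bar>) * cmod (f l)"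
          using \<kappa> w by (simp add: t_def norm_mult norm_power mult_ac)
        also have "\<dots> \<le> real N ^ (2 * r) * cmod (f k) * (2 * (cmod (q (k - l)) * \<bar>real_of_int k\<bar>)) * (\<bar>real_of_int l\<bar> * cmod (f l) / real K)"
          using \<kappa> by (intro mult_mono[OF mult_mono[OF mult_right_mono[OF w2] vl] fl]) auto
        also have "\<dots> = 2 * real N ^ (2 * r) / real K * b k l" by (simp add: b_def)
        finally show ?thesis .
      qed
    qed
    also have "\<dots> = 2 * real N ^ (2 * r) / real K * (\<Sum>k\<in>symint K. \<Sum>l\<in>symint J - symint K. b k l)"
      by (simp only: sum_distrib_left)
    also have "\<dots> \<le> 2 * real N ^ (2 * r) / real K * (A * M)"
      unfolding b_def by (intro mult_left_mono Young_212[where x = ?c and y = "\<lambda>k. cmod (q k)" and z = ?c])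
        (use A M in auto)
    finally show ?thesis by simp
  qed
  moreover have "(pairing N r K f (advect \<kappa> v f J)) =
    (\<Sum>k\<in>symint K. \<Sum>l\<in>symint K. S k l) + (\<Sum>k\<in>symint K. \<Sum>l\<in>symint K. R k l) + (\<Sum>k\<in>symint K. \<Sum>l\<in>symint J - symint K. t k l)"
  proof -
    have "(\<Sum>l\<in>symint J. t k l) = (\<Sum>l\<in>symint K. t k l) + (\<Sum>l\<in>symint J - symint K. t k l)" for k
      using sum.subset_diff[of "symint K" "symint J" "t k"] K by (simp add: add.commute)
    then show ?thesis unfolding sum_distrib_left w_def[symmetric] t_def[symmetric] by (simp add: sum.distrib tSR)
  qed
  \<comment> \<open>The symmetrised part contributes \<open>1 / 2\<close>, rounded up to
    \<open>1\<close>.\<close>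
  moreover have "A * X / 2 + 2 * real r * 2 ^ r * (2 * A * X) \<le> (1 + 4 * real r * 2 ^ r) * A * X"
    using A_nonneg X_nonneg by (simp add: algebra_simps)
  ultimately show ?thesis by simp
qed

end

section \<open>Energy estimates for the Fourier coefficients\<close>

text \<open>The function \<open>exp (- C * s) * F s - e * s\<close> is nonincreasing. The crude
  linear term is harmless, because \<open>e\<close> will tend to zero with the cutoff error.\<close>

lemma Gronwall_within:
  fixes F :: "real \<Rightarrow> real"
  assumes F': "\<And>t. t \<in> {0..T} \<Longrightarrow> (F has_real_derivative F' t) (at t within {0..T})"
    and le: "\<And>t. t \<in> {0..T} \<Longrightarrow> F' t \<le> C * F t + e"
    and "C \<ge> 0" "e \<ge> 0" and t: "t \<in> {0..T}"
  shows "F t \<le> (F 0 + e * t) * exp (C * t)"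
proof -
  define G where "G s = exp (- C * s) * F s - e * s" for s
  define G' where "G' s = exp (- C * s) * (F' s - C * F s) - e" for s
  have G: "(G has_real_derivative G' s) (at s within {0..T})" if "s \<in> {0..T}" for s unfolding G_def[abs_def] G'_def using F'[OF that]
    by (auto intro!: derivative_eq_intros simp: algebra_simps)
  have G'_le: "G' s \<le> 0" if "s \<in> {0..T}" for s
  proof -
    have "exp (- C * s) * (F' s - C * F s) \<le> exp (- C * s) * e" using le[OF that] by (intro mult_left_mono) auto
    also have "\<dots> \<le> 1 * e" using that \<open>C \<ge> 0\<close> \<open>e \<ge> 0\<close> by (intro mult_right_mono) auto
    finally show ?thesis by (simp add: G'_def)
  qed
  have "G t \<le> G 0"
  proof (cases "t = 0")
    case False
    then have "0 < t" using t by simp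
    have "\<exists>s\<in>{0<..<t}. G t - G 0 = (\<lambda>h. G' s * h) (t - 0)"
    proof (rule mvt_simple[OF \<open>0 < t\<close>])
      fix s assume "0 \<le> s" "s \<le> t"
      then have "(G has_real_derivative G' s) (at s within {0..t})" using t by (intro DERIV_subset[OF G]) auto
      then show "(G has_derivative (\<lambda>h. G' s * h)) (at s within {0..t})" by (simp add: has_field_derivative_def)
    qed
    then obtain s where s: "s \<in> {0<..<t}" "G t - G 0 = G' s * t" by auto
    then have "G' s * t \<le> 0" using G'_le[of s] t by (intro mult_nonpos_nonneg) auto
    then show ?thesis using s by simp
  qed simp
  then have "exp (- C * t) * F t \<le> F 0 + e * t" by (simp add: G_def)
  then have "exp (C * t) * (exp (- C * t) * F t) \<le> exp (C * t) * (F 0 + e * t)" by (rule mult_left_mono) simp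
  moreover have "exp (C * t) * (exp (- C * t) * F t) = F t" by (simp flip: mult.assoc exp_add)
  ultimately show ?thesis by (simp only: mult.commute)
qed

lemma Lipschitz_within:
  fixes F :: "real \<Rightarrow> real"
  assumes F': "\<And>t. t \<in> {0..T} \<Longrightarrow> (F has_real_derivative F' t) (at t within {0..T})"
    and le: "\<And>t. t \<in> {0..T} \<Longrightarrow> \<bar>F' t\<bar> \<le> C"
    and t: "t \<in> {0..T}" "s \<in> {0..T}"
  shows "F t \<le> F s + C * \<bar>t - s\<bar>"
proof -
  have "norm (F t - F s) \<le> C * norm (t - s)" by (rule field_differentiable_bound[of "{0..T}" F F']) (use assms in auto)
  then show ?thesis by simp
qed

text \<open>\<open>p\<close> stands for the coefficients of u_z, \<open>q\<close> for those of omega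
  and \<open>v\<close> for those of the velocity. Differentiating the first equation once puts both
  unknowns at the same order; the product rule yields advection plus stretching. Of the Hilbert
  transform only the modulus bound \<open>v_le\<close> remains.\<close>

locale spectral_flow =
  fixes \<kappa> T M :: real and p q v dp dq :: "real \<Rightarrow> int \<Rightarrow> complex"
  assumes \<kappa>: "\<kappa> > 0"
    and p_0: "\<And>t. t \<in> {0..T} \<Longrightarrow> p t 0 = 0" and q_0: "\<And>t. t \<in> {0..T} \<Longrightarrow> q t 0 = 0"
    and v_cnj: "\<And>t j. t \<in> {0..T} \<Longrightarrow> v t (- j) = cnj (v t j)"
    and v_le: "\<And>t j. t \<in> {0..T} \<Longrightarrow> \<kappa> * \<bar>real_of_int j\<bar> * cmod (v t j) \<le> cmod (q t j)"
    and p_M: "\<And>t F. t \<in> {0..T} \<Longrightarrow> finite F \<Longrightarrow> (\<Sum>k\<in>F. (\<bar>real_of_int k\<bar> * cmod (p t k))\<^sup>2) \<le> M"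
    and q_M: "\<And>t F. t \<in> {0..T} \<Longrightarrow> finite F \<Longrightarrow> (\<Sum>k\<in>F. (\<bar>real_of_int k\<bar> * cmod (q t k))\<^sup>2) \<le> M"
    and p_deriv: "\<And>t k. t \<in> {0..T} \<Longrightarrow> ((\<lambda>s. p s k) has_vector_derivative dp t k) (at t within {0..T})"
    and q_deriv: "\<And>t k. t \<in> {0..T} \<Longrightarrow> ((\<lambda>s. q s k) has_vector_derivative dq t k) (at t within {0..T})"
    and p_eq: "\<And>t k. t \<in> {0..T} \<Longrightarrow> (\<lambda>J. advect \<kappa> (v t) (p t) J k
      + stretch \<kappa> (v t) (p t) J k) \<longlonglongrightarrow> - dp t k"
    and q_eq: "\<And>t k. t \<in> {0..T} \<Longrightarrow> (\<lambda>J. advect \<kappa> (v t) (q t) J k) \<longlonglongrightarrow> p t k - dq t k"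
begin

abbreviation intensity :: "real \<Rightarrow> int \<Rightarrow> real" where
  "intensity t k \<equiv> (cmod (p t k))\<^sup>2 + (cmod (q t k))\<^sup>2"

definition energy :: "nat \<Rightarrow> nat \<Rightarrow> int set \<Rightarrow> real \<Rightarrow> real" where
  "energy N r F t = (\<Sum>k\<in>F. (wt N r k)\<^sup>2 * intensity t k)"

definition energy' :: "nat \<Rightarrow> nat \<Rightarrow> nat \<Rightarrow> real \<Rightarrow> real" where
  "energy' N r K t = 2 * Re (pairing N r K (p t) (dp t))
     + 2 * Re (pairing N r K (q t) (dq t))"

text \<open>Read off in \<open>energy'_le\<close>: two transport terms, one stretching term and the
  coupling of \<open>p\<close> with \<open>q\<close>, doubled by differentiating squares, with
  \<open>M + 4\<close> bounding the absolute sums. It is free of \<open>N\<close> and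
  \<open>K\<close>.\<close>

definition rate :: "nat \<Rightarrow> real" where
  "rate r = 4 * (1 + 4 * real r * 2 ^ r) * (M + 4) + 4 * 2 ^ r * (M + 4) + 2"

lemma cmod_square_has_derivative:
  assumes "((\<lambda>s. f s) has_vector_derivative f') (at t within S)"
  shows "((\<lambda>s. (cmod (f s))\<^sup>2) has_real_derivative 2 * Re (cnj (f t) * f')) (at t within S)"
proof -
  have "((\<lambda>s. Re (f s)) has_real_derivative Re f') (at t within S)"
    "((\<lambda>s. Im (f s)) has_real_derivative Im f') (at t within S)" using bounded_linear.has_vector_derivative[OF bounded_linear_Re assms]
      bounded_linear.has_vector_derivative[OF bounded_linear_Im assms] by (simp_all only: has_real_derivative_iff_has_vector_derivative)
  from DERIV_add[OF DERIV_power[OF this(1), of 2] DERIV_power[OF this(2), of 2]]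
  show ?thesis unfolding cmod_power2 by (simp add: algebra_simps)
qed

lemma energy_has_derivative:
  assumes "t \<in> {0..T}"
  shows "(energy N r (symint K) has_real_derivative energy' N r K t) (at t within {0..T})"
proof -
  have "((\<lambda>s. \<Sum>k\<in>symint K. (wt N r k)\<^sup>2 * intensity s k) has_real_derivative
    (\<Sum>k\<in>symint K. (wt N r k)\<^sup>2 * (2 * Re (cnj (p t k) * dp t k) + 2 * Re (cnj (q t k) * dq t k)))) (at t within {0..T})"
    by (intro DERIV_sum DERIV_cmult DERIV_add cmod_square_has_derivative p_deriv q_deriv assms)
  moreover have "(\<Sum>k\<in>symint K. (wt N r k)\<^sup>2 * (2 * Re (cnj (p t k) * dp t k) + 2 * Re (cnj (q t k) * dq t k))) = energy' N r K t"
  proof -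
    have "Re (of_real ((wt N r k)\<^sup>2) * cnj a * b) = (wt N r k)\<^sup>2 * Re (cnj a * b)" for k a b
      by (simp only: mult.assoc Re_complex_of_real times_complex.sel Im_complex_of_real mult_zero_left diff_zero)
    then show ?thesis unfolding energy'_def Re_sum sum_distrib_left sum.distrib[symmetric]
      by (intro sum.cong refl) (simp only: of_real_power[symmetric] ring_distribs mult.left_commute)
  qed
  ultimately show ?thesis by (simp add: energy_def[abs_def])
qed

lemma M_nonneg: "t \<in> {0..T} \<Longrightarrow> M \<ge> 0" using p_M[of t "{}"] by simp

text \<open>\<open>X\<close> has to bound the energy on every finite set, because the convolutions
  reach beyond \<open>K\<close>. The estimates hold for each partial convolution with
  \<open>J \<ge> K\<close> and pass to the limit in \<open>J\<close>.\<close>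

lemma energy'_le:
  assumes t: "t \<in> {0..T}" and K: "K > 0" and X: "\<And>F. finite F \<Longrightarrow> energy N r F t \<le> X"
  shows "\<bar>energy' N r K t\<bar> \<le> rate r * X + 8 * real N ^ (2 * r) * (M + 4) * M / real K"
proof -
  define B where "B = (1 + 4 * real r * 2 ^ r) * (M + 4) * X + 2 * real N ^ (2 * r) * (M + 4) * M / real K"
  define D where "D = 2 * 2 ^ r * (M + 4) * X"
  have Xp: "(\<Sum>k\<in>F. (wt N r k * cmod (p t k))\<^sup>2) \<le> X" and Xq: "(\<Sum>k\<in>F. (wt N r k * cmod (q t k))\<^sup>2) \<le> X" if "finite F" for F
  proof -
    have "(\<Sum>k\<in>F. (wt N r k * cmod (p t k))\<^sup>2) \<le> energy N r F t"
      unfolding energy_def power_mult_distrib by (intro sum_mono mult_left_mono) auto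
    then show "(\<Sum>k\<in>F. (wt N r k * cmod (p t k))\<^sup>2) \<le> X" using X[OF that] by simp
    have "(\<Sum>k\<in>F. (wt N r k * cmod (q t k))\<^sup>2) \<le> energy N r F t"
      unfolding energy_def power_mult_distrib by (intro sum_mono mult_left_mono) auto
    then show "(\<Sum>k\<in>F. (wt N r k * cmod (q t k))\<^sup>2) \<le> X" using X[OF that] by simp
  qed
  have Ap: "(\<Sum>k\<in>F. cmod (p t k)) \<le> M + 4" and Aq: "(\<Sum>k\<in>F. cmod (q t k)) \<le> M + 4" if "finite F" for F
    using that sum_cmod_le[of "p t" F M] sum_cmod_le[of "q t" F M] p_0[OF t] q_0[OF t] p_M[OF t] q_M[OF t] by auto
  \<comment> \<open>The transported quantity is once \<open>p\<close> and once \<open>q\<close>; the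
    transporting field is governed by \<open>q\<close> both times.\<close>
  interpret P: energy_snapshot "p t" "q t" "M + 4" X M N r by unfold_locales (use Ap Aq Xp Xq p_M[OF t] p_0[OF t] in auto)
  interpret Q: energy_snapshot "q t" "q t" "M + 4" X M N r by unfold_locales (use Ap Aq Xp Xq q_M[OF t] q_0[OF t] in auto)
  have "\<bar>Re (pairing N r K (p t) (dp t))\<bar> \<le> B + D"
  proof -
    define Z where "Z J = pairing N r K (p t) (advect \<kappa> (v t) (p t) J)" for J
    define Y where "Y J = pairing N r K (p t) (stretch \<kappa> (v t) (p t) J)" for J
    have "(\<lambda>J. \<Sum>k\<in>symint K. (wt N r k)\<^sup>2 * cnj (p t k) * (advect \<kappa> (v t) (p t) J k
      + stretch \<kappa> (v t) (p t) J k)) \<longlonglongrightarrow> pairing N r K (p t) (\<lambda>k. - dp t k)"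
      by (intro tendsto_sum tendsto_mult tendsto_const p_eq t)
    then have "(\<lambda>J. Z J + Y J) \<longlonglongrightarrow> - pairing N r K (p t) (dp t)"
      by (simp add: Z_def Y_def ring_distribs sum.distrib sum_negf)
    then have lim: "(\<lambda>J. \<bar>Re (Z J + Y J)\<bar>) \<longlonglongrightarrow> \<bar>Re (- pairing N r K (p t) (dp t))\<bar>"
      by (intro tendsto_rabs tendsto_Re)
    have "\<bar>Re (Z J + Y J)\<bar> \<le> B + D" if "J \<ge> K" for J
    proof -
      have "\<bar>Re (Z J)\<bar> \<le> B" unfolding Z_def B_def by (rule P.transport_le[OF \<kappa> v_cnj[OF t] v_le[OF t] K that])
      moreover have "\<bar>Re (Y J)\<bar> \<le> D" unfolding Y_def D_def
      proof -
        have "cmod (\<i> * \<kappa> * j * v t j) \<le> cmod (q t j)" for j :: int using v_le[OF t, of j] \<kappa> by (simp add: norm_mult)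
        from P.stretching_le[of "\<lambda>j. \<i> * \<kappa> * j * v t j" J K, OF this]
        show "\<bar>Re (pairing N r K (p t) (stretch \<kappa> (v t) (p t) J))\<bar> \<le> 2 * 2 ^ r * (M + 4) * X" by (simp only: of_int_diff)
      qed
      ultimately show ?thesis by simp
    qed
    from LIMSEQ_le_const2[OF lim] this have "\<bar>Re (- pairing N r K (p t) (dp t))\<bar> \<le> B + D" by blast
    then show ?thesis by (simp only: uminus_complex.sel abs_minus_cancel)
  qed
  moreover have "\<bar>Re (pairing N r K (q t) (dq t))\<bar> \<le> B + X"
  proof -
    define Z where "Z J = pairing N r K (q t) (advect \<kappa> (v t) (q t) J)" for J
    define Y where "Y = pairing N r K (q t) (p t)"
    have "Z \<longlonglongrightarrow> pairing N r K (q t) (\<lambda>k. p t k - dq t k)"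
      unfolding Z_def by (intro tendsto_sum tendsto_mult tendsto_const q_eq t)
    then have "Z \<longlonglongrightarrow> Y - pairing N r K (q t) (dq t)" by (simp add: Y_def ring_distribs sum_subtractf)
    then have lim: "(\<lambda>J. \<bar>Re (Z J)\<bar>) \<longlonglongrightarrow> \<bar>Re (Y - pairing N r K (q t) (dq t))\<bar>"
      by (intro tendsto_rabs tendsto_Re)
    have "\<bar>Re (Z J)\<bar> \<le> B" if "J \<ge> K" for J
      unfolding Z_def B_def by (rule Q.transport_le[OF \<kappa> v_cnj[OF t] v_le[OF t] K that])
    from LIMSEQ_le_const2[OF lim] this
    have "\<bar>Re (Y - pairing N r K (q t) (dq t))\<bar> \<le> B" by blast
    moreover have "\<bar>Re Y\<bar> \<le> X"
    proof -
      have "cmod Y \<le> (\<Sum>k\<in>symint K. (wt N r k)\<^sup>2 * intensity t k)" unfolding Y_def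
      proof (rule sum_norm_le)
        fix k
        have "cmod (q t k) * cmod (p t k) \<le> intensity t k"
          using sum_squares_bound[of "cmod (q t k)" "cmod (p t k)"] mult_nonneg_nonneg[OF norm_ge_zero norm_ge_zero, of "q t k" "p t k"]
          by linarith
        then show "cmod ((wt N r k)\<^sup>2 * cnj (q t k) * p t k) \<le> (wt N r k)\<^sup>2 * intensity t k"
          by (simp add: norm_mult norm_power mult.assoc mult_left_mono)
      qed
      also have "\<dots> \<le> X" using X[of "symint K"] by (simp add: energy_def)
      finally show ?thesis using abs_Re_le_cmod order_trans by blast
    qed
    ultimately show ?thesis by simp
  qed
  ultimately have "\<bar>energy' N r K t\<bar> \<le> 2 * (B + D) + 2 * (B + X)" unfolding energy'_def
    by (intro order.trans[OF abs_triangle_ineq] add_mono) (simp_all add: abs_mult)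
  also have "\<dots> = rate r * X + 8 * real N ^ (2 * r) * (M + 4) * M / real K" by (simp add: B_def D_def rate_def algebra_simps)
  finally show ?thesis .
qed

text \<open>For fixed \<open>N\<close> the weight is bounded, and the H^1 bound makes the
  frequencies beyond \<open>K\<close> contribute O(1/K). This replaces \<open>X\<close> in
  \<open>energy'_le\<close> by the truncated energy and closes the differential inequality.\<close>

lemma energy_tail:
  assumes t: "t \<in> {0..T}" and K: "K > 0" and F: "finite F"
  shows "energy N r F t \<le> energy N r (symint K) t + 2 * real N ^ (2 * r) * M / real K"
proof -
  have "energy N r F t \<le> energy N r (symint K \<union> F) t" unfolding energy_def by (intro sum_mono2) (use F in auto)
  also have "\<dots> = energy N r (symint K) t + energy N r (F - symint K) t"
    unfolding energy_def using F by (subst sum.union_disjoint[symmetric]) (auto intro!: sum.cong)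
  also have "energy N r (F - symint K) t \<le> (\<Sum>k\<in>F - symint K. real N ^ (2 * r) / real K * ((\<bar>real_of_int k\<bar> * cmod (p t k))\<^sup>2 + (\<bar>real_of_int k\<bar> * cmod (q t k))\<^sup>2))"
    unfolding energy_def
  proof (rule sum_mono)
    fix k assume "k \<in> F - symint K"
    then have k: "real K \<le> \<bar>real_of_int k\<bar>" by auto
    have w2: "(wt N r k)\<^sup>2 \<le> real N ^ (2 * r)" using power_mono[OF wt_le[of N r k], of 2] by (simp add: mult.commute flip: power_mult)
    have "real K * 1 \<le> \<bar>real_of_int k\<bar> * \<bar>real_of_int k\<bar>" using k K by (intro mult_mono) auto
    then have "1 \<le> \<bar>real_of_int k\<bar>\<^sup>2 / real K" using K by (simp add: field_simps power2_eq_square)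
    from mult_mono[OF w2 this]
    have "(wt N r k)\<^sup>2 \<le> real N ^ (2 * r) / real K * \<bar>real_of_int k\<bar>\<^sup>2" by simp
    then have "(wt N r k)\<^sup>2 * intensity t k \<le> (real N ^ (2 * r) / real K * \<bar>real_of_int k\<bar>\<^sup>2) * intensity t k"
      by (rule mult_right_mono) simp
    then show "(wt N r k)\<^sup>2 * intensity t k \<le> real N ^ (2 * r) / real K * ((\<bar>real_of_int k\<bar> * cmod (p t k))\<^sup>2 + (\<bar>real_of_int k\<bar> * cmod (q t k))\<^sup>2)"
      by (simp only: power_mult_distrib ring_distribs mult.assoc)
  qed
  also have "\<dots> \<le> real N ^ (2 * r) / real K * (M + M)" unfolding sum_distrib_left[symmetric] sum.distrib using p_M[OF t] q_M[OF t] F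
    by (intro mult_left_mono add_mono) auto
  finally show ?thesis by (simp add: mult_ac)
qed

section \<open>Bounds and continuity for the unsaturated energy\<close>

abbreviation intensity_diff :: "real \<Rightarrow> real \<Rightarrow> int \<Rightarrow> real" where
  "intensity_diff s t k \<equiv> (cmod (p s k - p t k))\<^sup>2 + (cmod (q s k - q t k))\<^sup>2"

definition sob :: "nat \<Rightarrow> int set \<Rightarrow> real \<Rightarrow> real" where
  "sob r F t = (\<Sum>k\<in>F. (\<bar>real_of_int k\<bar> ^ r)\<^sup>2 * intensity t k)"

lemma energy_le_sob: "energy N r F t \<le> sob r F t"
  unfolding energy_def sob_def by (intro sum_mono mult_right_mono power_mono wt_le_power) auto

lemma energy_eq_sob:
  assumes "F \<subseteq> symint N" shows "energy N r F t = sob r F t"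
  unfolding energy_def sob_def
proof (rule sum.cong)
  fix k assume "k \<in> F"
  then have "\<bar>k\<bar> \<le> int N" using assms by (auto simp: abs_le_iff)
  then have "\<bar>real_of_int k\<bar> \<le> real N" by (metis of_int_abs of_int_le_iff of_int_of_nat_eq)
  then show "(wt N r k)\<^sup>2 * intensity t k = (\<bar>real_of_int k\<bar> ^ r)\<^sup>2 * intensity t k" by (simp add: wt_def)
qed simp

lemma rate_nonneg: "t \<in> {0..T} \<Longrightarrow> rate r \<ge> 0" unfolding rate_def using M_nonneg by simp

lemma tendsto_const_over_nat: "(\<lambda>K. a + b / real K) \<longlonglongrightarrow> (a :: real)"
  using tendsto_add[OF tendsto_const lim_const_over_n] by simp

text \<open>\<open>N\<close> is chosen beyond \<open>F\<close>, so saturation is invisible there;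
  Gronwall runs on the range cut off at \<open>K\<close>, and \<open>K\<close> tends to infinity
  with \<open>N\<close> fixed. The exponential rate depends on neither.\<close>

lemma sob_bound:
  assumes B0: "\<And>F. finite F \<Longrightarrow> sob r F 0 \<le> B0" and t: "t \<in> {0..T}" and F: "finite F"
  shows "sob r F t \<le> B0 * exp (rate r * T)"
proof -
  obtain N where N: "F \<subseteq> symint N" using finite_subset_symint[OF F] by metis
  \<comment> \<open>Collects the two errors of order \<open>1 / K\<close>: the energy beyond the
    cutoff, multiplied by the rate, and the transport tail.\<close>
  define c where "c = rate r * (2 * real N ^ (2 * r) * M) + 8 * real N ^ (2 * r) * (M + 4) * M"
  have M: "M \<ge> 0" and rate: "rate r \<ge> 0" using M_nonneg[OF t] rate_nonneg[OF t] .
  have c: "c \<ge> 0" using M rate by (simp add: c_def)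
  have "sob r F t \<le> (B0 + (c * t) / real K) * exp (rate r * t)" if K: "K \<ge> Suc N" for K
  proof -
    have "K > 0" using K by simp
    have "sob r F t = energy N r F t" using energy_eq_sob[OF N] by simp
    also have "\<dots> \<le> energy N r (symint K) t" unfolding energy_def using N K by (intro sum_mono2) auto
    also have "\<dots> \<le> (energy N r (symint K) 0 + c / real K * t) * exp (rate r * t)"
    proof (rule Gronwall_within[OF energy_has_derivative _ rate _ t])
      fix s assume s: "s \<in> {0..T}"
      have "energy' N r K s \<le> \<bar>energy' N r K s\<bar>" by simp
      also have "\<dots> \<le> rate r * (energy N r (symint K) s + 2 * real N ^ (2 * r) * M / real K) + 8 * real N ^ (2 * r) * (M + 4) * M / real K"
        by (rule energy'_le[OF s \<open>K > 0\<close> energy_tail[OF s \<open>K > 0\<close>]])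
      also have "\<dots> = rate r * energy N r (symint K) s + c / real K" by (simp add: c_def ring_distribs add_divide_distrib)
      finally show "energy' N r K s \<le> rate r * energy N r (symint K) s + c / real K" .
    qed (use c in auto)
    also have "\<dots> \<le> (B0 + c / real K * t) * exp (rate r * t)"
      using order.trans[OF energy_le_sob B0[of "symint K"]] by (intro mult_right_mono add_right_mono) auto
    finally show ?thesis by simp
  qed
  moreover have "(\<lambda>K. (B0 + (c * t) / real K) * exp (rate r * t)) \<longlonglongrightarrow> B0 * exp (rate r * t)"
    by (intro tendsto_mult tendsto_const tendsto_const_over_nat)
  ultimately have "sob r F t \<le> B0 * exp (rate r * t)" by (intro LIMSEQ_le_const) blast+
  also have "\<dots> \<le> B0 * exp (rate r * T)" using B0[of "{}"] rate t by (intro mult_left_mono) (auto simp: sob_def mult_left_mono)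
  finally show ?thesis .
qed

text \<open>On every cutoff range the time derivative is at most \<open>rate r * B\<close> up to
  O(1/K). Since \<open>X\<close> may be any bound at time \<open>s\<close>, this compares the total
  energies at two times.\<close>

lemma sob_Lipschitz:
  assumes B: "\<And>t F. t \<in> {0..T} \<Longrightarrow> finite F \<Longrightarrow> sob r F t \<le> B"
    and X: "\<And>F. finite F \<Longrightarrow> sob r F s \<le> X"
    and t: "t \<in> {0..T}" and s: "s \<in> {0..T}" and F: "finite F"
  shows "sob r F t \<le> X + rate r * B * \<bar>t - s\<bar>"
proof -
  obtain N where N: "F \<subseteq> symint N" using finite_subset_symint[OF F] by metis
  define c where "c = 8 * real N ^ (2 * r) * (M + 4) * M"
  have "sob r F t \<le> (X + rate r * B * \<bar>t - s\<bar>) + c * \<bar>t - s\<bar> / real K" if K: "K \<ge> Suc N" for K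
  proof -
    have "K > 0" using K by simp
    have "sob r F t = energy N r F t" using energy_eq_sob[OF N] by simp
    also have "\<dots> \<le> energy N r (symint K) t" unfolding energy_def using N K by (intro sum_mono2) auto
    also have "\<dots> \<le> energy N r (symint K) s + (rate r * B + c / real K) * \<bar>t - s\<bar>"
    proof (rule Lipschitz_within[OF energy_has_derivative _ t s])
      fix s assume s: "s \<in> {0..T}"
      show "\<bar>energy' N r K s\<bar> \<le> rate r * B + c / real K"
        unfolding c_def by (rule energy'_le[OF s \<open>K > 0\<close> order.trans[OF energy_le_sob B[OF s]]])
    qed
    also have "energy N r (symint K) s \<le> X" using order.trans[OF energy_le_sob X[of "symint K"]] by simp
    finally show ?thesis by (simp add: ring_distribs)
  qed
  moreover have "(\<lambda>K. (X + rate r * B * \<bar>t - s\<bar>) + c * \<bar>t - s\<bar> / real K) \<longlonglongrightarrow> X + rate r * B * \<bar>t - s\<bar>"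
    by (rule tendsto_const_over_nat)
  ultimately show ?thesis by (intro LIMSEQ_le_const) blast+
qed

text \<open>The total energy depends continuously on time, as do the individual coefficients; hence no
  energy can escape to high frequencies, and weak continuity improves to strong continuity.\<close>

lemma sob_difference_small:
  assumes B: "\<And>t F. t \<in> {0..T} \<Longrightarrow> finite F \<Longrightarrow> sob r F t \<le> B"
    and t: "t \<in> {0..T}" and e: "e > 0"
  shows "\<forall>\<^sub>F s in at t within {0..T}. \<forall>F. finite F \<longrightarrow>
    (\<Sum>k\<in>F. (\<bar>real_of_int k\<bar> ^ r)\<^sup>2 * intensity_diff s t k) \<le> 9 * e"
proof -
  define d where "d s F = (\<Sum>k\<in>F. (\<bar>real_of_int k\<bar> ^ r)\<^sup>2 * intensity_diff s t k)" for s F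
  \<comment> \<open>The total energy at time \<open>t\<close>; the finite set \<open>F0\<close>
    below carries all of it except \<open>e\<close>.\<close>
  define S where "S = (SUP F\<in>{F. finite F}. sob r F t)"
  have bdd: "bdd_above ((\<lambda>F. sob r F t) ` {F. finite F})" using B[OF t] by (auto simp: bdd_above_def)
  have S: "sob r F t \<le> S" if "finite F" for F unfolding S_def using that bdd by (intro cSUP_upper) auto
  have "S - e < S" using e by simp
  have ne: "{F :: int set. finite F} \<noteq> {}" by auto
  obtain F0 where F0: "finite F0" "S - e < sob r F0 t"
    using \<open>S - e < S\<close> less_cSUP_iff[OF ne bdd, of "S - e"] unfolding S_def by auto
  have cp: "((\<lambda>s. p s k) \<longlongrightarrow> p t k) (at t within {0..T})" and cq: "((\<lambda>s. q s k) \<longlongrightarrow> q t k) (at t within {0..T})" for k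
    using has_vector_derivative_continuous[OF p_deriv[OF t]] has_vector_derivative_continuous[OF q_deriv[OF t]] by (auto simp: continuous_within)
  have "((\<lambda>s. sob r F0 s) \<longlongrightarrow> sob r F0 t) (at t within {0..T})" unfolding sob_def by (intro tendsto_intros cp cq)
  then have ev1: "\<forall>\<^sub>F s in at t within {0..T}. S - 2 * e < sob r F0 s" by (rule order_tendstoD(1)) (use F0 e in auto)
  have "((\<lambda>s. rate r * B * \<bar>s - t\<bar>) \<longlongrightarrow> rate r * B * \<bar>t - t\<bar>) (at t within {0..T})"
    by (intro tendsto_intros)
  then have ev2: "\<forall>\<^sub>F s in at t within {0..T}. rate r * B * \<bar>s - t\<bar> < e" by (rule order_tendstoD(2)) (use e in simp)
  have "((\<lambda>s. d s F0) \<longlongrightarrow> (\<Sum>k\<in>F0. (\<bar>real_of_int k\<bar> ^ r)\<^sup>2 * ((cmod (p t k - p t k))\<^sup>2 + (cmod (q t k - q t k))\<^sup>2))) (at t within {0..T})"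
    unfolding d_def by (intro tendsto_intros cp cq)
  then have ev3: "\<forall>\<^sub>F s in at t within {0..T}. d s F0 < e" by (rule order_tendstoD(2)) (use e in simp)
  have ev4: "\<forall>\<^sub>F s in at t within {0..T}. s \<in> {0..T}" by (simp add: eventually_at_filter)
  have split: "sob r (F - F0) s = sob r (F \<union> F0) s - sob r F0 s" if "finite F" for s F
    unfolding sob_def using that F0(1) by (subst sum_diff[symmetric]) (auto intro!: sum.cong)
  have "\<forall>\<^sub>F s in at t within {0..T}. \<forall>F. finite F \<longrightarrow> d s F \<le> 9 * e" using ev1 ev2 ev3 ev4
  proof eventually_elim
    case (elim s)
    show ?case
    proof (intro allI impI)
      fix F :: "int set" assume F: "finite F"
      have "sob r (F \<union> F0) s \<le> S + rate r * B * \<bar>s - t\<bar>" using F F0 by (intro sob_Lipschitz[OF B S elim(4) t]) auto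
      \<comment> \<open>At time \<open>s\<close> the total is at most \<open>S + e\<close>, while
        \<open>F0\<close> already carries more than \<open>S - 2 * e\<close>.\<close>
      then have s1: "sob r (F - F0) s \<le> 3 * e" using split[OF F] elim by simp
      have t1: "sob r (F - F0) t \<le> e" using split[OF F] S[of "F \<union> F0"] F F0 by simp
      have "d s F \<le> d s (F0 \<union> (F - F0))" unfolding d_def using F F0 by (intro sum_mono2) auto
      also have "\<dots> = d s F0 + d s (F - F0)" unfolding d_def using F F0 by (intro sum.union_disjoint) auto
      also have "d s (F - F0) \<le> 2 * sob r (F - F0) s + 2 * sob r (F - F0) t" unfolding d_def sob_def sum_distrib_left sum.distrib[symmetric]
      proof (rule sum_mono)
        fix k
        have sq: "(cmod (a - b))\<^sup>2 \<le> 2 * (cmod a)\<^sup>2 + 2 * (cmod b)\<^sup>2" for a b :: complex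
          using cmod_add_square_le[of a "- b"] by simp
        have "(cmod (p s k - p t k))\<^sup>2 + (cmod (q s k - q t k))\<^sup>2 \<le> 2 * intensity s k + 2 * intensity t k"
          using sq[of "p s k" "p t k"] sq[of "q s k" "q t k"] by simp
        from mult_left_mono[OF this, of "(\<bar>real_of_int k\<bar> ^ r)\<^sup>2"]
        show "(\<bar>real_of_int k\<bar> ^ r)\<^sup>2 * intensity_diff s t k \<le>
          2 * ((\<bar>real_of_int k\<bar> ^ r)\<^sup>2 * intensity s k) + 2 * ((\<bar>real_of_int k\<bar> ^ r)\<^sup>2 * intensity t k)"
          by (simp add: ring_distribs mult_ac)
      qed
      \<comment> \<open>\<open>9 * e\<close> is \<open>e\<close> on \<open>F0\<close>, plus twice
        \<open>3 * e\<close> and twice \<open>e\<close> outside it.\<close>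
      finally show "d s F \<le> 9 * e" using elim s1 t1 by simp
    qed
  qed
  then show ?thesis by (simp add: d_def)
qed

end

section \<open>The periodic Hilbert transform\<close>

text \<open>Primitives of \<open>cis (- 2 * l * x) * cot x\<close> off the zeros of the sine: the integrands for \<open>l\<close> and
  \<open>l + 1\<close> differ by the trigonometric polynomial \<open>- \<i> * (cis (- 2 * l * x) + cis (- 2 * (l + 1) * x))\<close>.\<close>

definition cot_step :: "nat \<Rightarrow> real \<Rightarrow> complex" where
  "cot_step j x = (if j = 0 then - \<i> * of_real x else cis (- 2 * real j * x) / (2 * of_nat j))"

definition cot_prim :: "nat \<Rightarrow> real \<Rightarrow> complex" where
  "cot_prim l x = of_real (ln ((sin x)\<^sup>2) / 2) + (\<Sum>j<l. cot_step j x + cot_step (Suc j) x)"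

lemma cis_has_vector_derivative:
  "((\<lambda>x. cis (a * x)) has_vector_derivative (\<i> * of_real a * cis (a * x))) (at x within S)"
proof -
  have eq: "cis (a * x) = exp ((\<i> * of_real a) * of_real x)" for x by (simp add: cis_conv_exp mult_ac)
  show ?thesis unfolding eq by (rule has_vector_derivative_real_field) (auto intro!: derivative_eq_intros)
qed

lemma cot_step_has_vector_derivative:
  "(cot_step j has_vector_derivative (- \<i> * cis (- 2 * real j * x))) (at x within S)"
proof (cases "j = 0")
  case True
  have "((\<lambda>x. - \<i> * of_real x) has_vector_derivative (- \<i> * of_real 1)) (at x within S)"
    by (intro has_vector_derivative_mult_right has_vector_derivative_of_real DERIV_ident)
  then show ?thesis using True by (simp add: cot_step_def[abs_def])
next
  case False
  have "((\<lambda>x. (1 / (2 * of_nat j)) * cis (- 2 * real j * x)) has_vector_derivative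
     (1 / (2 * of_nat j)) * (\<i> * of_real (- 2 * real j) * cis (- 2 * real j * x))) (at x within S)"
    by (intro has_vector_derivative_mult_right cis_has_vector_derivative)
  then show ?thesis using False by (simp add: cot_step_def[abs_def])
qed

lemma cot_prim_has_vector_derivative:
  assumes "sin x \<noteq> 0"
  shows "(cot_prim l has_vector_derivative (cis (- 2 * real l * x) * of_real (cot x))) (at x within S)"
proof -
  \<comment> \<open>The square lets one formula serve on both sides of the singularity.\<close>
  have "((\<lambda>x. ln ((sin x)\<^sup>2) / 2) has_real_derivative cot x) (at x within S)"
    using assms by (auto intro!: derivative_eq_intros simp: cot_def field_simps power2_eq_square zero_less_mult_iff)
  then have "(cot_prim l has_vector_derivative (of_real (cot x) + (\<Sum>j<l. - \<i> * cis (- 2 * real j * x) + - \<i> * cis (- 2 * real (Suc j) * x)))) (at x within S)"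
    unfolding cot_prim_def[abs_def]
    by (intro has_vector_derivative_add has_vector_derivative_of_real has_vector_derivative_sum cot_step_has_vector_derivative)
  moreover have "of_real (cot x) + (\<Sum>j<l. - \<i> * cis (- 2 * real j * x) + - \<i> * cis (- 2 * real (Suc j) * x)) = cis (- 2 * real l * x) * of_real (cot x)"
  proof (induction l)
    case (Suc l)
    define a where "a = - 2 * real l * x"
    have s: "- 2 * real (Suc l) * x = a + (- 2 * x)" by (simp add: a_def algebra_simps)
    have c: "cis (- 2 * x) = of_real (cos x * cos x - sin x * sin x) - \<i> * of_real (2 * sin x * cos x)"
      using cos_double[of x] sin_double[of x] by (simp add: cis.ctr complex_eq_iff power2_eq_square)
    have "sin x * cot x = cos x" using assms by (simp add: cot_def)
    then have sc: "of_real (sin x) * of_real (cot x) = complex_of_real (cos x)" by (metis of_real_mult)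
    have one: "complex_of_real (cos x) * of_real (cos x) + of_real (sin x) * of_real (sin x) = 1"
      using sin_cos_squared_add3[of x] by (metis of_real_mult of_real_add of_real_1)
    \<comment> \<open>\<open>cis (- 2 * x) - 1\<close> has the factor \<open>sin x\<close>, which
      cancels the pole of the cotangent.\<close>
    have "(cis (- 2 * x) - 1) * of_real (cot x) = - \<i> * (1 + cis (- 2 * x))"
    proof -
      have "cis (- 2 * x) - 1 = - 2 * of_real (sin x) * (of_real (sin x) + \<i> * of_real (cos x))"
        unfolding c using one by (simp add: algebra_simps)
      then have "(cis (- 2 * x) - 1) * of_real (cot x) = - 2 * (of_real (sin x) * of_real (cot x)) * (of_real (sin x) + \<i> * of_real (cos x))"
        by (simp add: mult_ac)
      also have "\<dots> = - 2 * of_real (cos x) * (of_real (sin x) + \<i> * of_real (cos x))" by (simp only: sc)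
      also have "\<dots> = - \<i> * (1 + cis (- 2 * x))" unfolding c one[symmetric] by (simp add: algebra_simps)
      finally show ?thesis .
    qed
    then have "cis a * ((cis (- 2 * x) - 1) * of_real (cot x)) = cis a * (- \<i> * (1 + cis (- 2 * x)))" by simp
    then show ?case using Suc unfolding sum.lessThan_Suc s a_def[symmetric] cis_mult[symmetric] by (simp add: algebra_simps)
  qed simp
  ultimately show ?thesis by simp
qed

text \<open>Everything is \<open>pi\<close>-periodic except the linear term
  \<open>cot_step 0\<close>, which occurs exactly once for \<open>l \<ge> 1\<close>. Its jump
  \<open>- \<i> * pi\<close> is the origin of the multiplier \<open>- \<i> * sgn k\<close>.\<close>

lemma cot_prim_diff_pi: "cot_prim l x - cot_prim l (x - pi) = (if l = 0 then 0 else - \<i> * of_real pi)"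
proof -
  have c: "cis (- 2 * real j * (x - pi)) = cis (- 2 * real j * x)" for j
  proof -
    have "cis (- 2 * real j * (x - pi)) = cis (- 2 * real j * x) * cis (2 * pi * of_int (int j))" unfolding cis_mult by (simp add: algebra_simps)
    then show ?thesis by (simp add: cis_multiple_2pi)
  qed
  have st: "cot_step j x - cot_step j (x - pi) = (if j = 0 then - \<i> * of_real pi else 0)" for j
    using c[of j] by (simp add: cot_step_def algebra_simps)
  have "cot_prim l x - cot_prim l (x - pi) = (\<Sum>j<l. (cot_step j x - cot_step j (x - pi)) + (cot_step (Suc j) x - cot_step (Suc j) (x - pi)))"
    by (simp add: cot_prim_def sum_subtractf[symmetric] algebra_simps)
  also have "\<dots> = (\<Sum>j<l. if j = 0 then - \<i> * of_real pi else 0)" by (simp add: st)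
  finally show ?thesis by simp
qed

text \<open>What the two edges of the removed neighbourhood contribute. The logarithm is even and
  drops out, so the rest is continuous and vanishes with the cutoff.\<close>

definition cot_odd :: "nat \<Rightarrow> real \<Rightarrow> complex" where
  "cot_odd l x = (\<Sum>j<l. (cot_step j (- x) - cot_step j x) + (cot_step (Suc j) (- x) - cot_step (Suc j) x))"

lemma cot_prim_odd: "cot_prim l (- x) - cot_prim l x = cot_odd l x"
  by (simp add: cot_prim_def cot_odd_def sum_subtractf[symmetric] algebra_simps)

lemma cot_odd_tendsto: "(cot_odd l \<longlongrightarrow> 0) (at_right 0)"
proof -
  have c: "(cot_step j \<longlongrightarrow> cot_step j 0) (at 0)" for j
    using has_vector_derivative_continuous[OF cot_step_has_vector_derivative[of j 0 UNIV]] by (simp add: continuous_within)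
  have "((\<lambda>x. cot_step j (- x)) \<longlongrightarrow> cot_step j 0) (at_right 0)"
     "((\<lambda>x. cot_step j x) \<longlongrightarrow> cot_step j 0) (at_right 0)" for j
  proof -
    have "filterlim (\<lambda>x :: real. - x) (at 0) (at_right 0)" by real_asymp
    from filterlim_compose[OF c this] show "((\<lambda>x. cot_step j (- x)) \<longlongrightarrow> cot_step j 0) (at_right 0)" .
    show "((\<lambda>x. cot_step j x) \<longlongrightarrow> cot_step j 0) (at_right 0)" using c by (rule tendsto_mono[rotated]) (simp add: at_le)
  qed
  then have "(cot_odd l \<longlongrightarrow> (\<Sum>j<l. (cot_step j 0 - cot_step j 0) + (cot_step (Suc j) 0 - cot_step (Suc j) 0))) (at_right 0)"
    unfolding cot_odd_def[abs_def] by (intro tendsto_intros)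
  then show ?thesis by simp
qed

text \<open>The linear term gives at most \<open>8\<close>, each oscillating term at most
  \<open>1 / j\<close>, hence two harmonic sums. The bound is uniform in \<open>x\<close>, as the
  majorant in \<open>hilbert_series\<close> requires.\<close>

lemma norm_cot_odd_le:
  assumes "0 \<le> x" "x \<le> 4"
  shows "cmod (cot_odd l x) \<le> 8 + 2 * harm l"
proof -
  have st: "cmod (cot_step j (- x) - cot_step j x) \<le> (if j = 0 then 8 else inverse (of_nat j))" for j
  proof (cases "j = 0")
    case True
    have "cot_step 0 (- x) - cot_step 0 x = \<i> * of_real (2 * x)" by (simp add: cot_step_def)
    then show ?thesis using True assms by (simp add: norm_mult)
  next
    case False
    have "cmod (cot_step j (- x) - cot_step j x) \<le> cmod (cot_step j (- x)) + cmod (cot_step j x)" by (rule norm_triangle_ineq4)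
    also have "\<dots> = inverse (of_nat j)" using False by (simp add: cot_step_def norm_divide norm_mult field_simps)
    finally show ?thesis using False by simp
  qed
  have "cmod (cot_odd l x) \<le> (\<Sum>j<l. (if j = 0 then 8 else inverse (of_nat j)) + inverse (of_nat (Suc j)))" unfolding cot_odd_def
  proof (rule sum_norm_le)
    fix j
    show "cmod ((cot_step j (- x) - cot_step j x) + (cot_step (Suc j) (- x) - cot_step (Suc j) x)) \<le> (if j = 0 then 8 else inverse (of_nat j)) + inverse (of_nat (Suc j))"
      using st[of j] st[of "Suc j"] by (intro order.trans[OF norm_triangle_ineq] add_mono) (simp_all only: nat.simps if_False)
  qed
  also have "\<dots> = (\<Sum>j<l. if j = 0 then 8 else inverse (of_nat j)) + harm l" by (simp add: sum.distrib harm_altdef)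
  also have "(\<Sum>j<l. if j = 0 then 8 else inverse (of_nat j)) \<le> (8 + harm l :: real)"
  proof (cases l)
    case (Suc m)
    have "(\<Sum>j<Suc m. if j = 0 then 8 else inverse (of_nat j) :: real) = 8 + harm m"
      by (simp add: sum.lessThan_Suc_shift harm_altdef del: sum.lessThan_Suc of_nat_Suc)
    then show ?thesis using harm_mono[of m l, where 'a=real] Suc by simp
  qed (simp add: harm_nonneg)
  finally show ?thesis by simp
qed

text \<open>Harmonic numbers grow like the logarithm, so their squares divided by
  \<open>i\<^sup>2\<close> remain summable.\<close>

lemma summable_harm_square: "summable (\<lambda>i. ((a + b * harm (Suc i)) / real (Suc i))\<^sup>2)"
proof (rule summable_comparison_test)
  define c where "c = \<bar>a\<bar> + \<bar>b\<bar>"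
  show "\<exists>N. \<forall>i\<ge>N. norm (((a + b * harm (Suc i)) / real (Suc i))\<^sup>2) \<le> c\<^sup>2 * ((1 + ln (real (Suc i))) / real (Suc i))\<^sup>2"
  proof (intro exI allI impI)
    fix i :: nat
    have "harm (Suc i) - ln (real (Suc i)) \<le> harm (Suc 0) - ln (real (Suc 0))" using decseqD[OF decseq_harm_diff_ln, of 0 i] by simp
    then have h: "harm (Suc i) \<le> 1 + ln (real (Suc i))" by (simp add: harm_expand)
    have "\<bar>a + b * harm (Suc i)\<bar> \<le> \<bar>a\<bar> + \<bar>b\<bar> * harm (Suc i)"
      by (rule order.trans[OF abs_triangle_ineq]) (simp add: abs_mult harm_nonneg)
    also have "\<dots> \<le> \<bar>a\<bar> * (1 + ln (real (Suc i))) + \<bar>b\<bar> * (1 + ln (real (Suc i)))"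
      using h mult_left_mono[of 1 "1 + ln (real (Suc i))" "\<bar>a\<bar>"] by (intro add_mono mult_left_mono) auto
    also have "\<dots> = c * (1 + ln (real (Suc i)))" by (simp add: c_def ring_distribs)
    finally have "\<bar>(a + b * harm (Suc i)) / real (Suc i)\<bar> \<le> c * (1 + ln (real (Suc i))) / real (Suc i)"
      by (simp add: abs_divide divide_right_mono)
    from power_mono[OF this abs_ge_zero, of 2]
    show "norm (((a + b * harm (Suc i)) / real (Suc i))\<^sup>2) \<le> c\<^sup>2 * ((1 + ln (real (Suc i))) / real (Suc i))\<^sup>2"
      by (simp add: power_mult_distrib power_divide)
  qed
  \<comment> \<open>Any exponent strictly between \<open>- 2\<close> and \<open>- 1\<close> absorbs
    the logarithms.\<close>
  have "(\<lambda>i. ((1 + ln (real (Suc i))) / real (Suc i))\<^sup>2) \<in> O(\<lambda>i. real i powr (- 3 / 2))" by real_asymp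
  then have "summable (\<lambda>i. ((1 + ln (real (Suc i))) / real (Suc i))\<^sup>2)"
    by (rule summable_comparison_test_bigo[rotated]) (simp add: summable_real_powr_iff)
  then show "summable (\<lambda>i. c\<^sup>2 * ((1 + ln (real (Suc i))) / real (Suc i))\<^sup>2)" by (rule summable_mult)
qed

section \<open>The truncated cotangent kernel\<close>

context circle
begin

abbreviation far :: "real \<Rightarrow> real \<Rightarrow> real \<Rightarrow> bool" where
  "far z e y \<equiv> \<forall>n::int. e \<le> \<bar>z - y - of_int n * L\<bar>"

text \<open>Truncation is built into a periodic function of \<open>y\<close> on the whole line, so
  that the kernel lies in L2 and Parseval applies to it.\<close>

definition cot_kernel :: "real \<Rightarrow> real \<Rightarrow> real \<Rightarrow> real" where
  "cot_kernel z e y = (if far z e y then cot (pi / L * (z - y)) else 0)"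

text \<open>Once \<open>e\<close> is below the distance of \<open>z\<close> to both endpoints, the
  other singularities stay farther than \<open>e\<close> from the period, and a single interval is
  removed.\<close>

lemma far_iff:
  assumes z: "0 < e" "e < z" "e < L - z" and y: "y \<in> {0..L}"
  shows "far z e y \<longleftrightarrow> y \<in> {0..z - e} \<union> {z + e..L}"
proof
  assume "far z e y"
  then have "e \<le> \<bar>z - y - of_int 0 * L\<bar>" by blast
  then show "y \<in> {0..z - e} \<union> {z + e..L}" using y by auto
next
  assume y': "y \<in> {0..z - e} \<union> {z + e..L}"
  show "far z e y"
  proof
    fix n :: int
    have yL: "0 \<le> y" "y \<le> L" using y by auto
    consider "n = 0" | "n \<ge> 1" | "n \<le> - 1" by linarith
    then show "e \<le> \<bar>z - y - of_int n * L\<bar>"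
    proof cases
      case 1
      then show ?thesis using y' z by auto
    next
      case 2
      then have "1 * L \<le> of_int n * L" using L_pos by (intro mult_right_mono) auto
      then have "e \<le> - (z - y - of_int n * L)" using yL z by linarith
      then show ?thesis by (rule order.trans[OF _ abs_ge_minus_self])
    next
      case 3
      then have "of_int n \<le> (- 1 :: real)" by linarith
      then have "of_int n * L \<le> - 1 * L" using L_pos by (intro mult_right_mono) auto
      then have "e \<le> z - y - of_int n * L" using yL z by linarith
      then show ?thesis by (rule order.trans[OF _ abs_ge_self])
    qed
  qed
qed

lemma sin_neq_0_far:
  assumes z: "0 < e" "e < z" "e < L - z" and y: "y \<in> {0..z - e} \<union> {z + e..L}"
  shows "sin (pi / L * (z - y)) \<noteq> 0"
  using y
proof
  assume "y \<in> {0..z - e}"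
  then have "0 < z - y" "z - y < L" using z by auto
  then have "0 < pi / L * (z - y)" "pi / L * (z - y) < pi / L * L" using L_pos by (intro mult_pos_pos mult_strict_left_mono; simp)+
  then show ?thesis using sin_gt_zero[of "pi / L * (z - y)"] L_pos by simp
next
  assume "y \<in> {z + e..L}"
  then have "0 < y - z" "y - z < L" using z by auto
  then have "0 < pi / L * (y - z)" "pi / L * (y - z) < pi / L * L" using L_pos by (intro mult_pos_pos mult_strict_left_mono; simp)+
  then have "sin (pi / L * (y - z)) > 0" using sin_gt_zero[of "pi / L * (y - z)"] L_pos by simp
  moreover have "pi / L * (z - y) = - (pi / L * (y - z))" by (simp only: mult_minus_right[symmetric] minus_diff_eq)
  ultimately show ?thesis by (simp only: sin_minus)
qed

lemma continuous_on_cot_far: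
  assumes z: "0 < e" "e < z" "e < L - z"
  shows "continuous_on ({0..z - e} \<union> {z + e..L}) (\<lambda>y. cot (pi / L * (z - y)))"
  unfolding cot_def using sin_neq_0_far[OF z] by (intro continuous_intros) auto

lemma cot_kernel_L2:
  assumes z: "0 < e" "e < z" "e < L - z"
  shows "cot_kernel z e \<in> L2 L"
proof -
  define K where "K = {0..z - e} \<union> {z + e..L}"
  have "cot_kernel z e (y + L) = cot_kernel z e y" for y
  proof -
    have "far z e (y + L) \<longleftrightarrow> far z e y"
    proof safe
      fix n :: int assume "far z e (y + L)"
      from spec[OF this, of "n - 1"] show "e \<le> \<bar>z - y - of_int n * L\<bar>" by (simp add: algebra_simps)
    next
      fix n :: int assume "far z e y"
      from spec[OF this, of "n + 1"] show "e \<le> \<bar>z - (y + L) - of_int n * L\<bar>" by (simp add: algebra_simps)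
    qed
    moreover have "cot (pi / L * (z - (y + L))) = cot (pi / L * (z - y))"
    proof -
      have "pi / L * (z - (y + L)) = pi / L * (z - y) - pi" using L_pos by (simp add: field_simps)
      then show ?thesis by (simp add: cot_def)
    qed
    ultimately show ?thesis by (simp only: cot_kernel_def)
  qed
  then have "periodic L (cot_kernel z e)" by (simp add: periodic_def)
  moreover have "cot_kernel z e \<in> borel_measurable borel" unfolding cot_kernel_def[abs_def] cot_def by measurable
  moreover have "set_integrable lborel {0..L} (\<lambda>y. (cot_kernel z e y)\<^sup>2)"
  proof -
    have "integrable lborel (\<lambda>y. indicator K y *\<^sub>R (cot (pi / L * (z - y)))\<^sup>2)"
      unfolding K_def by (intro borel_integrable_compact continuous_intros continuous_on_cot_far z) auto
    moreover have "indicator K y *\<^sub>R (cot (pi / L * (z - y)))\<^sup>2 = indicator {0..L} y *\<^sub>R (cot_kernel z e y)\<^sup>2" for y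
      using far_iff[OF z, of y] z by (auto simp: cot_kernel_def K_def indicator_def)
    ultimately show ?thesis by (simp add: set_integrable_def)
  qed
  ultimately show ?thesis by (simp add: L2_def)
qed

abbreviation truncation :: "(real \<Rightarrow> real) \<Rightarrow> real \<Rightarrow> real \<Rightarrow> real" where
  "truncation w z e \<equiv> (LINT y:{y \<in> {0..L}. far z e y}|lborel. w y * cot (pi / L * (z - y)))"

lemma integral_cot_kernel:
  "truncation w z e
    = (\<integral>y. cot_kernel z e y * w y \<partial>circ L)" unfolding integral_circ[symmetric] set_lebesgue_integral_def
  by (intro Bochner_Integration.integral_cong) (auto simp: cot_kernel_def indicator_def)

text \<open>The fundamental theorem of calculus on the two remaining intervals. Only frequencies
  \<open>- l\<close> with \<open>l \<ge> 0\<close> are computed; the others are their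
  conjugates.\<close>

lemma fc_cot_kernel:
  assumes z: "0 < e" "e < z" "e < L - z"
  shows "L * fc L (cot_kernel z e) (- int l) = L / pi * ee L (int l) z * ((if l = 0 then 0 else - \<i> * of_real pi) + cot_odd l (pi / L * e))"
proof -
  define \<mu> where "\<mu> = pi / L"
  define f where "f y = ee L (int l) y * of_real (cot (\<mu> * (z - y)))" for y
  \<comment> \<open>The factor \<open>ee L (int l) z\<close> comes from splitting \<open>y\<close>
    as \<open>z - (z - y)\<close> in the character, and \<open>- 1 / \<mu>\<close> from the chain
    rule.\<close>
  define F where "F y = - (ee L (int l) z / of_real \<mu>) * cot_prim l (\<mu> * (z - y))" for y
  have \<mu>: "\<mu> > 0" "\<mu> * L = pi" using L_pos by (simp_all add: \<mu>_def)
  have cont: "continuous_on ({0..z - e} \<union> {z + e..L}) f"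
    unfolding f_def \<mu>_def by (intro continuous_on_mult continuous_on_ee continuous_on_of_real continuous_on_cot_far z)
  have vd: "(F has_vector_derivative f y) (at y within S)" if "y \<in> {0..z - e} \<union> {z + e..L}" for y S
  proof -
    have s: "sin (\<mu> * (z - y)) \<noteq> 0" using sin_neq_0_far[OF z that] by (simp add: \<mu>_def)
    have "((\<lambda>y. \<mu> * (z - y)) has_vector_derivative - \<mu>) (at y within S)"
      by (auto intro!: derivative_eq_intros simp: has_real_derivative_iff_has_vector_derivative[symmetric])
    from vector_diff_chain_within[OF this cot_prim_has_vector_derivative[OF s, of l]]
    have "((\<lambda>y. cot_prim l (\<mu> * (z - y))) has_vector_derivative - \<mu> *\<^sub>R (cis (- 2 * real l * (\<mu> * (z - y))) * of_real (cot (\<mu> * (z - y))))) (at y within S)"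
      by (simp add: o_def)
    from has_vector_derivative_mult_right[OF this, of "- (ee L (int l) z / of_real \<mu>)"]
    have "(F has_vector_derivative ee L (int l) z * cis (- 2 * real l * (\<mu> * (z - y))) * of_real (cot (\<mu> * (z - y)))) (at y within S)"
      using \<mu> by (simp add: F_def[abs_def] scaleR_conv_of_real mult_ac)
    moreover have "ee L (int l) z * cis (- 2 * real l * (\<mu> * (z - y))) = ee L (int l) y"
    proof -
      have "2 * pi / L * of_int (int l) * z + - 2 * real l * (\<mu> * (z - y)) = 2 * pi / L * of_int (int l) * y"
        using L_pos by (simp add: \<mu>_def field_simps)
      then show ?thesis by (simp only: ee_def cis_mult)
    qed
    ultimately show ?thesis by (simp only: f_def)
  qed
  have i1: "(\<integral>y. indicator {0..z - e} y *\<^sub>R f y \<partial>lborel) = F (z - e) - F 0"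
    by (rule integral_FTC_Icc) (use z vd continuous_on_subset[OF cont] in auto)
  have i2: "(\<integral>y. indicator {z + e..L} y *\<^sub>R f y \<partial>lborel) = F L - F (z + e)"
    by (rule integral_FTC_Icc) (use z vd continuous_on_subset[OF cont] in auto)
  have int: "integrable lborel (\<lambda>y. indicator {0..z - e} y *\<^sub>R f y)" "integrable lborel (\<lambda>y. indicator {z + e..L} y *\<^sub>R f y)"
    by (intro borel_integrable_compact continuous_on_subset[OF cont]; simp)+
  have "L * fc L (cot_kernel z e) (- int l) = (\<integral>y. of_real (cot_kernel z e y) * ee L (int l) y \<partial>circ L)"
    using L_pos by (simp add: fc_def)
  also have "\<dots> = (\<integral>y. indicator {0..z - e} y *\<^sub>R f y + indicator {z + e..L} y *\<^sub>R f y \<partial>lborel)"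
    unfolding integral_circ[symmetric] set_lebesgue_integral_def
  proof (rule Bochner_Integration.integral_cong)
    fix y
    show "indicator {0..L} y *\<^sub>R (of_real (cot_kernel z e y) * ee L (int l) y) = indicator {0..z - e} y *\<^sub>R f y + indicator {z + e..L} y *\<^sub>R f y"
      using far_iff[OF z, of y] z by (auto simp: cot_kernel_def f_def \<mu>_def indicator_def)
  qed simp
  also have "\<dots> = (F (z - e) - F 0) + (F L - F (z + e))" using int by (simp add: i1 i2)
  \<comment> \<open>The ends \<open>0\<close> and \<open>L\<close> are \<open>pi\<close> apart in
    the scaled variable and give the jump; the edges \<open>z - e\<close> and \<open>z + e\<close>
    give \<open>cot_odd\<close>.\<close>
  also have "\<dots> = ee L (int l) z / of_real \<mu> * ((cot_prim l (\<mu> * z) - cot_prim l (\<mu> * z - pi)) + (cot_prim l (- (\<mu> * e)) - cot_prim l (\<mu> * e)))"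
    using \<mu>(2) by (simp add: F_def algebra_simps)
  also have "\<dots> = L / pi * ee L (int l) z * ((if l = 0 then 0 else - \<i> * of_real pi) + cot_odd l (\<mu> * e))"
    unfolding cot_prim_diff_pi cot_prim_odd using L_pos by (simp add: \<mu>_def)
  finally show ?thesis by (simp add: \<mu>_def)
qed

section \<open>The principal value and the Fourier multiplier of the Hilbert transform\<close>

abbreviation mode :: "(int \<Rightarrow> complex) \<Rightarrow> real \<Rightarrow> nat \<Rightarrow> real" where
  "mode c z i \<equiv> 2 * Re (c (int (Suc i)) * ee L (int (Suc i)) z)"

lemma Re_trig_sum_eq:
  assumes "\<And>k. c (- k) = cnj (c k)" "c 0 = 0"
  shows "Re (trig_sum L c J z) = (\<Sum>i<J. mode c z i)"
proof -
  have "Re (c (- int (Suc i)) * ee L (- int (Suc i)) z) = Re (c (int (Suc i)) * ee L (int (Suc i)) z)" for i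
  proof -
    have "c (- int (Suc i)) * ee L (- int (Suc i)) z = cnj (c (int (Suc i)) * ee L (int (Suc i)) z)"
      by (simp only: assms complex_cnj_mult cnj_ee)
    then show ?thesis by (simp only: complex_cnj(1) cnj.sel)
  qed
  then show ?thesis unfolding trig_sum_def sum_symint by (simp add: assms Re_sum)
qed

text \<open>Harmonic growth costs less than the one derivative available: move the frequency from
  one factor to the other and use \<open>\<bar>x * y\<bar> \<le> x\<^sup>2 + y\<^sup>2\<close>.
  Taking \<open>a = 1\<close>, \<open>b = 0\<close> gives absolute summability.\<close>

lemma summable_V_1:
  assumes w: "w \<in> V_space L 1"
  shows "summable (\<lambda>i. cmod (fc L w (int (Suc i))) * (a + b * harm (Suc i)))"
proof -
  obtain B where B: "\<And>J. sobolev_sum 1 w J \<le> B" using w by (auto simp: V_space_iff)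
  have "summable (\<lambda>i. (real (Suc i) * cmod (fc L w (int (Suc i))))\<^sup>2)"
  proof (rule summableI_nonneg_bounded)
    fix n
    have "(\<Sum>i<n. (real (Suc i) * cmod (fc L w (int (Suc i))))\<^sup>2) = (\<Sum>k\<in>(\<lambda>i. int (Suc i)) ` {..<n}. (real_of_int k) ^ (2 * 1) * (cmod (fc L w k))\<^sup>2)"
      by (subst sum.reindex) (auto simp: inj_on_def power_mult_distrib)
    also have "\<dots> \<le> sobolev_sum 1 w n" unfolding sobolev_sum_def by (intro sum_mono2) (auto simp: zero_le_even_power)
    also note B[of n]
    finally show "(\<Sum>i<n. (real (Suc i) * cmod (fc L w (int (Suc i))))\<^sup>2) \<le> B" .
  qed simp
  from summable_add[OF this summable_harm_square[of a b]]
  show ?thesis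
  proof (rule summable_comparison_test[rotated], intro exI allI impI)
    fix i
    define x y where "x = real (Suc i) * cmod (fc L w (int (Suc i)))" "y = (a + b * harm (Suc i)) / real (Suc i)"
    have "cmod (fc L w (int (Suc i))) * (a + b * harm (Suc i)) = x * y" unfolding x_y_def by (simp del: of_nat_Suc)
    then show "norm (cmod (fc L w (int (Suc i))) * (a + b * harm (Suc i))) \<le> (real (Suc i) * cmod (fc L w (int (Suc i))))\<^sup>2 + ((a + b * harm (Suc i)) / real (Suc i))\<^sup>2"
      using abs_mult_le_sum_squares[of x y] unfolding x_y_def by simp
  qed
qed

text \<open>\<open>Lim\<close> has a known value only after convergence is proved. Parseval writes
  each truncated integral as a series, and Tannery's theorem lets \<open>e\<close> tend to zero
  under the sum.\<close>

lemma hilbert_series: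
  assumes w: "w \<in> V_space L 1" and z: "0 < z" "z < L"
  shows "(\<lambda>i. mode (\<lambda>k. - \<i> * fc L w k) z i) sums hilbert L w z"
proof -
  have wL2: "w \<in> L2 L" and w0: "fc L w 0 = 0" using w by (auto simp: V_space_iff)
  define c where "c = fc L w"
  let ?o = "\<lambda>i e. - \<i> * of_real pi + cot_odd (Suc i) (pi / L * e)"
  define a where "a i e = 2 * Re (L / pi * ee L (int (Suc i)) z * ?o i e * c (int (Suc i)))" for i e
  \<comment> \<open>The limit of \<open>a i\<close>; \<open>+ 0\<close> is the limit of
    \<open>cot_odd\<close>.\<close>
  define b where "b i = 2 * Re (L / pi * ee L (int (Suc i)) z * (- \<i> * of_real pi + 0) * c (int (Suc i)))" for i
  have sums: "(\<lambda>i. a i e) sums (\<integral>y. cot_kernel z e y * w y \<partial>circ L)" if e: "0 < e" "e < z" "e < L - z" for e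
  proof -
    define d where "d l = fc L (cot_kernel z e) (- l) * c l" for l
    have "d (- l) = cnj (d l)" for l by (simp add: d_def c_def fc_cnj)
    then have dd: "d (int (Suc i)) + d (- int (Suc i)) = of_real (2 * Re (d (int (Suc i))))" for i by (simp only: complex_add_cnj)
    have "L * (\<Sum>l\<in>symint J. d l) = of_real (\<Sum>i<J. a i e)" for J
    proof -
      have "L * (\<Sum>l\<in>symint J. d l) = (\<Sum>i<J. of_real (L * (2 * Re (d (int (Suc i))))))"
        unfolding sum_symint dd by (simp add: d_def c_def w0 sum_distrib_left)
      also have "\<dots> = (\<Sum>i<J. of_real (a i e))"
      proof (intro sum.cong refl arg_cong[of _ _ complex_of_real])
        fix i
        have "L * d (int (Suc i)) = L / pi * ee L (int (Suc i)) z * ?o i e * c (int (Suc i))"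
          unfolding d_def using fc_cot_kernel[OF e, of "Suc i"] by (simp add: mult.assoc[symmetric] del: of_nat_Suc)
        then have "a i e = 2 * Re (L * d (int (Suc i)))" by (simp only: a_def)
        then show "L * (2 * Re (d (int (Suc i)))) = a i e" by (simp del: of_nat_Suc)
      qed
      finally show ?thesis by simp
    qed
    moreover have "(\<lambda>J. L * (\<Sum>l\<in>symint J. d l)) \<longlonglongrightarrow> of_real (\<integral>y. cot_kernel z e y * w y \<partial>circ L)"
      unfolding d_def c_def by (rule Parseval[OF cot_kernel_L2[OF e] wL2])
    ultimately have "(\<lambda>J. complex_of_real (\<Sum>i<J. a i e)) \<longlonglongrightarrow> of_real (\<integral>y. cot_kernel z e y * w y \<partial>circ L)"
      by (simp only:)
    then show ?thesis unfolding sums_def by (simp only: tendsto_of_real_iff)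
  qed
  define \<delta> where "\<delta> = min z (L - z)"
  have \<delta>: "\<delta> > 0" using z by (simp add: \<delta>_def)
  have evd: "\<forall>\<^sub>F e in at_right 0. 0 < e \<and> e < z \<and> e < L - z"
    using \<delta> by (auto simp: eventually_at_right_field \<delta>_def intro!: exI[of _ \<delta>])
  \<comment> \<open>\<open>12\<close> is \<open>4\<close>, a bound for \<open>pi\<close>, plus the
    \<open>8\<close> of \<open>norm_cot_odd_le\<close>.\<close>
  define B where "B i = 2 * (L / pi) * (cmod (c (int (Suc i))) * (12 + 2 * harm (Suc i)))" for i
  have bound: "norm (a i e) \<le> B i" if "0 < e" "e < L" for i e
  proof -
    have "pi / L * e \<le> pi / L * L" using that L_pos by (intro mult_left_mono) auto
    then have e4: "pi / L * e \<le> 4" using L_pos pi_less_4 by simp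
    have "cmod (?o i e) \<le> pi + (8 + 2 * harm (Suc i))" by (rule order.trans[OF norm_triangle_ineq], intro add_mono norm_cot_odd_le)
         (use e4 that L_pos in \<open>auto simp: norm_mult\<close>)
    also have "\<dots> \<le> 12 + 2 * harm (Suc i)" using pi_less_4 by simp
    finally have co: "cmod (?o i e) \<le> 12 + 2 * harm (Suc i)" .
    have "norm (a i e) \<le> 2 * cmod (L / pi * ee L (int (Suc i)) z * ?o i e * c (int (Suc i)))"
      unfolding a_def real_norm_def abs_mult by (intro mult_mono abs_Re_le_cmod) auto
    also have "\<dots> = 2 * (L / pi) * (cmod (c (int (Suc i))) * cmod (?o i e))"
      using L_pos by (simp only: norm_mult norm_ee norm_of_real) (simp del: of_nat_Suc)
    also have "\<dots> \<le> B i" unfolding B_def using co L_pos by (intro mult_left_mono) auto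
    finally show ?thesis .
  qed
  have "((\<lambda>e. \<Sum>i. a i e) \<longlongrightarrow> suminf b) (at_right 0)"
  proof (rule conjunct2[OF conjunct2[OF tannerys_theorem]])
    fix i
    have "filterlim (\<lambda>e. pi / L * e) (at_right 0) (at_right 0)"
    proof -
      have "((\<lambda>e. pi / L * e) \<longlongrightarrow> pi / L * 0) (at_right 0)" by (intro tendsto_intros)
      moreover have "\<forall>\<^sub>F e in at_right 0. pi / L * e \<in> {0<..} \<and> pi / L * e \<noteq> 0"
        using eventually_at_right_less[of 0] by eventually_elim (use L_pos in auto)
      ultimately show ?thesis unfolding filterlim_at by (simp only: mult_zero_right simp_thms)
    qed
    from filterlim_compose[OF cot_odd_tendsto this, of "Suc i"]
    show "((\<lambda>e. a i e) \<longlongrightarrow> b i) (at_right 0)" unfolding a_def b_def by (intro tendsto_intros)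
  next
    have "\<forall>\<^sub>F e in at_right 0. 0 < e \<and> e < L" using evd by eventually_elim (use z in auto)
    then show "\<forall>\<^sub>F (i, e) in sequentially \<times>\<^sub>F at_right 0. norm (a i e) \<le> B i"
      unfolding eventually_prod_filter using bound by (intro exI[of _ "\<lambda>_. True"] exI[of _ "\<lambda>e. 0 < e \<and> e < L"]) auto
  next
    show "summable B" unfolding B_def c_def by (intro summable_mult summable_V_1 w)
  qed simp
  moreover have "\<forall>\<^sub>F e in at_right 0. (\<Sum>i. a i e) = truncation w z e" using evd
  proof eventually_elim
    case (elim e)
    then have e: "0 < e" "e < z" "e < L - z" by simp_all
    show ?case unfolding integral_cot_kernel using sums_unique[OF sums[OF e]] by (rule sym)
  qed
  ultimately have "(truncation w z \<longlongrightarrow> suminf b) (at_right 0)" by (rule Lim_transform_eventually)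
  then have "hilbert L w z = (1 / L) * suminf b" unfolding hilbert_def by (subst tendsto_Lim) auto
  moreover have "summable b"
  proof (rule summable_comparison_test')
    show "summable B" unfolding B_def c_def by (intro summable_mult summable_V_1 w)
    fix i :: nat assume "i \<ge> 0"
    have "norm (b i) \<le> 2 * cmod (L / pi * ee L (int (Suc i)) z * (- \<i> * of_real pi + 0) * c (int (Suc i)))"
      unfolding b_def real_norm_def abs_mult by (intro mult_mono abs_Re_le_cmod) auto
    also have "\<dots> = 2 * (L / pi) * (cmod (c (int (Suc i))) * pi)"
      using L_pos by (simp only: norm_mult norm_ee norm_of_real) (simp add: norm_mult del: of_nat_Suc)
    also have "\<dots> \<le> B i" unfolding B_def using L_pos pi_less_4 harm_nonneg[of "Suc i", where 'a=real] by (intro mult_left_mono) auto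
    finally show "norm (b i) \<le> B i" .
  qed
  ultimately have "(\<lambda>i. (1 / L) * b i) sums hilbert L w z" by (simp only: sums_mult summable_sums)
  moreover have "(1 / L) * b i = mode (\<lambda>k. - \<i> * fc L w k) z i" for i
  proof -
    define x where "x = L / pi * ee L (int (Suc i)) z * (- \<i> * of_real pi + 0) * c (int (Suc i))"
    have "- \<i> * fc L w (int (Suc i)) * ee L (int (Suc i)) z = of_real (1 / L) * x"
      using L_pos by (simp add: x_def c_def mult_ac del: of_nat_Suc)
    moreover have "Re (of_real (1 / L) * x) = 1 / L * Re x"
      by (simp only: Re_complex_of_real times_complex.sel Im_complex_of_real mult_zero_left diff_zero)
    ultimately show ?thesis unfolding b_def x_def[symmetric] by (simp only: mult.left_commute)
  qed
  ultimately show ?thesis by (simp only:)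
qed

text \<open>Absolute summability bounds the partial sums uniformly, so dominated convergence
  applies. Used for the Hilbert transform and for the smooth representative.\<close>

lemma fc_series:
  assumes d: "\<And>k. d (- k) = cnj (d k)" "d 0 = 0" and sm: "summable (\<lambda>i. cmod (d (int (Suc i))))"
    and h: "h \<in> borel_measurable borel"
    and lim: "AE z in circ L. (\<lambda>i. mode d z i) sums h z"
  shows "fc L h k = d k"
proof -
  define s where "s J z = Re (trig_sum L d J z)" for J z
  have s_eq: "s J z = (\<Sum>i<J. mode d z i)" for J z unfolding s_def by (rule Re_trig_sum_eq[of d, OF d])
  define B where "B = (\<Sum>i. 2 * cmod (d (int (Suc i))))"
  have sB: "\<bar>s J z\<bar> \<le> B" for J z
  proof -
    have "\<bar>s J z\<bar> \<le> (\<Sum>i<J. 2 * cmod (d (int (Suc i))))" unfolding s_eq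
    proof (rule order.trans[OF sum_abs], rule sum_mono)
      fix i
      have "\<bar>Re (d (int (Suc i)) * ee L (int (Suc i)) z)\<bar> \<le> cmod (d (int (Suc i)))"
        by (rule order.trans[OF abs_Re_le_cmod]) (simp add: norm_mult del: of_nat_Suc)
      then show "\<bar>mode d z i\<bar> \<le> 2 * cmod (d (int (Suc i)))" by (simp only: abs_mult)
    qed
    also have "\<dots> \<le> B" unfolding B_def by (rule sum_le_suminf[OF summable_mult[OF sm]]) auto
    finally show ?thesis .
  qed
  have [measurable]: "s J \<in> borel_measurable borel" for J unfolding s_def[abs_def] by measurable
  note [measurable] = h
  have "(\<lambda>J. \<integral>z. of_real (s J z) * ee L (- k) z \<partial>circ L) \<longlonglongrightarrow> (\<integral>z. of_real (h z) * ee L (- k) z \<partial>circ L)"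
  proof (rule integral_dominated_convergence[where w="\<lambda>z. B"])
    show "AE z in circ L. (\<lambda>J. complex_of_real (s J z) * ee L (- k) z) \<longlonglongrightarrow> of_real (h z) * ee L (- k) z"
      using lim unfolding sums_def s_eq[symmetric] by eventually_elim (intro tendsto_intros)
    show "AE z in circ L. norm (complex_of_real (s J z) * ee L (- k) z) \<le> B" for J using sB by (simp add: norm_mult)
  qed (auto intro!: integrable_bounded[of _ "\<bar>B\<bar>"])
  then have "(\<lambda>J. fc L (s J) k) \<longlonglongrightarrow> fc L h k" unfolding fc_def by (intro tendsto_intros)
  moreover have "(\<lambda>J. fc L (s J) k) \<longlonglongrightarrow> d k"
  proof (rule tendsto_eventually)
    show "\<forall>\<^sub>F J in sequentially. fc L (s J) k = d k" using eventually_ge_at_top[of "nat \<bar>k\<bar>"]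
      by eventually_elim (auto simp: s_def[abs_def] fc_trig_sum[of d, OF d(1)])
  qed
  ultimately show ?thesis by (rule LIMSEQ_unique)
qed

text \<open>The pointwise series holds inside the period, which is enough almost everywhere.\<close>

lemma fc_hilbert:
  assumes w: "w \<in> V_space L 1" and H: "hilbert L w \<in> borel_measurable borel"
  shows "fc L (hilbert L w) k = - \<i> * of_int (sgn k) * fc L w k"
proof (rule fc_series[where d = "\<lambda>k. - \<i> * of_int (sgn k) * fc L w k"])
  show "- \<i> * of_int (sgn (- k)) * fc L w (- k) = cnj (- \<i> * of_int (sgn k) * fc L w k)" for k by (simp add: fc_cnj sgn_minus)
  show "summable (\<lambda>i. cmod (- \<i> * of_int (sgn (int (Suc i))) * fc L w (int (Suc i))))"
    using summable_V_1[OF w, of 1 0] by (simp add: norm_mult del: of_nat_Suc)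
  show "AE z in circ L. (\<lambda>i. mode (\<lambda>k. - \<i> * of_int (sgn k) * fc L w k) z i) sums hilbert L w z"
    using AE_space[of "circ L"] AE_interior
  proof eventually_elim
    case (elim z)
    then show ?case using hilbert_series[OF w, of z] by (simp del: of_nat_Suc)
  qed
qed (use H in auto)

end

section \<open>Smoothness and time continuity in terms of Fourier coefficients\<close>

text \<open>\<open>circ L\<close> sees one period only, while \<open>C_infinity\<close> compares
  functions on the whole line: countably many translates of the exceptional null set cover all
  exceptions.\<close>

lemma AE_periodic:
  assumes "L > 0" "periodic L f" "periodic L g" and m: "f \<in> borel_measurable borel" "g \<in> borel_measurable borel"
    and ae: "AE z in circ L. f z = g z"
  shows "AE z in lborel. f z = g z"
proof -
  note [measurable] = m
  have per: "h (z + of_int n * L) = h z" if "periodic L h" for h :: "real \<Rightarrow> real" and n :: int and z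
  proof (induction n rule: int_induct[where k=0])
    case (step1 i)
    then show ?case using that unfolding periodic_def by (metis add.assoc distrib_right mult_1 of_int_1 of_int_add)
  next
    case (step2 i)
    have "h (z + of_int i * L) = h (z + of_int (i - 1) * L + L)" by (simp add: algebra_simps)
    then show ?case using step2 that unfolding periodic_def by metis
  qed simp
  define P where "P z \<longleftrightarrow> (z \<in> {0..L} \<longrightarrow> f z = g z)" for z
  have [measurable]: "Measurable.pred borel P" unfolding P_def[abs_def] by measurable
  have P: "AE z in lborel. P z" using ae unfolding circ_def P_def by (subst (asm) AE_restrict_space_iff) auto
  have "AE z in lborel. P (of_int n * L + z)" for n :: int
  proof -
    have "AE z in distr lborel borel ((+) (of_int n * L)). P z" using P unfolding lborel_distr_plus .
    then show ?thesis by (subst (asm) AE_distr_iff) auto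
  qed
  then have "AE z in lborel. \<forall>n::int. P (of_int n * L + z)" by (simp add: AE_all_countable)
  then show ?thesis
  proof eventually_elim
    case (elim z)
    define n where "n = - \<lfloor>z / L\<rfloor>"
    have "of_int n * L + z \<in> {0..L}"
    proof -
      have "of_int \<lfloor>z / L\<rfloor> * L \<le> z / L * L" "z / L * L \<le> (of_int \<lfloor>z / L\<rfloor> + 1) * L"
        using \<open>L > 0\<close> real_of_int_floor_add_one_ge[of "z / L"] by (intro mult_right_mono; simp)+
      then show ?thesis using \<open>L > 0\<close> by (simp add: n_def algebra_simps)
    qed
    then have "f (of_int n * L + z) = g (of_int n * L + z)" using elim by (auto simp: P_def)
    then show ?case using per[OF assms(2), of z n] per[OF assms(3), of z n] by (simp add: add.commute)
  qed
qed

context circle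
begin

text \<open>The classical derivatives of the smooth representative are weak derivatives, so smooth
  data can start the propagation at every order.\<close>

lemma smooth_imp_V_space:
  assumes u: "u \<in> V_space L n" and C: "u \<in> C_infinity L"
  shows "u \<in> V_space L j"
proof -
  obtain g where g: "g \<in> smooth_fun L" "AE z in lborel. u z = g z" using C by (auto simp: C_infinity_def)
  have uL2: "u \<in> L2 L" "fc L u 0 = 0" using u by (auto simp: V_space_iff)
  have gL2: "g \<in> L2 L" "(deriv ^^ j) g \<in> L2 L" using g by (auto intro!: smooth_fun_L2 smooth_fun_funpow_deriv)
  have ug: "fc L u k = fc L g k" for k using fc_cong_AE[OF AE_circ[OF g(2)]] uL2 gL2 by (simp add: L2_iff)
  have "has_weak_deriv L j u ((deriv ^^ j) g)" by (rule fc_imp_has_weak_deriv) (use uL2 gL2 g ug in \<open>simp_all add: fc_funpow_deriv\<close>)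
  then have "(2 * pi / L) ^ (2 * j) * sobolev_sum j u J \<le> (\<integral>z. ((deriv ^^ j) g z)\<^sup>2 \<partial>circ L) / L" for J
    using Bessel[OF gL2(2), of J] sum_has_weak_deriv[of j u "(deriv ^^ j) g" J] L_pos by (simp add: field_simps)
  then have "sobolev_sum j u J \<le> (\<integral>z. ((deriv ^^ j) g z)\<^sup>2 \<partial>circ L) / L / (2 * pi / L) ^ (2 * j)" for J
    using L_pos by (subst pos_le_divide_eq) (auto simp: mult.commute)
  then show ?thesis unfolding V_space_iff using uL2 by blast
qed

text \<open>Each weak derivative lies in \<open>V_space L 1\<close>, so its Fourier series converges
  absolutely, and the series of \<open>f\<close> may be differentiated termwise any number of times.
  \<open>G j\<close> is the resulting derivative of order \<open>j\<close>.\<close>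

lemma V_space_imp_smooth:
  assumes f: "\<And>n. f \<in> V_space L n"
  shows "f \<in> C_infinity L"
proof -
  define c where "c = fc L f"
  define G where "G j z = (\<Sum>i. mode (\<lambda>k. c k * frq L k ^ j) z i)" for j z
  have fL2: "f \<in> L2 L" and f0: "fc L f 0 = 0" using f[of 0] by (auto simp: V_space_iff)
  have sm: "summable (\<lambda>i. cmod (c (int (Suc i)) * frq L (int (Suc i)) ^ j))" for j
  proof -
    have "f \<in> sobolev L j" using f[of j] by (simp add: V_space_def)
    then have wd: "has_weak_deriv L j f (weak_deriv L j f)" by (rule has_weak_deriv_weak_deriv) simp
    then have fcw: "fc L (weak_deriv L j f) k = frq L k ^ j * fc L f k" for k by (rule has_weak_deriv_imp_fc)
    obtain B where B: "\<And>J. sobolev_sum (Suc j) f J \<le> B" using f[of "Suc j"] by (auto simp: V_space_iff)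
    have "sobolev_sum 1 (weak_deriv L j f) J \<le> (2 * pi / L) ^ (2 * j) * B" for J
    proof -
      have "sobolev_sum 1 (weak_deriv L j f) J = (2 * pi / L) ^ (2 * j) * sobolev_sum (Suc j) f J"
        unfolding sobolev_sum_def fcw cmod_frq sum_distrib_left by (intro sum.cong refl) (simp add: power_add power2_eq_square mult_ac)
      then show ?thesis using B[of J] L_pos by (simp add: mult_left_mono)
    qed
    moreover have "fc L (weak_deriv L j f) 0 = 0" by (simp add: fcw f0)
    ultimately have "weak_deriv L j f \<in> V_space L 1" using wd by (auto simp: V_space_iff has_weak_deriv_def)
    from summable_V_1[OF this, of 1 0] show ?thesis by (simp add: fcw c_def mult.commute)
  qed
  have bnd: "norm (mode (\<lambda>k. c k * frq L k ^ j) z i) \<le> 2 * cmod (c (int (Suc i)) * frq L (int (Suc i)) ^ j)" for i j z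
  proof -
    have "\<bar>Re (c (int (Suc i)) * frq L (int (Suc i)) ^ j * ee L (int (Suc i)) z)\<bar> \<le> cmod (c (int (Suc i)) * frq L (int (Suc i)) ^ j * ee L (int (Suc i)) z)"
      by (rule abs_Re_le_cmod)
    then show ?thesis by (simp add: norm_mult del: of_nat_Suc)
  qed
  have sm2: "summable (\<lambda>i. mode (\<lambda>k. c k * frq L k ^ j) z i)" for j z
    by (rule summable_comparison_test'[OF summable_mult[OF sm[of j], of 2]]) (rule bnd)
  have G': "(G j has_real_derivative G (Suc j) z) (at z)" for j z unfolding G_def[abs_def]
  proof (rule has_field_derivative_series'(2)[of UNIV])
    show "((\<lambda>z. mode (\<lambda>k. c k * frq L k ^ j) z i) has_real_derivative mode (\<lambda>k. c k * frq L k ^ Suc j) z i) (at z within UNIV)" for i z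
      using DERIV_cmult[OF Re_ee_has_real_derivative[of "c (int (Suc i)) * frq L (int (Suc i)) ^ j" "int (Suc i)" z], of 2]
      by (simp only: power_Suc2 mult.assoc)
    show "uniformly_convergent_on UNIV (\<lambda>n z. \<Sum>i<n. mode (\<lambda>k. c k * frq L k ^ Suc j) z i)"
      by (rule Weierstrass_m_test'[OF bnd summable_mult[OF sm]])
    show "summable (\<lambda>i. mode (\<lambda>k. c k * frq L k ^ j) 0 i)" by (rule sm2)
  qed auto
  have Gj: "(deriv ^^ j) (G 0) = G j" for j
  proof (induction j)
    case (Suc j)
    have "deriv (G j) = G (Suc j)" by (rule ext, rule DERIV_imp_deriv) (rule G')
    then show ?case using Suc by simp
  qed simp
  have pG: "periodic L (G 0)" by (simp add: periodic_def G_def ee_periodic)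
  have G0: "G 0 \<in> smooth_fun L" using pG G' by (auto simp: smooth_fun_def Gj real_differentiable_def)
  then have GL2: "G 0 \<in> L2 L" by (rule smooth_fun_L2)
  have "fc L (G 0) k = c k" for k
  proof (rule fc_series)
    show "c (- k) = cnj (c k)" for k by (simp add: c_def fc_cnj)
    show "c 0 = 0" by (simp add: c_def f0)
    show "summable (\<lambda>i. cmod (c (int (Suc i))))" using sm[of 0] by simp
    show "G 0 \<in> borel_measurable borel" using GL2 by (rule L2_measurable)
    show "AE z in circ L. (\<lambda>i. mode c z i) sums G 0 z" using summable_sums[OF sm2[of 0]] by (intro AE_I2) (simp add: G_def)
  qed
  then have "AE z in circ L. f z = G 0 z" by (intro fc_inj L2_integrable fL2 GL2) (simp add: c_def)
  then have "AE z in lborel. f z = G 0 z" using AE_periodic[OF L_pos] fL2 GL2 by (auto simp: L2_iff)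
  then show ?thesis using G0 fL2 by (auto simp: C_infinity_def L2_iff)
qed

section \<open>Differences, uniform bounds and derivatives in time\<close>

lemma sobolev_sum_diff:
  assumes "f \<in> L2 L" "g \<in> L2 L"
  shows "fc L (\<lambda>z. f z - g z) k = fc L f k - fc L g k"
    and "sobolev_sum n f J \<le> 2 * sobolev_sum n (\<lambda>z. f z - g z) J + 2 * sobolev_sum n g J"
    and "sobolev_sum n (\<lambda>z. f z - g z) J \<le> 2 * sobolev_sum n f J + 2 * sobolev_sum n g J"
proof -
  show d: "fc L (\<lambda>z. f z - g z) k = fc L f k - fc L g k" for k
    using fc_add[OF L2_integrable[OF assms(1)] L2_integrable[OF assms(2)], of 1 "-1"] by simp
  have gen: "(\<Sum>k\<in>symint J. (real_of_int k) ^ (2 * n) * (cmod (a k + b k))\<^sup>2) \<le>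
      2 * (\<Sum>k\<in>symint J. (real_of_int k) ^ (2 * n) * (cmod (a k))\<^sup>2) + 2 * (\<Sum>k\<in>symint J. (real_of_int k) ^ (2 * n) * (cmod (b k))\<^sup>2)" for a b :: "int \<Rightarrow> complex"
    unfolding sum_distrib_left sum.distrib[symmetric]
  proof (rule sum_mono)
    fix k
    have "(real_of_int k) ^ (2 * n) * (cmod (a k + b k))\<^sup>2 \<le> (real_of_int k) ^ (2 * n) * (2 * (cmod (a k))\<^sup>2 + 2 * (cmod (b k))\<^sup>2)"
      by (intro mult_left_mono cmod_add_square_le) (simp add: zero_le_even_power)
    then show "(real_of_int k) ^ (2 * n) * (cmod (a k + b k))\<^sup>2 \<le> 2 * ((real_of_int k) ^ (2 * n) * (cmod (a k))\<^sup>2) + 2 * ((real_of_int k) ^ (2 * n) * (cmod (b k))\<^sup>2)"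
      by (simp add: ring_distribs mult_ac)
  qed
  show "sobolev_sum n f J \<le> 2 * sobolev_sum n (\<lambda>z. f z - g z) J + 2 * sobolev_sum n g J"
    using gen[of "fc L (\<lambda>z. f z - g z)" "fc L g"] by (simp add: sobolev_sum_def d)
  show "sobolev_sum n (\<lambda>z. f z - g z) J \<le> 2 * sobolev_sum n f J + 2 * sobolev_sum n g J"
    using gen[of "fc L f" "\<lambda>k. - fc L g k"] by (simp add: sobolev_sum_def d)
qed

lemma sobolev_diff:
  assumes "f \<in> sobolev L n" "g \<in> sobolev L n" shows "(\<lambda>z. f z - g z) \<in> sobolev L n"
proof -
  from assms have f: "f \<in> L2 L" "g \<in> L2 L" by (auto simp: sobolev_iff)
  from assms obtain A B where "\<And>J. sobolev_sum n f J \<le> A" "\<And>J. sobolev_sum n g J \<le> B" by (auto simp: sobolev_iff)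
  then have "sobolev_sum n (\<lambda>z. f z - g z) J \<le> 2 * A + 2 * B" for J using sobolev_sum_diff(3)[OF f, of n J] by (smt (verit))
  then show ?thesis using L2_diff[OF f] by (auto simp: sobolev_iff)
qed

lemma V_norm_nonneg: "V_norm L n f \<ge> 0" unfolding V_norm_def integral_circ by (intro real_sqrt_ge_zero integral_nonneg_AE) simp

text \<open>Continuity is given at each time separately. Times with norms beyond every
  \<open>m\<close> would accumulate at some \<open>l\<close>, near which the norm is
  bounded.\<close>

lemma C_V_bounded:
  assumes f: "f \<in> C_V L T n"
  shows "\<exists>B. \<forall>t\<in>{0..T}. \<forall>J. sobolev_sum n (f t) J \<le> B"
proof (rule ccontr)
  define \<gamma> where "\<gamma> = L * (2 * pi / L) ^ (2 * n)"
  have \<gamma>: "\<gamma> > 0" using L_pos by (simp add: \<gamma>_def)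
  assume "\<not> ?thesis"
  then have "\<forall>m::nat. \<exists>t\<in>{0..T}. \<exists>J. sobolev_sum n (f t) J > real m" by (meson not_le)
  then obtain t J where t: "\<And>m. t m \<in> {0..T}" and J: "\<And>m. sobolev_sum n (f (t m)) (J m) > real m" by metis
  have "compact {0..T}" by simp
  then obtain l r where l: "l \<in> {0..T}" and r: "strict_mono r" and lim: "(t \<circ> r) \<longlonglongrightarrow> l"
    unfolding compact_def using t by blast
  have V: "f s \<in> sobolev L n" if "s \<in> {0..T}" for s using f that by (auto simp: C_V_def V_space_def)
  then have L2: "f s \<in> L2 L" if "s \<in> {0..T}" for s using that by (simp add: sobolev_iff)
  obtain A where A: "\<And>J. sobolev_sum n (f l) J \<le> A" using V[OF l] by (auto simp: sobolev_iff)
  have "((\<lambda>s. V_norm L n (\<lambda>z. f s z - f l z)) \<longlongrightarrow> 0) (at l within {0..T})" using f l by (auto simp: C_V_def)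
  then have "\<forall>\<^sub>F s in at l within {0..T}. V_norm L n (\<lambda>z. f s z - f l z) < 1" by (rule order_tendstoD) simp
  then obtain d where d: "d > 0" "\<And>s. s \<in> {0..T} \<Longrightarrow> s \<noteq> l \<Longrightarrow> dist s l < d \<Longrightarrow> V_norm L n (\<lambda>z. f s z - f l z) < 1"
    unfolding eventually_at by blast
  have bound: "sobolev_sum n (f s) J \<le> 2 / \<gamma> + 2 * \<bar>A\<bar>" if "s \<in> {0..T}" "dist s l < d" for s J
  \<comment> \<open>The limit at \<open>l\<close> says nothing about \<open>s = l\<close>
    itself.\<close>
  proof (cases "s = l")
    case True
    have "sobolev_sum n (f s) J \<le> 2 * \<bar>A\<bar>" using A[of J] True by simp
    also have "\<dots> \<le> 2 / \<gamma> + 2 * \<bar>A\<bar>" using \<gamma> by simp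
    finally show ?thesis .
  next
    case False
    have "\<gamma> * sobolev_sum n (\<lambda>z. f s z - f l z) J \<le> (V_norm L n (\<lambda>z. f s z - f l z))\<^sup>2"
      unfolding \<gamma>_def by (intro sobolev_sum_le_V_norm sobolev_diff V that l)
    also have "\<dots> \<le> 1\<^sup>2" using d(2)[OF that(1) False that(2)] by (intro power_mono V_norm_nonneg) auto
    finally have "sobolev_sum n (\<lambda>z. f s z - f l z) J \<le> 1 / \<gamma>" using \<gamma> by (simp add: field_simps)
    then show ?thesis using sobolev_sum_diff(2)[OF L2[OF that(1)] L2[OF l], of n J] A[of J] by simp
  qed
  obtain N where N: "2 / \<gamma> + 2 * \<bar>A\<bar> < real N" using reals_Archimedean2 by blast
  have "\<forall>\<^sub>F m in sequentially. dist ((t \<circ> r) m) l < d" using lim d(1) by (rule tendstoD)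
  then have "\<forall>\<^sub>F m in sequentially. dist ((t \<circ> r) m) l < d \<and> N \<le> m"
    using eventually_ge_at_top[of N] by eventually_elim simp
  then obtain m where m: "dist (t (r m)) l < d" "N \<le> m" by (auto simp: eventually_sequentially)
  have "real (r m) < real N" using J[of "r m"] bound[OF t m(1), of "J (r m)"] N by linarith
  moreover have "N \<le> r m" using m(2) seq_suble[OF r, of m] by simp
  ultimately show False by simp
qed

text \<open>Taking a coefficient is linear and bounded on L2, so the error of the L2 difference
  quotient controls that of the scalar one.\<close>

lemma has_time_deriv_imp_fc:
  assumes d: "has_time_deriv L T f d t" and t: "t \<in> {0..T}"
  shows "((\<lambda>s. fc L (f s) k) has_vector_derivative fc L d k) (at t within {0..T})"
proof -
  let ?Q = "\<lambda>s. (1 / norm (s - t)) *\<^sub>R (fc L (f s) k - (fc L (f t) k + (s - t) *\<^sub>R fc L d k))"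
  let ?R = "\<lambda>s. L2_norm L (\<lambda>z. (f s z - f t z) / (s - t) - d z) / sqrt L"
  have f: "f s \<in> L2 L" if "s \<in> {0..T}" for s using d that by (simp add: has_time_deriv_def)
  have dL2: "d \<in> L2 L" using d by (simp add: has_time_deriv_def)
  have "(?R \<longlongrightarrow> 0 / sqrt L) (at t within {0..T})"
    using d L_pos by (intro tendsto_divide tendsto_const) (auto simp: has_time_deriv_def)
  then have lim: "(?R \<longlongrightarrow> 0) (at t within {0..T})" by simp
  have "(?Q \<longlongrightarrow> 0) (at t within {0..T})"
  proof (rule Lim_null_comparison[OF _ lim])
    have "norm (?Q s) \<le> ?R s"
      if s: "s \<in> {0..T}" "s \<noteq> t" for s
    proof -
      define g where "g z = (f s z - f t z) / (s - t) - d z" for z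
      have gd: "g = (\<lambda>z. 1 / (s - t) * (1 * f s z + (- 1) * f t z) + (- 1) * d z)" by (auto simp: g_def)
      have i: "f s \<in> L2 L" "f t \<in> L2 L" "(\<lambda>z. 1 * f s z + (- 1) * f t z) \<in> L2 L" by (intro L2_add f s t)+
      have gL2: "g \<in> L2 L" unfolding gd by (intro L2_add i dL2)
      have "fc L g k = of_real (1 / (s - t)) * (fc L (f s) k - fc L (f t) k) - fc L d k"
        unfolding gd using i dL2 by (subst fc_add | simp add: L2_integrable)+
      then have "(s - t) *\<^sub>R fc L g k = fc L (f s) k - (fc L (f t) k + (s - t) *\<^sub>R fc L d k)"
        using s(2) by (simp add: scaleR_conv_of_real field_simps)
      then have "norm (?Q s) = norm (fc L g k)" using s(2) by (simp flip: \<open>(s - t) *\<^sub>R fc L g k = _\<close>)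
      also have "\<dots> \<le> L2_norm L g / sqrt L" by (rule norm_fc_le[OF gL2])
      finally show ?thesis by (simp add: g_def[abs_def])
    qed
    then show "\<forall>\<^sub>F s in at t within {0..T}. norm (?Q s) \<le> ?R s"
      unfolding eventually_at_filter by (intro always_eventually) auto
  qed
  then show ?thesis unfolding has_vector_derivative_def has_derivative_within by (intro conjI bounded_linear_scaleR_left)
qed

end

section \<open>Propagation of regularity\<close>

context circle
begin

text \<open>The regularity assumed on \<open>[0, T]\<close> supplies the uniform bound
  \<open>M\<close>, the initial data supply the energy at time \<open>0\<close>. Energy of order
  \<open>m\<close> controls \<open>u\<close> at order \<open>m + 1\<close>, since \<open>p\<close>
  belongs to u_z.\<close>

lemma regularity_propagates:
  fixes T :: real and m :: nat
  assumes u: "u \<in> C_V L T 2" and w: "\<omega> \<in> C_V L T 1" and sol: "solves_model L T u \<omega> v"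
    and T: "T > 0" and u0: "u\<^sub>0 \<in> V_space L (m + 1)" and w0: "\<omega>\<^sub>0 \<in> V_space L m"
    and ae: "AE z in lborel. u 0 z = u\<^sub>0 z" "AE z in lborel. \<omega> 0 z = \<omega>\<^sub>0 z"
  shows "u \<in> C_V L T (m + 1) \<and> \<omega> \<in> C_V L T m"
proof -
  define \<kappa> where "\<kappa> = 2 * pi / L"
  have \<kappa>: "\<kappa> > 0" using L_pos by (simp add: \<kappa>_def)
  have frq: "frq L k = \<i> * \<kappa> * k" for k by (simp add: frq_def \<kappa>_def)
  define p where "p t k = fc L (weak_deriv L 1 (u t)) k" for t k
  define q where "q t k = fc L (\<omega> t) k" for t k
  define vh where "vh t k = fc L (v t) k" for t k
  define dp where "dp t k = frq L k * fc L (\<lambda>z. - (v t z * weak_deriv L 1 (u t) z)) k" for t k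
  define dq where "dq t k = fc L (\<lambda>z. weak_deriv L 1 (u t) z - v t z * weak_deriv L 1 (\<omega> t) z) k" for t k
  have uV: "u t \<in> V_space L 2" and wV: "\<omega> t \<in> V_space L 1" if "t \<in> {0..T}" for t using u w that by (auto simp: C_V_def)
  have uL2: "u t \<in> L2 L" and u_0: "fc L (u t) 0 = 0" and wL2: "\<omega> t \<in> L2 L" and w_0: "fc L (\<omega> t) 0 = 0" if "t \<in> {0..T}" for t
    using uV[OF that] wV[OF that] by (auto simp: V_space_iff)
  have du: "has_weak_deriv L 1 (u t) (weak_deriv L 1 (u t))" if "t \<in> {0..T}" for t
    by (rule has_weak_deriv_weak_deriv[of _ 2]) (use uV[OF that] in \<open>auto simp: V_space_def\<close>)
  have dw: "has_weak_deriv L 1 (\<omega> t) (weak_deriv L 1 (\<omega> t))" if "t \<in> {0..T}" for t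
    by (rule has_weak_deriv_weak_deriv[of _ 1]) (use wV[OF that] in \<open>auto simp: V_space_def\<close>)
  have duL2: "weak_deriv L 1 (u t) \<in> L2 L" and dwL2: "weak_deriv L 1 (\<omega> t) \<in> L2 L" if "t \<in> {0..T}" for t
    using du[OF that] dw[OF that] by (auto simp: has_weak_deriv_def)
  have p_eq_u: "p t k = frq L k * fc L (u t) k" if "t \<in> {0..T}" for t k
    using has_weak_deriv_imp_fc[OF du[OF that], of k] by (simp add: p_def)
  have dw_eq: "fc L (weak_deriv L 1 (\<omega> t)) k = frq L k * q t k" if "t \<in> {0..T}" for t k
    using has_weak_deriv_imp_fc[OF dw[OF that], of k] by (simp add: q_def)
  have dv: "has_weak_deriv L 1 (v t) (hilbert L (\<omega> t))"
    and tu: "has_time_deriv L T u (\<lambda>z. - (v t z * weak_deriv L 1 (u t) z)) t"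
    and tw: "has_time_deriv L T \<omega> (\<lambda>z. weak_deriv L 1 (u t) z - v t z * weak_deriv L 1 (\<omega> t) z) t" if "t \<in> {0..T}" for t
    using sol that by (auto simp: solves_model_def is_velocity_def)
  have vL2: "v t \<in> L2 L" if "t \<in> {0..T}" for t using dv[OF that] by (simp add: has_weak_deriv_def)
  obtain B2 where B2: "\<And>t J. t \<in> {0..T} \<Longrightarrow> sobolev_sum 2 (u t) J \<le> B2" using C_V_bounded[OF u] by blast
  obtain B1 where B1: "\<And>t J. t \<in> {0..T} \<Longrightarrow> sobolev_sum 1 (\<omega> t) J \<le> B1" using C_V_bounded[OF w] by blast
  \<comment> \<open>\<open>p\<close> is \<open>u\<close> with one derivative, so its squared H^1
    seminorm carries an extra \<open>\<kappa>\<^sup>2\<close> against the sum of order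
    \<open>2\<close> for \<open>u\<close>.\<close>
  define M where "M = max (\<kappa>\<^sup>2 * B2) B1"
  interpret spectral_flow \<kappa> T M p q vh dp dq
  proof
    show "\<kappa> > 0" by (rule \<kappa>)
  next
    fix t assume t: "t \<in> {0..T}"
    show "p t 0 = 0" using p_eq_u[OF t] u_0[OF t] by simp
    show "q t 0 = 0" using w_0[OF t] by (simp add: q_def)
    show "vh t (- j) = cnj (vh t j)" for j by (simp add: vh_def fc_cnj)
    show "\<kappa> * \<bar>real_of_int j\<bar> * cmod (vh t j) \<le> cmod (q t j)" for j
    proof -
      \<comment> \<open>Measurability of the pointwise principal value comes from its role as weak
        derivative of \<open>v t\<close>.\<close>
      have "hilbert L (\<omega> t) \<in> L2 L" using dv[OF t] by (simp add: has_weak_deriv_def)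
      then have "fc L (hilbert L (\<omega> t)) j = - \<i> * of_int (sgn j) * q t j"
        using fc_hilbert[OF wV[OF t], of j] L2_measurable by (simp add: q_def)
      moreover have "fc L (hilbert L (\<omega> t)) j = frq L j * vh t j" using has_weak_deriv_imp_fc[OF dv[OF t], of j] by (simp add: vh_def)
      ultimately have "cmod (frq L j * vh t j) = cmod (- \<i> * of_int (sgn j) * q t j)" by simp
      then have "\<kappa> * \<bar>real_of_int j\<bar> * cmod (vh t j) = \<bar>real_of_int (sgn j)\<bar> * cmod (q t j)"
        using \<kappa> by (simp add: frq norm_mult)
      also have "\<dots> \<le> cmod (q t j)" by (simp add: sgn_if)
      finally show ?thesis .
    qed
    fix F :: "int set" assume F: "finite F"
    obtain J where J: "F \<subseteq> symint J" using finite_subset_symint[OF F] by metis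
    have "(\<Sum>k\<in>F. (\<bar>real_of_int k\<bar> * cmod (p t k))\<^sup>2) \<le> (\<Sum>k\<in>symint J. (\<bar>real_of_int k\<bar> * cmod (p t k))\<^sup>2)"
      using J by (intro sum_mono2) auto
    also have "\<dots> = \<kappa>\<^sup>2 * sobolev_sum 2 (u t) J" unfolding sobolev_sum_def sum_distrib_left p_eq_u[OF t]
      using \<kappa> by (intro sum.cong refl) (simp add: frq norm_mult power_mult_distrib mult_ac flip: power_add)
    also have "\<dots> \<le> M" using B2[OF t, of J] by (auto simp: M_def intro: order.trans[OF mult_left_mono])
    finally show "(\<Sum>k\<in>F. (\<bar>real_of_int k\<bar> * cmod (p t k))\<^sup>2) \<le> M" .
    have "(\<Sum>k\<in>F. (\<bar>real_of_int k\<bar> * cmod (q t k))\<^sup>2) \<le> (\<Sum>k\<in>symint J. (\<bar>real_of_int k\<bar> * cmod (q t k))\<^sup>2)"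
      using J by (intro sum_mono2) auto
    also have "\<dots> = sobolev_sum 1 (\<omega> t) J" unfolding sobolev_sum_def q_def by (simp add: power_mult_distrib)
    also have "\<dots> \<le> M" using B1[OF t, of J] by (simp add: M_def)
    finally show "(\<Sum>k\<in>F. (\<bar>real_of_int k\<bar> * cmod (q t k))\<^sup>2) \<le> M" .
  next
    fix t k assume t: "t \<in> {0..T}"
    let ?vu = "\<lambda>z. v t z * weak_deriv L 1 (u t) z" and ?vw = "\<lambda>z. v t z * weak_deriv L 1 (\<omega> t) z"
    have "((\<lambda>s. frq L k * fc L (u s) k) has_vector_derivative dp t k) (at t within {0..T})"
      unfolding dp_def by (intro has_vector_derivative_mult_right has_time_deriv_imp_fc tu t)
    then show "((\<lambda>s. p s k) has_vector_derivative dp t k) (at t within {0..T})"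
      by (rule has_vector_derivative_transform[OF t, rotated]) (rule p_eq_u)
    show "((\<lambda>s. q s k) has_vector_derivative dq t k) (at t within {0..T})" unfolding dq_def q_def by (intro has_time_deriv_imp_fc tw t)
    have vu: "integrable (circ L) ?vu"
      and vw: "integrable (circ L) ?vw"
      by (intro L2_mult_integrable vL2 duL2 dwL2 t)+
    have "(\<lambda>J. \<Sum>l\<in>symint J. fc L (v t) (k - l) * fc L (weak_deriv L 1 (u t)) l) \<longlonglongrightarrow> fc L ?vu k"
      by (rule fc_mult[OF vL2[OF t] duL2[OF t]])
    then have "(\<lambda>J. frq L k * (\<Sum>l\<in>symint J. vh t (k - l) * p t l)) \<longlonglongrightarrow> frq L k * fc L ?vu k"
      unfolding vh_def p_def by (intro tendsto_mult tendsto_const)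
    moreover have "frq L k * fc L ?vu k = - dp t k" using fc_add[OF vu vu, of "- 1" 0 k] by (simp add: dp_def)
    \<comment> \<open>The product rule: \<open>k = l + (k - l)\<close> splits the outer
      derivative.\<close>
    moreover have "frq L k * (\<Sum>l\<in>symint J. vh t (k - l) * p t l) = advect \<kappa> (vh t) (p t) J k
      + stretch \<kappa> (vh t) (p t) J k" for J
      unfolding sum_distrib_left sum.distrib[symmetric] frq by (intro sum.cong refl) (simp add: algebra_simps)
    ultimately show "(\<lambda>J. advect \<kappa> (vh t) (p t) J k
      + stretch \<kappa> (vh t) (p t) J k) \<longlonglongrightarrow> - dp t k" by (simp only:)
    have "(\<lambda>J. \<Sum>l\<in>symint J. fc L (v t) (k - l) * fc L (weak_deriv L 1 (\<omega> t)) l) \<longlonglongrightarrow> fc L ?vw k"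
      by (rule fc_mult[OF vL2[OF t] dwL2[OF t]])
    moreover have "fc L ?vw k = p t k - dq t k" using fc_add[OF L2_integrable[OF duL2[OF t]] vw, of 1 "- 1" k] by (simp add: dq_def p_def)
    moreover have "(\<Sum>l\<in>symint J. fc L (v t) (k - l) * fc L (weak_deriv L 1 (\<omega> t)) l) = advect \<kappa> (vh t) (q t) J k" for J
      by (intro sum.cong refl) (simp only: vh_def dw_eq[OF t] frq mult_ac)
    ultimately show "(\<lambda>J. \<Sum>l\<in>symint J. vh t (k - l) * (\<i> * \<kappa> * l) * q t l) \<longlonglongrightarrow> p t k - dq t k" by (simp only:)
  qed
  have pu: "(\<Sum>k\<in>symint J. (\<bar>real_of_int k\<bar> ^ m)\<^sup>2 * (cmod (frq L k * x k))\<^sup>2) = \<kappa>\<^sup>2 * (\<Sum>k\<in>symint J. (real_of_int k) ^ (2 * (m + 1)) * (cmod (x k))\<^sup>2)" for J x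
    unfolding sum_distrib_left
  proof (intro sum.cong refl)
    fix k
    have "(\<bar>real_of_int k\<bar> ^ m)\<^sup>2 = (real_of_int k) ^ (2 * m)" by (simp add: power_mult[symmetric] mult.commute power_even_abs)
    then show "(\<bar>real_of_int k\<bar> ^ m)\<^sup>2 * (cmod (frq L k * x k))\<^sup>2 = \<kappa>\<^sup>2 * ((real_of_int k) ^ (2 * (m + 1)) * (cmod (x k))\<^sup>2)"
      using \<kappa> by (simp add: frq norm_mult power_mult_distrib power_add power2_eq_square mult_ac)
  qed
  have qw: "(\<Sum>k\<in>symint J. (\<bar>real_of_int k\<bar> ^ m)\<^sup>2 * (cmod (x k))\<^sup>2) = (\<Sum>k\<in>symint J. (real_of_int k) ^ (2 * m) * (cmod (x k))\<^sup>2)" for J and x :: "int \<Rightarrow> complex"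
    by (intro sum.cong refl) (simp add: power_mult[symmetric] mult.commute power_even_abs)
  have sob_eq: "sob m (symint J) t = \<kappa>\<^sup>2 * sobolev_sum (m + 1) (u t) J + sobolev_sum m (\<omega> t) J" if "t \<in> {0..T}" for t J
    unfolding sob_def sobolev_sum_def ring_distribs sum.distrib p_eq_u[OF that] pu by (simp add: q_def qw)
  have zero: "0 \<in> {0..T}" using T by simp
  \<comment> \<open>Only coefficients enter, so agreement with the initial data almost everywhere is
    enough.\<close>
  have init: "sobolev_sum n (u 0) J = sobolev_sum n u\<^sub>0 J" "sobolev_sum n (\<omega> 0) J = sobolev_sum n \<omega>\<^sub>0 J" for n J
    using fc_cong_AE[OF AE_circ[OF ae(1)]] fc_cong_AE[OF AE_circ[OF ae(2)]] uL2[OF zero] wL2[OF zero] u0 w0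
    by (auto simp: sobolev_sum_def V_space_iff L2_measurable)
  obtain A1 A2 where A: "\<And>J. sobolev_sum (m + 1) u\<^sub>0 J \<le> A1" "\<And>J. sobolev_sum m \<omega>\<^sub>0 J \<le> A2"
    using u0 w0 by (auto simp: V_space_iff)
  have sob_0: "sob m F 0 \<le> \<kappa>\<^sup>2 * A1 + A2" if F: "finite F" for F
  proof -
    obtain J where J: "F \<subseteq> symint J" using finite_subset_symint[OF F] by metis
    have "sob m F 0 \<le> sob m (symint J) 0" unfolding sob_def using J by (intro sum_mono2) auto
    also have "\<dots> \<le> \<kappa>\<^sup>2 * A1 + A2" unfolding sob_eq[OF zero] init by (intro add_mono mult_left_mono A) auto
    finally show ?thesis .
  qed
  define B where "B = (\<kappa>\<^sup>2 * A1 + A2) * exp (rate m * T)"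
  have B: "sob m F t \<le> B" if "t \<in> {0..T}" "finite F" for F t unfolding B_def using sob_0 that by (intro sob_bound)
  have nonneg: "sobolev_sum n f J \<ge> 0" for n f J unfolding sobolev_sum_def by (intro sum_nonneg) (simp add: zero_le_even_power)
  have uV': "u t \<in> V_space L (m + 1)" and wV': "\<omega> t \<in> V_space L m" if t: "t \<in> {0..T}" for t
  proof -
    have "sobolev_sum (m + 1) (u t) J \<le> B / \<kappa>\<^sup>2" "sobolev_sum m (\<omega> t) J \<le> B" for J
    proof -
      have le: "\<kappa>\<^sup>2 * sobolev_sum (m + 1) (u t) J + sobolev_sum m (\<omega> t) J \<le> B"
        using B[OF t, of "symint J"] by (simp add: sob_eq[OF t])
      have "\<kappa>\<^sup>2 * sobolev_sum (m + 1) (u t) J \<ge> 0" by (intro mult_nonneg_nonneg nonneg) simp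
      then show "sobolev_sum m (\<omega> t) J \<le> B" using le by linarith
      have "\<kappa>\<^sup>2 * sobolev_sum (m + 1) (u t) J \<le> B" using le nonneg[of m "\<omega> t" J] by linarith
      then show "sobolev_sum (m + 1) (u t) J \<le> B / \<kappa>\<^sup>2" using \<kappa> by (simp add: pos_le_divide_eq mult.commute)
    qed
    then show "u t \<in> V_space L (m + 1)" "\<omega> t \<in> V_space L m"
      using uL2[OF t] u_0[OF t] wL2[OF t] w_0[OF t] by (auto simp: V_space_iff simp del: add_Suc_right)
  qed
  let ?SU = "\<lambda>s t. sobolev_sum (m + 1) (\<lambda>z. u s z - u t z)" and ?SW = "\<lambda>s t. sobolev_sum m (\<lambda>z. \<omega> s z - \<omega> t z)"
  have small: "\<forall>\<^sub>F s in at t within {0..T}. (\<forall>J. ?SU s t J \<le> e) \<and> (\<forall>J. ?SW s t J \<le> e)"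
    if t: "t \<in> {0..T}" and e: "e > 0" for t e
  proof -
    \<comment> \<open>Chosen so that \<open>9 * e'\<close>, the bound of
      \<open>sob_difference_small\<close>, is at most \<open>e\<close> for omega and at most
      \<open>\<kappa>\<^sup>2 * e\<close> for \<open>u\<close>.\<close>
    define e' where "e' = min (\<kappa>\<^sup>2 * e) e / 9"
    have e': "e' > 0" "9 * e' \<le> \<kappa>\<^sup>2 * e" "9 * e' \<le> e" using e \<kappa> by (auto simp: e'_def)
    have "\<forall>\<^sub>F s in at t within {0..T}. s \<in> {0..T}" by (simp add: eventually_at_filter)
    moreover have "\<forall>\<^sub>F s in at t within {0..T}. \<forall>F. finite F \<longrightarrow>
      (\<Sum>k\<in>F. (\<bar>real_of_int k\<bar> ^ m)\<^sup>2 * intensity_diff s t k) \<le> 9 * e'"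
      by (rule sob_difference_small) (erule (1) B, rule t, rule e'(1))
    ultimately show ?thesis
    proof eventually_elim
      case (elim s)
      have "?SU s t J \<le> e \<and> ?SW s t J \<le> e" for J
      proof -
        let ?U = "?SU s t J" and ?W = "?SW s t J"
        have du: "p s k - p t k = frq L k * fc L (\<lambda>z. u s z - u t z) k" for k
          by (simp only: p_eq_u[OF elim(1)] p_eq_u[OF t] sobolev_sum_diff(1)[OF uL2[OF elim(1)] uL2[OF t]] right_diff_distrib)
        have dw: "q s k - q t k = fc L (\<lambda>z. \<omega> s z - \<omega> t z) k" for k
          by (simp only: q_def sobolev_sum_diff(1)[OF wL2[OF elim(1)] wL2[OF t]])
        have eq: "(\<Sum>k\<in>symint J. (\<bar>real_of_int k\<bar> ^ m)\<^sup>2 * intensity_diff s t k) = \<kappa>\<^sup>2 * ?U + ?W"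
          unfolding ring_distribs sum.distrib du dw pu qw sobolev_sum_def by (rule refl)
        have le: "\<kappa>\<^sup>2 * ?U + ?W \<le> 9 * e'" unfolding eq[symmetric] by (rule elim(2)[rule_format]) simp
        have "\<kappa>\<^sup>2 * ?U \<ge> 0" by (intro mult_nonneg_nonneg nonneg) simp
        then have W: "?W \<le> e" using le e' by linarith
        have "\<kappa>\<^sup>2 * ?U \<le> \<kappa>\<^sup>2 * e" using le nonneg[of m "\<lambda>z. \<omega> s z - \<omega> t z" J] e' by linarith
        then show ?thesis using W \<kappa> by simp
      qed
      then show ?case by blast
    qed
  qed
  have conv: "((\<lambda>s. V_norm L n (\<lambda>z. f s z - f t z)) \<longlongrightarrow> 0) (at t within {0..T})"
    if t: "t \<in> {0..T}" and f: "\<And>t. t \<in> {0..T} \<Longrightarrow> f t \<in> V_space L n"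
      and ev: "\<And>e. e > 0 \<Longrightarrow> \<forall>\<^sub>F s in at t within {0..T}. \<forall>J. sobolev_sum n (\<lambda>z. f s z - f t z) J \<le> e" for n f t
  proof (rule tendstoI)
    fix e :: real assume e: "e > 0"
    define \<gamma> where "\<gamma> = L * (2 * pi / L) ^ (2 * n)"
    have \<gamma>: "\<gamma> > 0" using L_pos by (simp add: \<gamma>_def)
    \<comment> \<open>The extra factor \<open>2\<close> makes the final inequality strict.\<close>
    have "e\<^sup>2 / (2 * \<gamma>) > 0" using e \<gamma> by simp
    from ev[OF this] have "\<forall>\<^sub>F s in at t within {0..T}. \<forall>J. sobolev_sum n (\<lambda>z. f s z - f t z) J \<le> e\<^sup>2 / (2 * \<gamma>)" .
    moreover have "\<forall>\<^sub>F s in at t within {0..T}. s \<in> {0..T}" by (simp add: eventually_at_filter)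
    ultimately show "\<forall>\<^sub>F s in at t within {0..T}. dist (V_norm L n (\<lambda>z. f s z - f t z)) 0 < e"
    proof eventually_elim
      case (elim s)
      have "(\<lambda>z. f s z - f t z) \<in> sobolev L n" using f[OF elim(2)] f[OF t] by (intro sobolev_diff) (auto simp: V_space_def)
      then have "(V_norm L n (\<lambda>z. f s z - f t z))\<^sup>2 \<le> \<gamma> * (e\<^sup>2 / (2 * \<gamma>))"
        unfolding \<gamma>_def[symmetric] using V_norm_le elim(1) unfolding \<gamma>_def by blast
      also have "\<dots> < e\<^sup>2" using \<gamma> e by simp
      finally have "V_norm L n (\<lambda>z. f s z - f t z) < e" using e by (simp add: power2_less_imp_less)
      then show ?case using V_norm_nonneg[of n "\<lambda>z. f s z - f t z"] by simp
    qed
  qed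
  have "u \<in> C_V L T (m + 1)" unfolding C_V_def mem_Collect_eq
  proof (intro conjI ballI)
    fix t assume t: "t \<in> {0..T}"
    show "u t \<in> V_space L (m + 1)" by (rule uV'[OF t])
    show "((\<lambda>s. V_norm L (m + 1) (\<lambda>z. u s z - u t z)) \<longlongrightarrow> 0) (at t within {0..T})"
      by (rule conv[OF t uV']) (auto intro: eventually_mono[OF small[OF t]])
  qed
  moreover have "\<omega> \<in> C_V L T m" unfolding C_V_def mem_Collect_eq
  proof (intro conjI ballI)
    fix t assume t: "t \<in> {0..T}"
    show "\<omega> t \<in> V_space L m" by (rule wV'[OF t])
    show "((\<lambda>s. V_norm L m (\<lambda>z. \<omega> s z - \<omega> t z)) \<longlongrightarrow> 0) (at t within {0..T})"
      by (rule conv[OF t wV']) (auto intro: eventually_mono[OF small[OF t]])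
  qed
  ultimately show ?thesis by blast
qed

end

theorem theorem2p2:
  fixes L T :: real and m :: nat
    and u \<omega> v :: "real \<Rightarrow> real \<Rightarrow> real" and u\<^sub>0 \<omega>\<^sub>0 :: "real \<Rightarrow> real"
  assumes "L > 0" and "T > 0" and "m \<ge> 1"
    and "u \<in> C_V L T 2" and "\<omega> \<in> C_V L T 1"
    and "solves_model L T u \<omega> v"
    and "u\<^sub>0 \<in> V_space L (m + 1)" and "\<omega>\<^sub>0 \<in> V_space L m"
    and "AE z in lborel. u 0 z = u\<^sub>0 z" and "AE z in lborel. \<omega> 0 z = \<omega>\<^sub>0 z"
  shows "u \<in> C_V L T (m + 1) \<and> \<omega> \<in> C_V L T m \<and>
    (u\<^sub>0 \<in> C_infinity L \<and> \<omega>\<^sub>0 \<in> C_infinity L \<longrightarrow>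
      (\<forall>t\<in>{0..T}. u t \<in> C_infinity L \<and> \<omega> t \<in> C_infinity L))"
proof (intro conjI impI ballI)
  interpret circle L by unfold_locales fact
  note reg = regularity_propagates[OF assms(4,5,6,2) _ _ assms(9,10)]
  show "u \<in> C_V L T (m + 1)" "\<omega> \<in> C_V L T m" using reg[OF assms(7,8)] by auto
  fix t assume C: "u\<^sub>0 \<in> C_infinity L \<and> \<omega>\<^sub>0 \<in> C_infinity L" and t: "t \<in> {0..T}"
  \<comment> \<open>Smooth data lie in every space, so the propagation applies with each
    \<open>n\<close> in place of \<open>m\<close>.\<close>
  have V: "u \<in> C_V L T (n + 1) \<and> \<omega> \<in> C_V L T n" for n
    using C assms(7,8) by (intro reg smooth_imp_V_space[where j = n] smooth_imp_V_space[where j = "n + 1"]) auto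
  have "u t \<in> V_space L n" for n
  proof -
    have "u t \<in> V_space L (n + 1)" using V[of n] t by (simp add: C_V_def)
    then show ?thesis by (auto simp: V_space_def sobolev_def)
  qed
  then show "u t \<in> C_infinity L" by (rule V_space_imp_smooth)
  have "\<omega> t \<in> V_space L n" for n using V[of n] t by (simp add: C_V_def)
  then show "\<omega> t \<in> C_infinity L" by (rule V_space_imp_smooth)
qed

end
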